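(* Let $n\ge3$. For every $m\in\mathbb{N}$, $\mathbb{Z}^m$ quasi-isometrically embeds into the edge splitting graph $\mathrm{ES}_n$.
   Context: The edge splitting graph $\mathrm{ES}_n$ has as vertices the equivalence classes of unordered pairs $\{A,B\}$ of nontrivial subgroups of $F_n$ with $F_n=A*B$, where $\{A,B\}$ is identified with $\{gAg^{-1},gBg^{-1}\}$ for $g\in F_n$. Whenever $F_n=A*B*C$ with $A,B,C$ nontrivial, there is an edge between the vertices $\{A*B,C\}$ and $\{A,B*C\}$. It carries the path metric with edges of length $1$; $\mathbb Z^m$ has the $\ell^1$ metric. *)

theory Defs
  imports "HOL-Algebra.Algebra" "HOL-Library.Extended_Nat"
begin

text \<open>Letters are pairs (i, b): generator i with exponent +1 (b = True) or -1 (b = False).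
Elements of F_n are freely reduced words.\<close>

type_synonym fword = "(nat \<times> bool) list"

definition cancels :: "nat \<times> bool \<Rightarrow> nat \<times> bool \<Rightarrow> bool" where
  "cancels x y \<longleftrightarrow> fst x = fst y \<and> snd x \<noteq> snd y"

fun freduced :: "fword \<Rightarrow> bool" where
  "freduced [] = True"
| "freduced [x] = True"
| "freduced (x # y # r) = (\<not> cancels x y \<and> freduced (y # r))"

definition fmult :: "fword \<Rightarrow> fword \<Rightarrow> fword" where
  "fmult xs ys = foldr (\<lambda>x acc. case acc of [] \<Rightarrow> [x]
       | y # r \<Rightarrow> (if cancels x y then r else x # acc)) xs ys"

definition free_group :: "nat \<Rightarrow> fword monoid" where
  "free_group n = \<lparr> carrier = {w. freduced w \<and> (\<forall>x \<in> set w. fst x < n)},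
                   monoid.mult = fmult, one = [] \<rparr>"

definition is_free_product :: "('a, 'b) monoid_scheme \<Rightarrow> 'a set list \<Rightarrow> bool" where
  "is_free_product G Hs \<longleftrightarrow>
     (\<forall>H \<in> set Hs. subgroup H G) \<and>
     generate G (\<Union> (set Hs)) = carrier G \<and>
     (\<forall>es :: (nat \<times> 'a) list. es \<noteq> [] \<longrightarrow>
        (\<forall>j < length es. fst (es ! j) < length Hs \<and>
                          snd (es ! j) \<in> Hs ! fst (es ! j) - {\<one>\<^bsub>G\<^esub>}) \<longrightarrow>
        (\<forall>j. Suc j < length es \<longrightarrow> fst (es ! j) \<noteq> fst (es ! Suc j)) \<longrightarrow>
        foldr (\<lambda>e acc. snd e \<otimes>\<^bsub>G\<^esub> acc) es \<one>\<^bsub>G\<^esub> \<noteq> \<one>\<^bsub>G\<^esub>)"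

definition nontrivial_sub :: "('a, 'b) monoid_scheme \<Rightarrow> 'a set \<Rightarrow> bool" where
  "nontrivial_sub G H \<longleftrightarrow> H \<noteq> {\<one>\<^bsub>G\<^esub>}"

definition free_splittings :: "nat \<Rightarrow> fword set set set" where
  "free_splittings n = {{A, B} | A B. nontrivial_sub (free_group n) A \<and>
      nontrivial_sub (free_group n) B \<and> is_free_product (free_group n) [A, B]}"

definition conj_sub :: "nat \<Rightarrow> fword \<Rightarrow> fword set \<Rightarrow> fword set" where
  "conj_sub n g H = (\<lambda>h. g \<otimes>\<^bsub>free_group n\<^esub> h \<otimes>\<^bsub>free_group n\<^esub> m_inv (free_group n) g) ` H"

definition conj_class :: "nat \<Rightarrow> fword set set \<Rightarrow> fword set set set" where
  "conj_class n P = {conj_sub n g ` P | g. g \<in> carrier (free_group n)}"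

definition ES_vertices :: "nat \<Rightarrow> fword set set set set" where
  "ES_vertices n = conj_class n ` free_splittings n"

definition ES_edge :: "nat \<Rightarrow> fword set set set \<Rightarrow> fword set set set \<Rightarrow> bool" where
  "ES_edge n V1 V2 \<longleftrightarrow> (\<exists>H1 H2 H3.
      nontrivial_sub (free_group n) H1 \<and> nontrivial_sub (free_group n) H2 \<and>
      nontrivial_sub (free_group n) H3 \<and> is_free_product (free_group n) [H1, H2, H3] \<and>
      ((V1 = conj_class n {generate (free_group n) (H1 \<union> H2), H3} \<and>
        V2 = conj_class n {H1, generate (free_group n) (H2 \<union> H3)}) \<or>
       (V2 = conj_class n {generate (free_group n) (H1 \<union> H2), H3} \<and>
        V1 = conj_class n {H1, generate (free_group n) (H2 \<union> H3)})))"

definition ES_walk :: "nat \<Rightarrow> fword set set set \<Rightarrow> fword set set set \<Rightarrow> nat \<Rightarrow> bool" where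
  "ES_walk n V1 V2 k \<longleftrightarrow> (\<exists>ps. length ps = Suc k \<and> ps ! 0 = V1 \<and> ps ! k = V2 \<and>
      (\<forall>i < k. ES_edge n (ps ! i) (ps ! Suc i)))"

text \<open>Path metric (\<infinity> if no path).\<close>
definition ES_dist :: "nat \<Rightarrow> fword set set set \<Rightarrow> fword set set set \<Rightarrow> enat" where
  "ES_dist n V1 V2 = Inf {enat k | k. ES_walk n V1 V2 k}"

definition l1_dist :: "int list \<Rightarrow> int list \<Rightarrow> real" where
  "l1_dist x y = (\<Sum>i < length x. real_of_int \<bar>x ! i - y ! i\<bar>)"

definition qi_embeds_Zm_ES :: "nat \<Rightarrow> nat \<Rightarrow> bool" where
  "qi_embeds_Zm_ES m n \<longleftrightarrow> (\<exists>(f :: int list \<Rightarrow> fword set set set) (K::real) (C::real).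
      K \<ge> 1 \<and> C \<ge> 0 \<and>
      (\<forall>x. length x = m \<longrightarrow> f x \<in> ES_vertices n) \<and>
      (\<forall>x y. length x = m \<longrightarrow> length y = m \<longrightarrow>
         ES_dist n (f x) (f y) \<noteq> \<infinity> \<and>
         l1_dist x y / K - C \<le> real (the_enat (ES_dist n (f x) (f y))) \<and>
         real (the_enat (ES_dist n (f x) (f y))) \<le> K * l1_dist x y + C))"

end

theory Submission
  imports Defs "HOL-Library.Sublist"
begin

text \<open>
  Let \<open>x\<close> be the last generator and \<open>B\<close> the free factor generated by the others. For \<open>w\<close> in \<open>B\<close> consider
  the splitting \<open>{<x w>, B}\<close>. Multiplying \<open>w\<close> on the right by a conjugate of a letter moves this vertex by
  at most two edges, through \<open>{<x w, y>, B'}\<close>; so distances are bounded above by a conjugation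
  invariant word length on \<open>B\<close>.

  For the lower bound, attach to a splitting \<open>{A, C}\<close> the set of its segments: all \<open>b\<close> in \<open>B\<close> for which
  \<open>x b x\<close> occurs in a cyclically reduced word conjugate into \<open>A\<close> or \<open>C\<close>. Adjacent splittings share a
  segment, because one of the three factors contains an element with nonzero exponent sum in \<open>x\<close>. By
  Whitehead's cut vertex lemma, applied repeatedly after automorphisms \<open>x \<mapsto> l x r\<close>, any two segments
  of one splitting have the form \<open>p c q\<close> and \<open>p c' q\<close> where neither \<open>c\<close> nor \<open>c'\<close> has a complete
  Whitehead graph. A Brooks counting quasimorphism for a word with complete Whitehead graph vanishes on
  such \<open>c\<close>, so it varies by a bounded amount along every edge. Since \<open>w\<close> is a segment of \<open>{<x w>, B}\<close>,
  products of powers of \<open>m\<close> words that are independent under such quasimorphisms form a quasiflat.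
\<close>

section \<open>Reduced words\<close>

text \<open>One splitting can have infinitely many, arbitrarily long segments, so they cannot be
  compared letter by letter. One half-space governs all of them at once, however: a single cut
  vertex dictates which letters to strip from any two segments, and this is why the outer words
  \<open>p\<close> and \<open>q\<close> are common. A complete Whitehead graph on the letters of
  \<open>B\<close> stays connected whichever vertex is deleted, so the disconnection must occur at
  \<open>x\<close> or its inverse; this makes the stripping possible. The automorphisms
  \<open>x \<mapsto> l x r\<close> are the right tool because they fix \<open>B\<close> pointwise
  and turn a segment \<open>b\<close> into \<open>r b l\<close>. Half-spaces are abstract sets with
  finite coboundary, and not sides of edges in a Bass-Serre tree, so that their images under these
  automorphisms qualify without further work. Conjugation invariance in the upper bound is forced:
  changing the exponent of a middle factor in a product of powers multiplies on the right by a
  conjugate whose word length depends on the whole tail. The assumption \<open>n \<ge> 3\<close>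
  gives \<open>B\<close> rank at least 2, which independent counting functions require.\<close>

type_synonym letter = "nat \<times> bool"

definition flip :: "letter \<Rightarrow> letter" where
  "flip x = (fst x, \<not> snd x)"

definition finv :: "fword \<Rightarrow> fword" where
  "finv w = rev (map flip w)"

text \<open>Left multiplication by one letter. Treating it as an action on reduced words isolates
  the cancellation argument behind associativity.\<close>

definition fstep :: "letter \<Rightarrow> fword \<Rightarrow> fword" where
  "fstep x w = (if w \<noteq> [] \<and> hd w = flip x then tl w else x # w)"

definition fwords :: "nat set \<Rightarrow> fword set" where
  "fwords I = {w. freduced w \<and> fst ` set w \<subseteq> I}"

lemma flip_flip [simp]: "flip (flip x) = x"
  by (simp add: flip_def)

lemma fst_flip [simp]: "fst (flip x) = fst x"
  by (simp add: flip_def)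

lemma flip_neq [simp]: "flip x \<noteq> x" "x \<noteq> flip x"
  by (cases x; simp add: flip_def)+

lemma flip_eq_iff [simp]: "flip x = flip y \<longleftrightarrow> x = y"
  by (metis flip_flip)

lemma flip_Pair [simp]: "flip (i, b) = (i, \<not> b)"
  by (simp add: flip_def)

lemma cancels_iff: "cancels x y \<longleftrightarrow> y = flip x"
  by (cases x; cases y) (auto simp: cancels_def flip_def)

lemma freduced_Cons: "freduced (x # w) \<longleftrightarrow> freduced w \<and> (w = [] \<or> hd w \<noteq> flip x)"
  by (cases w) (auto simp: cancels_iff)

lemma freduced_append:
  "freduced (v @ w) \<longleftrightarrow> freduced v \<and> freduced w \<and> (v = [] \<or> w = [] \<or> hd w \<noteq> flip (last v))"
proof (induction v)
  case (Cons x v)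
  show ?case
    by (cases "v = []") (auto simp: freduced_Cons Cons)
qed simp

lemma fmult_Nil [simp]: "fmult [] w = w"
  by (simp add: fmult_def)

lemma fmult_Cons: "fmult (x # v) w = fstep x (fmult v w)"
  by (auto simp: fmult_def fstep_def cancels_iff split: list.splits)

lemma freduced_fstep: "freduced w \<Longrightarrow> freduced (fstep x w)"
  by (cases w) (auto simp: fstep_def freduced_Cons)

lemma freduced_fmult: "freduced w \<Longrightarrow> freduced (fmult v w)"
  by (induction v) (auto simp: fmult_Cons freduced_fstep)

lemma fstep_flip: "freduced w \<Longrightarrow> fstep x (fstep (flip x) w) = w"
  by (cases w) (auto simp: fstep_def freduced_Cons)

lemma fmult_fstep: "freduced w \<Longrightarrow> fmult (fstep x v) w = fstep x (fmult v w)"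
proof (cases "v \<noteq> [] \<and> hd v = flip x")
  case True
  then obtain v' where v: "v = flip x # v'"
    by (cases v) auto
  assume "freduced w"
  then show ?thesis
    by (simp add: v fmult_Cons fstep_flip freduced_fmult) (simp add: fstep_def)
qed (auto simp: fstep_def fmult_Cons)

text \<open>The maps \<open>fstep x\<close> and \<open>fstep (flip x)\<close> are mutually inverse
  on reduced words, so words act on reduced words and associativity is the action law. Only the word
  acted upon has to be reduced.\<close>

lemma fmult_assoc: "freduced w \<Longrightarrow> fmult (fmult u v) w = fmult u (fmult v w)"
  by (induction u) (auto simp: fmult_Cons fmult_fstep)

lemma fmult_append: "freduced (v @ w) \<Longrightarrow> fmult v w = v @ w"
proof (induction v)
  case (Cons x v)
  then show ?case
    by (simp add: fmult_Cons freduced_Cons) (auto simp: fstep_def)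
qed simp

lemma fmult_Nil_right: "freduced v \<Longrightarrow> fmult v [] = v"
  using fmult_append[of v "[]"] by simp

lemma fst_set_fstep: "fst ` set (fstep x w) \<subseteq> insert (fst x) (fst ` set w)"
  by (cases w) (auto simp: fstep_def)

lemma fst_set_fmult: "fst ` set (fmult v w) \<subseteq> fst ` set v \<union> fst ` set w"
proof (induction v)
  case (Cons x v)
  then show ?case
    using fst_set_fstep[of x "fmult v w"] unfolding fmult_Cons list.set image_insert by blast
qed simp

lemma finv_simps [simp]:
  "finv [] = []" "finv [x] = [flip x]" "finv (v @ w) = finv w @ finv v"
  "finv (x # w) = finv w @ [flip x]" "finv w = [] \<longleftrightarrow> w = []" "length (finv w) = length w"
  by (auto simp: finv_def)

lemma finv_finv [simp]: "finv (finv w) = w"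
  by (induction w) auto

lemma last_finv: "w \<noteq> [] \<Longrightarrow> last (finv w) = flip (hd w)"
  by (cases w) auto

lemma hd_finv: "w \<noteq> [] \<Longrightarrow> hd (finv w) = flip (last w)"
  by (cases w rule: rev_cases) auto

lemma freduced_finv [simp]: "freduced (finv w) = freduced w"
proof -
  have "freduced (finv w)" if "freduced w" for w
    using that by (induction w) (auto simp: freduced_append freduced_Cons last_finv)
  from this[of w] this[of "finv w"] show ?thesis
    by auto
qed

lemma fst_set_finv [simp]: "fst ` set (finv w) = fst ` set w"
  by (induction w) auto

lemma fmult_finv: "freduced w \<Longrightarrow> fmult (finv w) w = []"
proof (induction w)
  case (Cons x w)
  have "fmult (finv (x # w)) (x # w) = fmult (fmult (finv w) [flip x]) (x # w)"
    using Cons.prems by (subst fmult_append) (simp_all del: freduced_finv add: freduced_finv[of "x # w", simplified])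
  also have "\<dots> = fmult (finv w) w"
    using Cons.prems by (subst fmult_assoc) (auto simp: fmult_Cons fstep_def)
  finally show ?case
    using Cons by (simp add: freduced_Cons)
qed simp

lemma fwords_Nil [simp]: "[] \<in> fwords I"
  by (simp add: fwords_def)

lemma fwords_fmult: "v \<in> fwords I \<Longrightarrow> w \<in> fwords I \<Longrightarrow> fmult v w \<in> fwords I"
  using fst_set_fmult[of v w] freduced_fmult[of w v] unfolding fwords_def by blast

lemma fwords_finv [simp]: "finv w \<in> fwords I \<longleftrightarrow> w \<in> fwords I"
  unfolding fwords_def mem_Collect_eq freduced_finv fst_set_finv ..

lemma fwords_mono: "I \<subseteq> J \<Longrightarrow> fwords I \<subseteq> fwords J"
  by (auto simp: fwords_def)

lemma fwords_single [simp]: "[x] \<in> fwords I \<longleftrightarrow> fst x \<in> I"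
  by (auto simp: fwords_def)

lemma carrier_free_group: "carrier (free_group n) = fwords {..<n}"
  by (auto simp: free_group_def fwords_def)

lemma mult_free_group [simp]: "v \<otimes>\<^bsub>free_group n\<^esub> w = fmult v w"
  by (simp add: free_group_def)

lemma one_free_group [simp]: "\<one>\<^bsub>free_group n\<^esub> = []"
  by (simp add: free_group_def)

lemma group_free_group: "group (free_group n)"
proof (rule groupI)
  fix w assume "w \<in> carrier (free_group n)"
  then show "\<exists>y\<in>carrier (free_group n). y \<otimes>\<^bsub>free_group n\<^esub> w = \<one>\<^bsub>free_group n\<^esub>"
    by (intro bexI[of _ "finv w"]) (auto simp: carrier_free_group fmult_finv fwords_def)
qed (simp_all add: carrier_free_group fwords_fmult, simp add: fwords_def fmult_assoc)

lemma inv_free_group: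
  assumes "w \<in> carrier (free_group n)"
  shows "inv\<^bsub>free_group n\<^esub> w = finv w"
proof -
  interpret group "free_group n"
    by (rule group_free_group)
  show ?thesis
    using assms
    by (intro inv_equality) (auto simp: carrier_free_group fmult_finv fwords_def)
qed

lemma subgroup_fwords: "I \<subseteq> {..<n} \<Longrightarrow> subgroup (fwords I) (free_group n)"
proof -
  assume I: "I \<subseteq> {..<n}"
  interpret group "free_group n"
    by (rule group_free_group)
  have *: "fwords I \<subseteq> carrier (free_group n)"
    using fwords_mono[OF I] by (simp add: carrier_free_group)
  show ?thesis
    by (rule subgroupI) (use * in \<open>auto simp: inv_free_group subset_iff fwords_fmult intro: fwords_Nil\<close>)
qed

subsection \<open>Cyclically reduced words\<close>

text \<open>Appending the first letter also tests the junction of the last letter with the first, so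
  powers are plain concatenations.\<close>

definition cyc_reduced :: "fword \<Rightarrow> bool" where
  "cyc_reduced w \<longleftrightarrow> w \<noteq> [] \<and> freduced (w @ [hd w])"

lemma cyc_reduced_imp_freduced: "cyc_reduced w \<Longrightarrow> freduced w"
  by (auto simp: cyc_reduced_def freduced_append)

lemma cyc_reduced_append_commute: "cyc_reduced (v @ w) \<Longrightarrow> cyc_reduced (w @ v)"
  by (cases "v = []"; cases "w = []") (auto simp: cyc_reduced_def freduced_append)

lemma cyc_reduced_finv: "cyc_reduced w \<Longrightarrow> cyc_reduced (finv w)"
  by (auto simp: cyc_reduced_def freduced_append last_finv hd_finv)

lemma cyc_reduced_replicate:
  assumes "cyc_reduced w"
  shows "freduced (concat (replicate k w))"
proof (induction k)
  case (Suc k)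
  have "hd (concat (replicate k w)) = hd w" if "k > 0"
    using that assms by (cases k) (auto simp: cyc_reduced_def)
  then show ?case
    using Suc assms by (cases "k = 0") (auto simp: freduced_append cyc_reduced_def)
qed simp

lemma pow_cyc_reduced:
  assumes "cyc_reduced w" "w \<in> carrier (free_group n)"
  shows "w [^]\<^bsub>free_group n\<^esub> k = concat (replicate k w)"
proof -
  interpret group "free_group n"
    by (rule group_free_group)
  show ?thesis
  proof (induction k)
    case (Suc k)
    have *: "concat (replicate (Suc k) w) = concat (replicate k w) @ w"
      by (simp flip: replicate_append_same)
    show ?case
      using cyc_reduced_replicate[OF assms(1), of "Suc k"] unfolding *
      by (simp add: Suc fmult_append)
  qed simp
qed

section \<open>Half-spaces of free splittings\<close>

text \<open>An almost invariant set: it has finite coboundary in the Cayley graph, whose edges are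
  right multiplications, and it splits the ends of the group into two parts.\<close>

definition halfspace :: "('a, 'b) monoid_scheme \<Rightarrow> 'a set \<Rightarrow> bool" where
  "halfspace G E \<longleftrightarrow> E \<subseteq> carrier G \<and> infinite E \<and> infinite (carrier G - E) \<and>
     (\<forall>s \<in> carrier G. finite {f \<in> carrier G. (f \<in> E) \<noteq> (f \<otimes>\<^bsub>G\<^esub> s \<in> E)})"

text \<open>Every translate of the axis of \<open>w\<close> has both its ends on the same side of \<open>E\<close>.\<close>

definition unseparated :: "('a, 'b) monoid_scheme \<Rightarrow> 'a set \<Rightarrow> 'a \<Rightarrow> bool" where
  "unseparated G E w \<longleftrightarrow> (\<forall>f \<in> carrier G. \<exists>b. \<forall>\<^sub>F k in sequentially.
     (f \<otimes>\<^bsub>G\<^esub> w [^]\<^bsub>G\<^esub> (k::nat) \<in> E) = b \<and> (f \<otimes>\<^bsub>G\<^esub> (inv\<^bsub>G\<^esub> w) [^]\<^bsub>G\<^esub> k \<in> E) = b)"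

definition infinite_order :: "('a, 'b) monoid_scheme \<Rightarrow> 'a \<Rightarrow> bool" where
  "infinite_order G w \<longleftrightarrow> (\<forall>k::nat. k > 0 \<longrightarrow> w [^]\<^bsub>G\<^esub> k \<noteq> \<one>\<^bsub>G\<^esub>)"

definition alternating :: "('a, 'b) monoid_scheme \<Rightarrow> 'a set list \<Rightarrow> (nat \<times> 'a) list \<Rightarrow> bool" where
  "alternating G Hs es \<longleftrightarrow>
     (\<forall>e \<in> set es. fst e < length Hs \<and> snd e \<in> Hs ! fst e - {\<one>\<^bsub>G\<^esub>}) \<and> distinct_adj (map fst es)"

definition gprod :: "('a, 'b) monoid_scheme \<Rightarrow> (nat \<times> 'a) list \<Rightarrow> 'a" where
  "gprod G es = foldr (\<lambda>e acc. snd e \<otimes>\<^bsub>G\<^esub> acc) es \<one>\<^bsub>G\<^esub>"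

text \<open>This plays the role of one side of an edge in the Bass-Serre tree of the splitting into
  factor \<open>i\<close> and the product of the other factors.\<close>

definition starting_with :: "('a, 'b) monoid_scheme \<Rightarrow> 'a set list \<Rightarrow> nat \<Rightarrow> 'a set" where
  "starting_with G Hs i = {gprod G es | es. alternating G Hs es \<and> es \<noteq> [] \<and> fst (hd es) = i}"

lemma is_free_product_alternating:
  "is_free_product G Hs \<longleftrightarrow> (\<forall>H \<in> set Hs. subgroup H G) \<and> generate G (\<Union> (set Hs)) = carrier G \<and>
     (\<forall>es. alternating G Hs es \<longrightarrow> es \<noteq> [] \<longrightarrow> gprod G es \<noteq> \<one>\<^bsub>G\<^esub>)"
proof -
  have alt: "alternating G Hs es \<longleftrightarrow>
      (\<forall>j < length es. fst (es ! j) < length Hs \<and> snd (es ! j) \<in> Hs ! fst (es ! j) - {\<one>\<^bsub>G\<^esub>}) \<and>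
      (\<forall>j. Suc j < length es \<longrightarrow> fst (es ! j) \<noteq> fst (es ! Suc j))" for es
    unfolding alternating_def distinct_adj_conv_nth all_set_conv_all_nth
    by (auto simp: less_diff_conv)
  show ?thesis
    unfolding is_free_product_def gprod_def alt
    by (intro conj_cong refl iff_allI) auto
qed

section \<open>Half-spaces under conjugation and isomorphisms\<close>

context group
begin

lemma inv_cancel [simp]:
  assumes "g \<in> carrier G" "h \<in> carrier G"
  shows "inv g \<otimes> (g \<otimes> h) = h" "g \<otimes> (inv g \<otimes> h) = h"
  using assms by (simp_all flip: m_assoc)

lemma infinite_order_inj:
  assumes "w \<in> carrier G" "infinite_order G w"
  shows "inj (\<lambda>k::nat. w [^] k)"
proof (rule linorder_injI)
  fix j k :: nat assume "j < k"
  then obtain d where d: "k = j + d" "d > 0"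
    using less_imp_add_positive by blast
  show "w [^] j \<noteq> w [^] k"
  proof
    assume "w [^] j = w [^] k"
    then have "w [^] j \<otimes> w [^] d = w [^] j \<otimes> \<one>"
      using assms(1) nat_pow_mult[of w j d] by (simp add: d)
    then have "w [^] d = \<one>"
      using assms(1) by (subst (asm) l_cancel) auto
    then show False
      using assms(2) d by (auto simp: infinite_order_def)
  qed
qed

lemma infinite_order_inv:
  assumes "w \<in> carrier G" "infinite_order G w"
  shows "infinite_order G (inv w)"
  using assms by (auto simp: infinite_order_def nat_pow_inv)

lemma conj_pow:
  assumes "w \<in> carrier G" "g \<in> carrier G"
  shows "(g \<otimes> w \<otimes> inv g) [^] (k::nat) = g \<otimes> w [^] k \<otimes> inv g"
proof (induction k)
  case (Suc k)
  then show ?case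
    using assms Suc by (simp add: m_assoc)
qed (use assms in simp)

lemma infinite_order_conj:
  assumes "w \<in> carrier G" "g \<in> carrier G" "infinite_order G w"
  shows "infinite_order G (g \<otimes> w \<otimes> inv g)"
  unfolding infinite_order_def
proof (intro allI impI notI)
  fix k :: nat assume "k > 0" "(g \<otimes> w \<otimes> inv g) [^] k = \<one>"
  then have "g \<otimes> w [^] k = g \<otimes> \<one>"
    using assms by (simp add: conj_pow inv_solve_right')
  then show False
    using assms \<open>k > 0\<close> by (simp add: infinite_order_def)
qed

lemma eventually_pow_notin_finite:
  assumes "w \<in> carrier G" "f \<in> carrier G" "infinite_order G w" "finite S"
  shows "\<forall>\<^sub>F k in sequentially. f \<otimes> w [^] (k::nat) \<notin> S"
proof -
  have "inj (\<lambda>k::nat. f \<otimes> w [^] k)"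
    using infinite_order_inj[OF assms(1,3)] assms by (auto simp: inj_def)
  then have "finite ((\<lambda>k::nat. f \<otimes> w [^] k) -` S)"
    using assms(4) by (rule finite_vimageI[rotated])
  then obtain m where "\<forall>k \<in> (\<lambda>k::nat. f \<otimes> w [^] k) -` S. k < m"
    using finite_nat_set_iff_bounded by blast
  then have "\<forall>k \<ge> m. k \<notin> (\<lambda>k::nat. f \<otimes> w [^] k) -` S"
    by (meson leD)
  then show ?thesis
    unfolding eventually_sequentially by auto
qed

text \<open>The powers of the conjugate, translated by \<open>f\<close>, are \<open>f g w^k\<close>
  followed by right multiplication by \<open>inv g\<close>, which changes sides at finitely many
  elements only. Infinite order makes the powers leave this finite set, so the limiting sides are
  those of the axis of \<open>w\<close> translated by \<open>f g\<close>.\<close>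

lemma unseparated_conj:
  assumes E: "halfspace G E" and w: "w \<in> carrier G" "infinite_order G w" "unseparated G E w"
    and g: "g \<in> carrier G"
  shows "unseparated G E (g \<otimes> w \<otimes> inv g)"
  unfolding unseparated_def
proof
  fix f assume f: "f \<in> carrier G"
  define D where "D = {f \<in> carrier G. (f \<in> E) \<noteq> (f \<otimes> inv g \<in> E)}"
  have "finite D"
    using E g by (auto simp: halfspace_def D_def)
  then have ev: "\<forall>\<^sub>F k in sequentially. f \<otimes> g \<otimes> v [^] (k::nat) \<notin> D"
    if "v \<in> carrier G" "infinite_order G v" for v
    using eventually_pow_notin_finite[of v "f \<otimes> g" D] that f g by auto
  have eq: "f \<otimes> (g \<otimes> v \<otimes> inv g) [^] (k::nat) = (f \<otimes> g \<otimes> v [^] k) \<otimes> inv g" if "v \<in> carrier G" for v k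
    using that f g by (subst conj_pow) (simp_all add: m_assoc)
  have iw: "inv (g \<otimes> w \<otimes> inv g) = g \<otimes> inv w \<otimes> inv g"
    using w g by (simp add: inv_mult_group m_assoc)
  obtain b where b: "\<forall>\<^sub>F k in sequentially.
      (f \<otimes> g \<otimes> w [^] (k::nat) \<in> E) = b \<and> (f \<otimes> g \<otimes> (inv w) [^] k \<in> E) = b"
    using w(3) f g unfolding unseparated_def by (meson m_closed)
  have "\<forall>\<^sub>F k in sequentially. (f \<otimes> (g \<otimes> w \<otimes> inv g) [^] (k::nat) \<in> E) = b \<and>
      (f \<otimes> (g \<otimes> inv w \<otimes> inv g) [^] k \<in> E) = b"
    using b ev[OF w(1,2)] ev[OF inv_closed[OF w(1)] infinite_order_inv[OF w(1,2)]]
    by eventually_elim (use w f g in \<open>simp add: eq D_def\<close>)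
  then show "\<exists>b. \<forall>\<^sub>F k in sequentially. (f \<otimes> (g \<otimes> w \<otimes> inv g) [^] (k::nat) \<in> E) = b \<and>
      (f \<otimes> (inv (g \<otimes> w \<otimes> inv g)) [^] k \<in> E) = b"
    unfolding iw by blast
qed

lemma halfspace_image:
  assumes \<alpha>: "\<alpha> \<in> iso G G" and E: "halfspace G E"
  shows "halfspace G (\<alpha> ` E)"
proof -
  have bij: "bij_betw \<alpha> (carrier G) (carrier G)" and hom: "\<alpha> \<in> hom G G"
    using \<alpha> by (auto simp: iso_def)
  have sub: "E \<subseteq> carrier G"
    using E by (auto simp: halfspace_def)
  have inj: "inj_on \<alpha> (carrier G)" and surj: "\<alpha> ` carrier G = carrier G"
    using bij by (auto simp: bij_betw_def)
  have mem: "\<alpha> f \<in> \<alpha> ` E \<longleftrightarrow> f \<in> E" if "f \<in> carrier G" for f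
    using that sub inj by (auto simp: inj_on_def)
  have "carrier G - \<alpha> ` E = \<alpha> ` (carrier G - E)"
    using inj_on_image_set_diff[OF inj, of "carrier G" E] sub surj by auto
  moreover have "finite {f \<in> carrier G. (f \<in> \<alpha> ` E) \<noteq> (f \<otimes> s \<in> \<alpha> ` E)}" if s: "s \<in> carrier G" for s
  proof -
    obtain s' where s': "s' \<in> carrier G" "s = \<alpha> s'"
      using s surj by blast
    have "{f \<in> carrier G. (f \<in> \<alpha> ` E) \<noteq> (f \<otimes> s \<in> \<alpha> ` E)} \<subseteq>
        \<alpha> ` {f \<in> carrier G. (f \<in> E) \<noteq> (f \<otimes> s' \<in> E)}"
    proof clarify
      fix f assume f: "f \<in> carrier G" "(f \<in> \<alpha> ` E) \<noteq> (f \<otimes> s \<in> \<alpha> ` E)"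
      then obtain f' where f': "f' \<in> carrier G" "f = \<alpha> f'"
        using surj by blast
      have "f \<otimes> s = \<alpha> (f' \<otimes> s')"
        using f' s' hom by (simp add: hom_mult)
      then have "(f' \<in> E) \<noteq> (f' \<otimes> s' \<in> E)"
        using f f' s' by (simp add: mem)
      then show "f \<in> \<alpha> ` {f \<in> carrier G. (f \<in> E) \<noteq> (f \<otimes> s' \<in> E)}"
        using f' by blast
    qed
    moreover have "finite {f \<in> carrier G. (f \<in> E) \<noteq> (f \<otimes> s' \<in> E)}"
      using E s' by (auto simp: halfspace_def)
    ultimately show ?thesis
      using finite_surj by blast
  qed
  moreover have "infinite (\<alpha> ` E)" "infinite (\<alpha> ` (carrier G - E))"
    using E inj sub unfolding halfspace_def
    by (metis finite_imageD inj_on_subset, metis finite_imageD inj_on_diff)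
  moreover have "\<alpha> ` E \<subseteq> carrier G"
    using sub surj by blast
  ultimately show ?thesis
    unfolding halfspace_def by auto
qed

lemma unseparated_image:
  assumes \<alpha>: "\<alpha> \<in> iso G G" and E: "E \<subseteq> carrier G" and w: "w \<in> carrier G" "unseparated G E w"
  shows "unseparated G (\<alpha> ` E) (\<alpha> w)"
  unfolding unseparated_def
proof
  have iw: "inv w \<in> carrier G"
    using w(1) by simp
  have hom: "\<alpha> \<in> hom G G"
    using \<alpha> by (auto simp: iso_def)
  then interpret group_hom G G \<alpha>
    by unfold_locales
  have inj: "inj_on \<alpha> (carrier G)" and surj: "\<alpha> ` carrier G = carrier G"
    using \<alpha> by (auto simp: iso_def bij_betw_def)
  have mem: "\<alpha> f \<in> \<alpha> ` E \<longleftrightarrow> f \<in> E" if "f \<in> carrier G" for f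
    using that E inj by (auto simp: inj_on_def)
  fix f assume "f \<in> carrier G"
  then obtain f' where f': "f' \<in> carrier G" "f = \<alpha> f'"
    using surj by blast
  have eq: "(\<alpha> f' \<otimes> \<alpha> v [^] k \<in> \<alpha> ` E) = (f' \<otimes> v [^] k \<in> E)"
    if v: "v \<in> carrier G" for v and k :: nat
  proof -
    have "\<alpha> f' \<otimes> \<alpha> v [^] k = \<alpha> (f' \<otimes> v [^] k)"
      using f' v by (simp add: hom_nat_pow)
    then show ?thesis
      using f' v by (simp only: mem m_closed nat_pow_closed)
  qed
  have inv_eq: "inv (\<alpha> w) = \<alpha> (inv w)"
    using w(1) by simp
  show "\<exists>b. \<forall>\<^sub>F k in sequentially. (f \<otimes> \<alpha> w [^] (k::nat) \<in> \<alpha> ` E) = b \<and>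
      (f \<otimes> (inv (\<alpha> w)) [^] k \<in> \<alpha> ` E) = b"
    unfolding f'(2) inv_eq
    unfolding eq[OF w(1)] eq[OF iw]
    using w(2) f'(1) unfolding unseparated_def by blast
qed

end

section \<open>Half-spaces cut out by a free product decomposition\<close>

locale free_product = group G for G (structure) +
  fixes Hs :: "'a set list"
  assumes is_free_product: "is_free_product G Hs"
begin

lemma subgroup_factor: "i < length Hs \<Longrightarrow> subgroup (Hs ! i) G"
  using is_free_product unfolding is_free_product_alternating by simp

lemma factor_closed: "i < length Hs \<Longrightarrow> h \<in> Hs ! i \<Longrightarrow> h \<in> carrier G"
  by (rule subgroup.mem_carrier[OF subgroup_factor])

lemma generate_factors: "generate G (\<Union> (set Hs)) = carrier G"
  using is_free_product unfolding is_free_product_alternating by simp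

lemma gprod_alternating: "alternating G Hs es \<Longrightarrow> es \<noteq> [] \<Longrightarrow> gprod G es \<noteq> \<one>"
  using is_free_product unfolding is_free_product_alternating by simp

lemma gprod_Nil [simp]: "gprod G [] = \<one>"
  by (simp add: gprod_def)

lemma gprod_Cons [simp]: "gprod G (e # es) = snd e \<otimes> gprod G es"
  by (simp add: gprod_def)

lemma alternating_Nil [simp]: "alternating G Hs []"
  by (simp add: alternating_def)

lemma alternating_Cons:
  "alternating G Hs (e # es) \<longleftrightarrow> fst e < length Hs \<and> snd e \<in> Hs ! fst e - {\<one>} \<and>
     alternating G Hs es \<and> (es = [] \<or> fst (hd es) \<noteq> fst e)"
  by (cases es) (auto simp: alternating_def)

lemma alternating_append:
  "alternating G Hs (es @ fs) \<longleftrightarrow> alternating G Hs es \<and> alternating G Hs fs \<and>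
     (es = [] \<or> fs = [] \<or> fst (hd fs) \<noteq> fst (last es))"
  unfolding alternating_def map_append distinct_adj_append_iff set_append ball_Un
  by (cases "es = []"; cases "fs = []") (simp_all add: hd_map last_map conj_ac eq_commute[of "fst (last es)"])

lemma gprod_closed [simp]: "alternating G Hs es \<Longrightarrow> gprod G es \<in> carrier G"
  by (induction es) (auto simp: alternating_Cons intro: factor_closed)

lemma gprod_append:
  "alternating G Hs es \<Longrightarrow> alternating G Hs fs \<Longrightarrow> gprod G (es @ fs) = gprod G es \<otimes> gprod G fs"
proof (induction es)
  case (Cons e es)
  moreover have "snd e \<in> carrier G"
    using Cons.prems factor_closed[of "fst e" "snd e"] by (simp add: alternating_Cons)
  ultimately show ?case
    by (simp add: alternating_Cons m_assoc)
qed simp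

lemma gprod_inverse:
  assumes "alternating G Hs es"
  defines "fs \<equiv> rev (map (\<lambda>(i, h). (i, inv h)) es)"
  shows "alternating G Hs fs" "gprod G fs = inv (gprod G es)"
proof -
  have "alternating G Hs fs \<and> gprod G fs = inv (gprod G es)"
    unfolding fs_def using assms(1)
  proof (induction es)
    case (Cons e es)
    obtain i h where e: "e = (i, h)"
      by fastforce
    have h: "i < length Hs" "h \<in> Hs ! i" "h \<noteq> \<one>" "h \<in> carrier G"
      using Cons.prems by (auto simp: e alternating_Cons intro: factor_closed)
    then have ih: "inv h \<in> Hs ! i" "inv h \<noteq> \<one>"
      using subgroup.m_inv_closed[OF subgroup_factor] by (auto simp: inv_eq_1_iff)
    have 1: "alternating G Hs [(i, inv h)]"
      using h ih by (simp add: alternating_Cons)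
    show ?case
      using Cons h ih 1
      by (auto simp: e alternating_Cons alternating_append gprod_append last_rev hd_map inv_mult_group
          split: prod.splits)
  qed simp
  then show "alternating G Hs fs" "gprod G fs = inv (gprod G es)"
    by auto
qed

text \<open>If the first factors differ, the inverse of one word followed by the other is again
  alternating, so the quotient is nontrivial. This much uniqueness of normal forms makes the sets
  \<open>starting_with\<close> disjoint.\<close>

lemma gprod_neq:
  assumes "alternating G Hs es" "alternating G Hs fs" "es \<noteq> []" "fs = [] \<or> fst (hd fs) \<noteq> fst (hd es)"
  shows "gprod G es \<noteq> gprod G fs"
proof
  assume eq: "gprod G es = gprod G fs"
  define gs where "gs = rev (map (\<lambda>(i, h). (i, inv h)) fs)"
  have gs: "alternating G Hs gs" "gprod G gs = inv (gprod G fs)"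
    using gprod_inverse[OF assms(2)] by (simp_all add: gs_def)
  have "fst (last gs) = fst (hd fs)" if "fs \<noteq> []"
    using that by (auto simp: gs_def last_rev hd_map split: prod.splits)
  then have "alternating G Hs (gs @ es)"
    using gs(1) assms by (auto simp: alternating_append gs_def)
  then have "gprod G (gs @ es) \<noteq> \<one>"
    using gprod_alternating assms(3) by blast
  then show False
    using gs assms by (simp add: gprod_append eq)
qed

text \<open>Right multiplication by an element of a factor touches only the last syllable, which is
  appended, merged or cancelled. The first factor survives unless the whole word disappears.\<close>

lemma gprod_snoc:
  assumes "alternating G Hs es" "j < length Hs" "s \<in> Hs ! j"
  obtains fs where "alternating G Hs fs" "gprod G fs = gprod G es \<otimes> s"
    "es \<noteq> [] \<Longrightarrow> fs \<noteq> [] \<Longrightarrow> fst (hd fs) = fst (hd es)"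
proof -
  have sc: "s \<in> carrier G"
    using assms factor_closed by blast
  consider "s = \<one>" | "s \<noteq> \<one>" "es = [] \<or> fst (last es) \<noteq> j" | "s \<noteq> \<one>" "es \<noteq> []" "fst (last es) = j"
    by blast
  then show ?thesis
  proof cases
    case 1
    then show ?thesis
      using that[of es] assms by simp
  next
    case 2
    then have s: "alternating G Hs [(j, s)]"
      using assms by (auto simp: alternating_Cons)
    then have "alternating G Hs (es @ [(j, s)])"
      using 2 assms by (auto simp: alternating_append)
    then show ?thesis
      using that[of "es @ [(j, s)]"] assms s sc by (auto simp: gprod_append)
  next
    case 3
    then obtain gs a where es: "es = gs @ [(j, a)]"
      by (cases es rule: rev_cases) auto
    have gs: "alternating G Hs gs" and a: "a \<in> Hs ! j" and ja: "alternating G Hs [(j, a)]"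
      using assms by (auto simp: es alternating_append alternating_Cons)
    then have ac: "a \<in> carrier G"
      using factor_closed assms by blast
    have eq: "gprod G es \<otimes> s = gprod G gs \<otimes> (a \<otimes> s)"
      using gs ja ac sc by (simp add: es gprod_append m_assoc)
    have aas: "a \<otimes> s \<in> Hs ! j"
      using subgroup.m_closed[OF subgroup_factor] a assms by blast
    show ?thesis
    proof (cases "a \<otimes> s = \<one>")
      case True
      then show ?thesis
        using that[of gs] gs eq by (auto simp: es)
    next
      case False
      then have jas: "alternating G Hs [(j, a \<otimes> s)]"
        using aas assms by (auto simp: alternating_Cons)
      then have "alternating G Hs (gs @ [(j, a \<otimes> s)])"
        using assms(1) by (auto simp: es alternating_append)
      then show ?thesis
        using that[of "gs @ [(j, a \<otimes> s)]"] gs jas ac sc eq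
        by (auto simp: gprod_append es hd_append)
    qed
  qed
qed

lemma starting_with_carrier: "starting_with G Hs i \<subseteq> carrier G"
  by (auto simp: starting_with_def)

lemma factor_starting_with:
  assumes "i < length Hs" "h \<in> Hs ! i" "h \<noteq> \<one>"
  shows "h \<in> starting_with G Hs i"
proof -
  have "alternating G Hs [(i, h)]" "gprod G [(i, h)] = h"
    using assms factor_closed by (auto simp: alternating_Cons)
  then show ?thesis
    unfolding starting_with_def by (intro CollectI exI[of _ "[(i, h)]"]) auto
qed

lemma one_notin_starting_with: "\<one> \<notin> starting_with G Hs i"
  using gprod_alternating by (force simp: starting_with_def)

lemma starting_with_disjoint: "i \<noteq> j \<Longrightarrow> starting_with G Hs i \<inter> starting_with G Hs j = {}"
  using gprod_neq by (fastforce simp: starting_with_def)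

lemma factor_notin_starting_with:
  assumes "i \<noteq> j" "j < length Hs" "h \<in> Hs ! j"
  shows "h \<notin> starting_with G Hs i"
  using assms factor_starting_with one_notin_starting_with starting_with_disjoint by blast

lemma starting_with_mult:
  assumes "f \<in> starting_with G Hs i" "j < length Hs" "s \<in> Hs ! j" "f \<otimes> s \<noteq> \<one>"
  shows "f \<otimes> s \<in> starting_with G Hs i"
proof -
  obtain es where es: "alternating G Hs es" "es \<noteq> []" "fst (hd es) = i" "f = gprod G es"
    using assms(1) by (auto simp: starting_with_def)
  obtain fs where fs: "alternating G Hs fs" "gprod G fs = gprod G es \<otimes> s"
    "es \<noteq> [] \<Longrightarrow> fs \<noteq> [] \<Longrightarrow> fst (hd fs) = fst (hd es)"
    using gprod_snoc[OF es(1) assms(2,3)] by blast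
  moreover have "fs \<noteq> []"
    using fs(2) es(4) assms(4) by auto
  ultimately show ?thesis
    using es unfolding starting_with_def by (intro CollectI exI[of _ fs]) auto
qed

lemma starting_with_mult_iff:
  assumes f: "f \<in> carrier G" and j: "j < length Hs" "s \<in> Hs ! j" and "f \<noteq> \<one>" "f \<otimes> s \<noteq> \<one>"
  shows "f \<otimes> s \<in> starting_with G Hs i \<longleftrightarrow> f \<in> starting_with G Hs i"
proof
  have s: "s \<in> carrier G" "inv s \<in> Hs ! j"
    using factor_closed j subgroup.m_inv_closed[OF subgroup_factor] by auto
  have eq: "f \<otimes> s \<otimes> inv s = f"
    using f s by (simp add: m_assoc)
  assume "f \<otimes> s \<in> starting_with G Hs i"
  then show "f \<in> starting_with G Hs i"
    using starting_with_mult[of "f \<otimes> s" i j "inv s"] j s assms eq by simp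
qed (use assms starting_with_mult in blast)

lemma starting_with_mult_other:
  assumes "f \<in> carrier G" "i \<noteq> j" "j < length Hs" "s \<in> Hs ! j"
  shows "f \<otimes> s \<in> starting_with G Hs i \<longleftrightarrow> f \<in> starting_with G Hs i"
proof (cases "f = \<one> \<or> f \<otimes> s = \<one>")
  case True
  have s: "s \<in> carrier G" "inv s \<in> Hs ! j"
    using factor_closed assms subgroup.m_inv_closed[OF subgroup_factor] by auto
  have "f = inv s" if "f \<otimes> s = \<one>"
    using that assms s by (simp add: inv_equality)
  moreover have "\<one> \<in> Hs ! j"
    using subgroup.one_closed[OF subgroup_factor] assms by blast
  ultimately have "f \<in> Hs ! j" "f \<otimes> s \<in> Hs ! j"
    using True s assms by auto
  then show ?thesis
    using factor_notin_starting_with assms by blast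
qed (use starting_with_mult_iff assms in blast)

text \<open>For \<open>s\<close> in a factor, sides can change only at the identity and at
  \<open>inv s\<close>. The coboundary of a product lies in that of the first element together with
  a translate of that of the second, so finiteness spreads from the generators.\<close>

lemma starting_with_coboundary:
  assumes "s \<in> carrier G"
  shows "finite {f \<in> carrier G. (f \<in> starting_with G Hs i) \<noteq> (f \<otimes> s \<in> starting_with G Hs i)}"
proof -
  let ?E = "starting_with G Hs i"
  have gen: "finite {f \<in> carrier G. (f \<in> ?E) \<noteq> (f \<otimes> s \<in> ?E)}" if "s \<in> Hs ! j" "j < length Hs" for s j
  proof (rule finite_subset)
    show "{f \<in> carrier G. (f \<in> ?E) \<noteq> (f \<otimes> s \<in> ?E)} \<subseteq> {\<one>, inv s}"
      using starting_with_mult_iff[of _ j s i] that factor_closed[of j s] by (auto intro: inv_equality[symmetric])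
  qed simp
  have "s \<in> generate G (\<Union> (set Hs))"
    using assms generate_factors by simp
  then show ?thesis
  proof (induction s rule: generate.induct)
    case one
    show ?case
      by (rule finite_subset[of _ "{}"]) auto
  next
    case (incl h)
    then show ?case
      using gen by (auto simp: in_set_conv_nth)
  next
    case (inv h)
    then obtain j where j: "j < length Hs" "h \<in> Hs ! j"
      by (auto simp: in_set_conv_nth)
    show ?case
      by (rule gen[OF subgroup.m_inv_closed[OF subgroup_factor[OF j(1)] j(2)] j(1)])
  next
    case (eng h1 h2)
    then have h: "h1 \<in> carrier G" "h2 \<in> carrier G"
      using generate_factors by auto
    let ?D = "\<lambda>s. {f \<in> carrier G. (f \<in> ?E) \<noteq> (f \<otimes> s \<in> ?E)}"
    have "?D (h1 \<otimes> h2) \<subseteq> ?D h1 \<union> (\<lambda>f. f \<otimes> inv h1) ` ?D h2"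
    proof
      fix f assume f: "f \<in> ?D (h1 \<otimes> h2)"
      show "f \<in> ?D h1 \<union> (\<lambda>f. f \<otimes> inv h1) ` ?D h2"
      proof (cases "f \<in> ?D h1")
        case False
        then have "f \<otimes> h1 \<in> ?D h2" "f = f \<otimes> h1 \<otimes> inv h1"
          using f h by (auto simp: m_assoc)
        then show ?thesis
          by blast
      qed simp
    qed
    then show ?case
      using eng finite_subset by blast
  qed
qed

lemma infinite_starting_with:
  assumes i: "i < length Hs" "a \<in> Hs ! i" "a \<noteq> \<one>" and j: "j < length Hs" "c \<in> Hs ! j" "c \<noteq> \<one>"
    and "i \<noteq> j"
  shows "infinite (starting_with G Hs i)"
proof -
  have ac: "a \<in> carrier G" "c \<in> carrier G"
    using i j factor_closed by auto
  let ?es = "\<lambda>k. concat (replicate k [(i, a), (j, c)])"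
  have alt: "alternating G Hs (?es k) \<and> gprod G (?es k) = (a \<otimes> c) [^] k" for k
  proof (induction k)
    case (Suc k)
    have "hd (?es k) = (i, a)" if "?es k \<noteq> []"
      using that by (cases k) auto
    moreover have "(a \<otimes> c) [^] Suc k = a \<otimes> c \<otimes> (a \<otimes> c) [^] k"
      by (rule nat_pow_Suc2[OF m_closed[OF ac]])
    ultimately show ?case
      using Suc i j ac \<open>i \<noteq> j\<close> by (auto simp: alternating_Cons m_assoc simp del: nat_pow_Suc)
  qed simp
  have "infinite_order G (a \<otimes> c)"
    unfolding infinite_order_def
  proof (intro allI impI)
    fix k :: nat assume "k > 0"
    then have "?es k \<noteq> []"
      by auto
    then show "(a \<otimes> c) [^] k \<noteq> \<one>"
      using gprod_alternating alt by metis
  qed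
  then have "inj (\<lambda>k::nat. (a \<otimes> c) [^] k)"
    using infinite_order_inj ac by blast
  then have "infinite ((\<lambda>k::nat. (a \<otimes> c) [^] k) ` {1..})"
    using finite_imageD inj_on_subset infinite_Ici by blast
  moreover have "(\<lambda>k::nat. (a \<otimes> c) [^] k) ` {1..} \<subseteq> starting_with G Hs i"
  proof clarify
    fix k :: nat assume "k \<ge> 1"
    then show "(a \<otimes> c) [^] k \<in> starting_with G Hs i"
      unfolding starting_with_def
      by (intro CollectI exI[of _ "?es k"]) (use alt[of k] in \<open>cases k; auto\<close>)
  qed
  ultimately show ?thesis
    using infinite_super by blast
qed

lemma halfspace_starting_with:
  assumes i: "i < length Hs" "a \<in> Hs ! i" "a \<noteq> \<one>" and j: "j < length Hs" "c \<in> Hs ! j" "c \<noteq> \<one>"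
    and "i \<noteq> j"
  shows "halfspace G (starting_with G Hs i)"
proof -
  have "starting_with G Hs j \<subseteq> carrier G - starting_with G Hs i"
    using starting_with_disjoint[OF \<open>i \<noteq> j\<close>] starting_with_carrier by blast
  then have "infinite (carrier G - starting_with G Hs i)"
    using infinite_starting_with[OF j i] \<open>i \<noteq> j\<close> infinite_super by blast
  then show ?thesis
    unfolding halfspace_def
    using infinite_starting_with[OF i j \<open>i \<noteq> j\<close>] starting_with_coboundary starting_with_carrier by blast
qed

text \<open>Every left coset of the factor lies on one side, except that the factor itself has its
  identity on the other side; infinite order keeps high powers away from that one point.\<close>

lemma unseparated_factor:
  assumes i: "i < length Hs" and a: "a \<in> Hs ! i" "infinite_order G a"
  shows "unseparated G (starting_with G Hs i) a"
  unfolding unseparated_def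
proof
  fix f assume f: "f \<in> carrier G"
  have ac: "a \<in> carrier G" and ia: "inv a \<in> Hs ! i"
    using assms factor_closed subgroup.m_inv_closed[OF subgroup_factor] by auto
  have pow: "b [^] k \<in> Hs ! i" if "b \<in> Hs ! i" for b and k :: nat
    using that subgroup.one_closed[OF subgroup_factor[OF i]] subgroup.m_closed[OF subgroup_factor[OF i]]
    by (induction k) simp_all
  let ?E = "starting_with G Hs i"
  show "\<exists>b. \<forall>\<^sub>F k in sequentially. (f \<otimes> a [^] (k::nat) \<in> ?E) = b \<and> (f \<otimes> (inv a) [^] k \<in> ?E) = b"
  proof (cases "f \<in> Hs ! i")
    case True
    have "f \<otimes> b [^] k \<in> ?E" if "b \<in> Hs ! i" "f \<otimes> b [^] k \<notin> {\<one>}" for b and k :: nat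
      using factor_starting_with i subgroup.m_closed[OF subgroup_factor[OF i] True pow[OF that(1)]] that
      by simp
    then have "\<forall>\<^sub>F k in sequentially. (f \<otimes> b [^] (k::nat) \<in> ?E)" if "b \<in> Hs ! i" "infinite_order G b" for b
      using eventually_pow_notin_finite[of b f "{\<one>}"] f that i factor_closed
      by (smt (verit) eventually_mono finite.emptyI finite_insert)
    then have "\<forall>\<^sub>F k in sequentially. (f \<otimes> a [^] (k::nat) \<in> ?E)"
      "\<forall>\<^sub>F k in sequentially. (f \<otimes> inv a [^] (k::nat) \<in> ?E)"
      using a ia ac infinite_order_inv by blast+
    then show ?thesis
      by (intro exI[of _ True]) (auto intro: eventually_conj)
  next
    case False
    have "f \<otimes> b [^] k \<in> ?E \<longleftrightarrow> f \<in> ?E" if b: "b \<in> Hs ! i" for b and k :: nat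
    proof (rule starting_with_mult_iff[OF f i pow[OF b]])
      show "f \<noteq> \<one>"
        using False subgroup.one_closed[OF subgroup_factor[OF i]] by blast
      show "f \<otimes> b [^] k \<noteq> \<one>"
        using False f inv_equality[of f "b [^] k"] subgroup.m_inv_closed[OF subgroup_factor[OF i] pow[OF b]]
          factor_closed[OF i pow[OF b]] by auto
    qed
    then show ?thesis
      using a ia by simp
  qed
qed

text \<open>Right multiplication by another factor preserves the side even at the identity, so the
  half-space is a union of left cosets of the subgroup generated by the other factors.\<close>

lemma unseparated_other_factors:
  assumes "a \<in> generate G (\<Union>j \<in> {..<length Hs} - {i}. Hs ! j)"
  shows "unseparated G (starting_with G Hs i) a"
proof -
  let ?E = "starting_with G Hs i" and ?S = "\<Union>j \<in> {..<length Hs} - {i}. Hs ! j"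
  have S: "?S \<subseteq> carrier G"
    using factor_closed by auto
  have inv: "f \<otimes> a \<in> ?E \<longleftrightarrow> f \<in> ?E" if "a \<in> generate G ?S" "f \<in> carrier G" for a f
    using that
  proof (induction a arbitrary: f rule: generate.induct)
    case (incl h)
    then obtain j where "j < length Hs" "j \<noteq> i" "h \<in> Hs ! j"
      by auto
    then show ?case
      using starting_with_mult_other[of f i j h] incl by simp
  next
    case (inv h)
    then obtain j where "j < length Hs" "j \<noteq> i" "h \<in> Hs ! j"
      by auto
    then show ?case
      using starting_with_mult_other[of f i j "inv h"] subgroup.m_inv_closed[OF subgroup_factor] inv by simp
  next
    case (eng h1 h2)
    then have "h1 \<in> carrier G" "h2 \<in> carrier G"
      using generate_in_carrier[OF S] by auto
    then show ?case
      using eng by (simp flip: m_assoc)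
  qed auto
  have ac: "a \<in> carrier G"
    using assms generate_in_carrier[OF S] by blast
  have pow: "f \<otimes> b [^] k \<in> ?E \<longleftrightarrow> f \<in> ?E"
    if "b \<in> generate G ?S" "b \<in> carrier G" "f \<in> carrier G" for b f and k :: nat
    by (induction k) (use that inv in \<open>simp_all flip: m_assoc\<close>)
  have "inv a \<in> generate G ?S"
    using generate_m_inv_closed[OF S assms] .
  then show ?thesis
    unfolding unseparated_def using pow[OF assms ac] pow[OF _ inv_closed[OF ac]] by auto
qed

end

section \<open>Whitehead's cut vertex lemma\<close>

text \<open>\<open>(s, t)\<close> with \<open>cyc_adjacent w s t\<close> is the edge joining \<open>flip s\<close> and \<open>t\<close> in the Whitehead graph of \<open>w\<close>.\<close>

definition cyc_adjacent :: "fword \<Rightarrow> letter \<Rightarrow> letter \<Rightarrow> bool" where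
  "cyc_adjacent w s t \<longleftrightarrow> w \<noteq> [] \<and> (\<exists>us vs. w @ [hd w] = us @ s # t # vs)"

lemma rotate_conj:
  assumes "v @ w \<in> carrier (free_group n)" "w @ v \<in> carrier (free_group n)"
  shows "w @ v = inv\<^bsub>free_group n\<^esub> v \<otimes>\<^bsub>free_group n\<^esub> (v @ w) \<otimes>\<^bsub>free_group n\<^esub> v"
proof -
  interpret group "free_group n"
    by (rule group_free_group)
  have vw: "v \<in> carrier (free_group n)" "w \<in> carrier (free_group n)"
    using assms(1) by (auto simp: carrier_free_group fwords_def freduced_append)
  have "v @ w = v \<otimes>\<^bsub>free_group n\<^esub> w" "w @ v = w \<otimes>\<^bsub>free_group n\<^esub> v"
    using assms by (simp_all add: fmult_append carrier_free_group fwords_def)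
  then show ?thesis
    using vw inv_cancel(1)[of v w] by (simp del: mult_free_group add: m_assoc)
qed

lemma infinite_order_cyc_reduced:
  assumes "cyc_reduced w" "w \<in> carrier (free_group n)"
  shows "infinite_order (free_group n) w"
  unfolding infinite_order_def
proof (intro allI impI)
  fix k :: nat assume "k > 0"
  then show "w [^]\<^bsub>free_group n\<^esub> k \<noteq> \<one>\<^bsub>free_group n\<^esub>"
    using assms unfolding pow_cyc_reduced[OF assms] by (cases k) (auto simp: cyc_reduced_def)
qed

text \<open>After this rotation the positive powers begin with \<open>t\<close> and the negative
  ones with \<open>flip s\<close>: the edge of the Whitehead graph becomes the pair of directions in
  which an axis leaves a vertex.\<close>

lemma cyc_adjacent_rotate:
  assumes w: "cyc_reduced w" "w \<in> carrier (free_group n)" and "cyc_adjacent w s t"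
  obtains v g where "cyc_reduced v" "v \<in> carrier (free_group n)" "hd v = t" "last v = s"
    "g \<in> carrier (free_group n)"
    "v = g \<otimes>\<^bsub>free_group n\<^esub> w \<otimes>\<^bsub>free_group n\<^esub> inv\<^bsub>free_group n\<^esub> g"
proof -
  interpret group "free_group n"
    by (rule group_free_group)
  obtain us vs where adj: "w @ [hd w] = us @ s # t # vs"
    using assms(3) by (auto simp: cyc_adjacent_def)
  show ?thesis
  proof (cases vs rule: rev_cases)
    case Nil
    then have "w = us @ [s]" "hd w = t"
      using adj by (metis append.assoc append_Cons append_Nil butlast_snoc last_snoc)+
    then show ?thesis
      using that[of w "\<one>\<^bsub>free_group n\<^esub>"] w by (auto simp del: mult_free_group one_free_group)
  next
    case (snoc vs' x)
    then have eq: "w = (us @ [s]) @ (t # vs')"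
      using adj by simp
    let ?u = "us @ [s]" and ?v = "(t # vs') @ us @ [s]"
    have "cyc_reduced ?v"
      using w(1) unfolding eq by (rule cyc_reduced_append_commute)
    have vc: "?v \<in> carrier (free_group n)" and uc: "?u \<in> carrier (free_group n)"
      using cyc_reduced_imp_freduced[OF \<open>cyc_reduced ?v\<close>] w(2)
      by (auto simp: carrier_free_group fwords_def eq freduced_append)
    have "?v = inv\<^bsub>free_group n\<^esub> ?u \<otimes>\<^bsub>free_group n\<^esub> w \<otimes>\<^bsub>free_group n\<^esub> inv\<^bsub>free_group n\<^esub> (inv\<^bsub>free_group n\<^esub> ?u)"
      unfolding inv_inv[OF uc] using rotate_conj[of ?u "t # vs'" n] w(2) vc unfolding eq by blast
    moreover have "hd ?v = t" "last ?v = s"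
      by simp_all
    ultimately show ?thesis
      by (metis that \<open>cyc_reduced ?v\<close> vc inv_closed uc)
  qed
qed

text \<open>
  Choose a longest \<open>g\<close> whose cylinder meets both \<open>E\<close> and its complement in infinite sets. All other
  directions at the vertex \<open>g\<close> of the Cayley tree then lie essentially on one side of \<open>E\<close>, so that the
  Whitehead graph, minus the direction \<open>c\<close> back from \<open>g\<close>, is disconnected.
\<close>

lemma cut_vertex:
  assumes E: "halfspace (free_group n) E"
  obtains c :: "letter option" and col :: "letter \<Rightarrow> bool" where
    "\<exists>s t. fst s < n \<and> fst t < n \<and> Some s \<noteq> c \<and> Some t \<noteq> c \<and> col s \<noteq> col t"
    "\<And>w s t. \<lbrakk>w \<in> carrier (free_group n); cyc_reduced w; unseparated (free_group n) E w; cyc_adjacent w s t;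
       Some t \<noteq> c; Some (flip s) \<noteq> c\<rbrakk> \<Longrightarrow> col t = col (flip s)"
proof -
  let ?G = "free_group n"
  interpret group ?G
    by (rule group_free_group)
  define cyl where "cyl g = {h \<in> carrier ?G. prefix g h}" for g
  define nonmono where "nonmono g \<longleftrightarrow> infinite (cyl g \<inter> E) \<and> infinite (cyl g - E)" for g
  define D where "D s = {f \<in> carrier ?G. (f \<in> E) \<noteq> (f \<otimes>\<^bsub>?G\<^esub> [s] \<in> E)}" for s
  have "finite (D s)" if "fst s < n" for s
    using that E unfolding halfspace_def D_def by (simp add: carrier_free_group)
  then have "finite (\<Union>s \<in> {..<n} \<times> UNIV. D s)"
    by auto
  \<comment> \<open>At depth \<open>L\<close> or more no edge of the Cayley tree crosses the
    coboundary, so deep cylinders lie on one side. This bounds the length of mixed cylinders and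
    gives a longest one.\<close>
  then obtain L where L: "\<And>s f. fst s < n \<Longrightarrow> f \<in> D s \<Longrightarrow> length f < L"
  proof -
    assume *: "finite (\<Union>s \<in> {..<n} \<times> UNIV. D s)" "\<And>L. (\<And>s f. fst s < n \<Longrightarrow> f \<in> D s \<Longrightarrow> length f < L) \<Longrightarrow> thesis"
    then obtain L where L: "\<forall>k \<in> length ` (\<Union>s \<in> {..<n} \<times> UNIV. D s). k < L"
      using finite_nat_set_iff_bounded by blast
    have "length f < L" if "fst s < n" "f \<in> D s" for s f
      using that by (intro bspec[OF L] imageI UN_I[of s]) (auto simp: mem_Times_iff)
    then show thesis
      by (rule *(2))
  qed
  have prefix_carrier: "g \<in> carrier ?G" if "g @ h \<in> carrier ?G" for g h
    using that by (auto simp: carrier_free_group fwords_def freduced_append)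
  have const: "(g @ h \<in> E) = (g \<in> E)" if "L \<le> length g" "g @ h \<in> carrier ?G" for g h
    using that
  proof (induction h rule: rev_induct)
    case (snoc s h)
    have h: "(g @ h) @ [s] \<in> carrier ?G"
      using snoc.prems by simp
    have "g @ h \<in> carrier ?G"
      using prefix_carrier[OF h] .
    moreover have "fst s < n" "(g @ h) \<otimes>\<^bsub>?G\<^esub> [s] = (g @ h) @ [s]"
      using h by (auto simp: carrier_free_group fwords_def fmult_append)
    moreover have "g @ h \<notin> D s"
      using L[of s "g @ h"] \<open>fst s < n\<close> snoc.prems by auto
    ultimately show ?case
      using snoc by (auto simp: D_def)
  qed simp
  have "cyl g \<inter> E = {} \<or> cyl g - E = {}" if "L \<le> length g" for g
    using const[OF that] by (auto simp: cyl_def elim!: prefixE)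
  then have bound: "length g < L" if "nonmono g" for g
    using that unfolding nonmono_def by (metis finite.emptyI not_le)
  have "cyl [] = carrier ?G"
    by (simp add: cyl_def)
  then have "nonmono []"
    using E unfolding nonmono_def halfspace_def by (simp add: Int_absorb1)
  then obtain g where g: "nonmono g" "\<And>h. nonmono h \<Longrightarrow> length h \<le> length g"
    using ex_has_greatest_nat[of nonmono "[]" length L] bound less_imp_le by metis
  have gc: "g \<in> carrier ?G"
  proof -
    have "cyl g \<noteq> {}"
      using g(1) unfolding nonmono_def by auto
    then show ?thesis
      using prefix_carrier by (auto simp: cyl_def elim!: prefixE)
  qed
  \<comment> \<open>For \<open>g = []\<close> there is no direction back; \<open>None\<close>
    deletes nothing and the Whitehead graph is disconnected as it stands.\<close>
  define c where "c = (if g = [] then None else Some (flip (last g)))"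
  \<comment> \<open>By maximality of \<open>g\<close> each cylinder one step further is infinite on
    at most one side, so \<open>col\<close> names that side.\<close>
  define col where "col s \<longleftrightarrow> infinite (cyl (g @ [s]) \<inter> E)" for s
  define A where "A = {s. fst s < n \<and> Some s \<noteq> c}"
  have "A \<subseteq> {..<n} \<times> UNIV"
    by (auto simp: A_def)
  then have finA: "finite A"
    by (rule finite_subset) simp
  have not_nonmono: "\<not> nonmono (g @ [s])" for s
    using g(2)[of "g @ [s]"] by auto
  have cylg: "cyl g \<subseteq> insert g (\<Union>s \<in> A. cyl (g @ [s]))"
  proof
    fix h assume "h \<in> cyl g"
    then obtain k where k: "h = g @ k" "h \<in> carrier ?G"
      by (auto simp: cyl_def elim: prefixE)
    show "h \<in> insert g (\<Union>s \<in> A. cyl (g @ [s]))"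
    proof (cases k)
      case (Cons s k')
      then have "s \<in> A"
        using k by (auto simp: A_def c_def carrier_free_group fwords_def freduced_append)
      moreover have "h \<in> cyl (g @ [s])"
        using k Cons by (simp add: cyl_def)
      ultimately show ?thesis
        by blast
    qed (use k in simp)
  qed
  have ex: "\<exists>s \<in> A. infinite (cyl (g @ [s]) \<inter> M)" if "infinite (cyl g \<inter> M)" for M
  proof (rule ccontr)
    assume "\<not> (\<exists>s \<in> A. infinite (cyl (g @ [s]) \<inter> M))"
    then have "finite (insert g (\<Union>s \<in> A. cyl (g @ [s]) \<inter> M))"
      using finA by (intro finite.insertI finite_UN_I) simp_all
    moreover have "cyl g \<inter> M \<subseteq> insert g (\<Union>s \<in> A. cyl (g @ [s]) \<inter> M)"
      using cylg by blast
    ultimately show False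
      using that finite_subset by blast
  qed
  obtain s where s: "s \<in> A" "col s"
    using ex[of E] g(1) by (auto simp: nonmono_def col_def)
  obtain t where t: "t \<in> A" "infinite (cyl (g @ [t]) \<inter> - E)"
    using ex[of "- E"] g(1) by (auto simp: nonmono_def Diff_eq)
  then have "\<not> col t"
    using not_nonmono[of t] by (auto simp: nonmono_def col_def Diff_eq)
  show ?thesis
  proof (rule that)
    show "\<exists>s t. fst s < n \<and> fst t < n \<and> Some s \<noteq> c \<and> Some t \<noteq> c \<and> col s \<noteq> col t"
      using s t \<open>\<not> col t\<close> by (intro exI[of _ s] exI[of _ t]) (simp add: A_def)
  next
    fix w s t
    assume w: "w \<in> carrier ?G" "cyc_reduced w" "unseparated ?G E w"
      and adj: "cyc_adjacent w s t" "Some t \<noteq> c" "Some (flip s) \<noteq> c"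
    obtain v k where v: "cyc_reduced v" "v \<in> carrier ?G" "hd v = t" "last v = s"
      and k: "k \<in> carrier ?G" "v = k \<otimes>\<^bsub>?G\<^esub> w \<otimes>\<^bsub>?G\<^esub> inv\<^bsub>?G\<^esub> k"
      using cyc_adjacent_rotate[OF w(2,1) adj(1)] by blast
    have v_unsep: "unseparated ?G E v"
      unfolding k(2) using w k(1) E infinite_order_cyc_reduced by (intro unseparated_conj)
    then have "\<exists>b m. \<forall>j \<ge> m. (g \<otimes>\<^bsub>?G\<^esub> v [^]\<^bsub>?G\<^esub> (j::nat) \<in> E) = b \<and>
        (g \<otimes>\<^bsub>?G\<^esub> (inv\<^bsub>?G\<^esub> v) [^]\<^bsub>?G\<^esub> j \<in> E) = b"
      unfolding unseparated_def eventually_sequentially using gc by (rule bspec)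
    then obtain b m where m: "\<And>j. j \<ge> m \<Longrightarrow> (g \<otimes>\<^bsub>?G\<^esub> v [^]\<^bsub>?G\<^esub> (j::nat) \<in> E) = b"
        "\<And>j. j \<ge> m \<Longrightarrow> (g \<otimes>\<^bsub>?G\<^esub> (inv\<^bsub>?G\<^esub> v) [^]\<^bsub>?G\<^esub> j \<in> E) = b"
      by blast
    \<comment> \<open>Since \<open>hd u\<close> does not lead back, nothing cancels in
      \<open>g\<close> times a power of \<open>u\<close>: the ray leaves \<open>g\<close> through
      \<open>hd u\<close> and puts infinitely many elements of side \<open>b\<close> into that
      cylinder. This is used for \<open>v\<close> and for its inverse.\<close>
    have col: "col (hd u) = b"
      if u: "cyc_reduced u" "u \<in> carrier ?G" "Some (hd u) \<noteq> c"
        and ub: "\<And>j. j \<ge> m \<Longrightarrow> (g \<otimes>\<^bsub>?G\<^esub> u [^]\<^bsub>?G\<^esub> (j::nat) \<in> E) = b" for u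
    proof -
      have "g \<otimes>\<^bsub>?G\<^esub> u [^]\<^bsub>?G\<^esub> j \<in> cyl (g @ [hd u])" if j: "j \<ge> Suc m" for j :: nat
      proof -
        obtain i where i: "j = Suc i"
          using j by (cases j) auto
        then have "u [^]\<^bsub>?G\<^esub> j = u @ concat (replicate i u)"
          unfolding pow_cyc_reduced[OF u(1,2)] i by simp
        then obtain r where r: "u [^]\<^bsub>?G\<^esub> j = hd u # r"
          using u(1) by (cases u) (auto simp: cyc_reduced_def)
        have rc: "u [^]\<^bsub>?G\<^esub> j \<in> carrier ?G"
          using u by simp
        have "freduced (g @ u [^]\<^bsub>?G\<^esub> j)"
          using gc rc u(3) r by (auto simp: freduced_append carrier_free_group fwords_def c_def)
        then have "g \<otimes>\<^bsub>?G\<^esub> u [^]\<^bsub>?G\<^esub> j = (g @ [hd u]) @ r"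
          by (simp add: fmult_append r)
        then show ?thesis
          using gc rc unfolding cyl_def by (metis (mono_tags, lifting) m_closed mem_Collect_eq prefixI)
      qed
      then have sub: "(\<lambda>j. g \<otimes>\<^bsub>?G\<^esub> u [^]\<^bsub>?G\<^esub> j) ` {Suc m..} \<subseteq> cyl (g @ [hd u]) \<inter> {x. (x \<in> E) = b}"
        using ub by fastforce
      have "inj (\<lambda>j::nat. u [^]\<^bsub>?G\<^esub> j)"
        using infinite_order_inj infinite_order_cyc_reduced u by blast
      then have "inj (\<lambda>j::nat. g \<otimes>\<^bsub>?G\<^esub> u [^]\<^bsub>?G\<^esub> j)"
        using gc u(2) by (auto simp: inj_def simp del: mult_free_group)
      then have "infinite ((\<lambda>j::nat. g \<otimes>\<^bsub>?G\<^esub> u [^]\<^bsub>?G\<^esub> j) ` {Suc m..})"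
        using finite_imageD inj_on_subset infinite_Ici by blast
      then have inf: "infinite (cyl (g @ [hd u]) \<inter> {x. (x \<in> E) = b})"
        using sub infinite_super by blast
      show ?thesis
      proof (cases b)
        case False
        then have "infinite (cyl (g @ [hd u]) - E)"
          using inf by (simp add: Diff_eq Collect_neg_eq)
        then show ?thesis
          using not_nonmono[of "hd u"] False by (auto simp: nonmono_def col_def)
      qed (use inf in \<open>simp add: col_def\<close>)
    qed
    have "inv\<^bsub>?G\<^esub> v = finv v" "hd (finv v) = flip s"
      using v by (auto simp: inv_free_group hd_finv cyc_reduced_def)
    then have "col (flip s) = b"
      using col[of "finv v"] v adj(3) m by (simp add: cyc_reduced_finv carrier_free_group)
    moreover have "col t = b"
      using col[of v] v adj(2) m by simp
    ultimately show "col t = col (flip s)"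
      by simp
  qed
qed

section \<open>Segments between consecutive occurrences of the last generator\<close>

lemma finv_fmult:
  assumes "freduced v" "freduced w"
  shows "finv (fmult v w) = fmult (finv w) (finv v)"
proof -
  \<comment> \<open>Any rank above all generators involved; the inverse law of that free group then
    holds for the bare words.\<close>
  define n where "n = Suc (Max (insert 0 (fst ` set v \<union> fst ` set w)))"
  interpret group "free_group n"
    by (rule group_free_group)
  have "i < n" if "i \<in> fst ` set v \<union> fst ` set w" for i
    using that unfolding n_def less_Suc_eq_le by (intro Max_ge) auto
  then have vw: "v \<in> carrier (free_group n)" "w \<in> carrier (free_group n)"
    using assms by (auto simp: carrier_free_group fwords_def)
  then have "fmult v w \<in> carrier (free_group n)"
    using m_closed by simp
  then show ?thesis
    using inv_mult_group[OF vw] vw by (simp add: inv_free_group)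
qed

lemma fmult_cancel:
  assumes "freduced v" "freduced w"
  shows "fmult (finv v) (fmult v w) = w" "fmult v (fmult (finv v) w) = w"
  using assms fmult_finv[of "finv v"] by (simp_all flip: fmult_assoc add: fmult_finv)

lemma fmult_single_Nil [simp]: "fmult [s] [] = [s]"
  by (simp add: fmult_Nil_right)

lemma fmult_finv_right: "freduced w \<Longrightarrow> fmult w (finv w) = []"
  using fmult_finv[of "finv w"] by simp

subsection \<open>The automorphisms fixing all generators but one\<close>

definition subst :: "(letter \<Rightarrow> fword) \<Rightarrow> fword \<Rightarrow> fword" where
  "subst \<sigma> w = foldr (\<lambda>x. fmult (\<sigma> x)) w []"

definition shear_letter :: "nat \<Rightarrow> fword \<Rightarrow> fword \<Rightarrow> letter \<Rightarrow> fword" where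
  "shear_letter N l r s = (if fst s \<noteq> N then [s]
     else if snd s then fmult l (fmult [s] r) else fmult (finv r) (fmult [s] (finv l)))"

definition shear :: "nat \<Rightarrow> fword \<Rightarrow> fword \<Rightarrow> fword \<Rightarrow> fword" where
  "shear N l r = subst (shear_letter N l r)"

lemma subst_simps [simp]: "subst \<sigma> [] = []" "subst \<sigma> (x # w) = fmult (\<sigma> x) (subst \<sigma> w)"
  by (simp_all add: subst_def)

lemma freduced_subst: "freduced (subst \<sigma> w)"
  by (induction w) (auto intro: freduced_fmult)

lemma subst_append: "subst \<sigma> (v @ w) = fmult (subst \<sigma> v) (subst \<sigma> w)"
  by (induction v) (simp_all add: fmult_assoc freduced_subst)

lemma subst_fmult:
  assumes "\<And>x. freduced (\<sigma> x)" "\<And>x. \<sigma> (flip x) = finv (\<sigma> x)"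
  shows "subst \<sigma> (fmult v w) = fmult (subst \<sigma> v) (subst \<sigma> w)"
proof -
  have "subst \<sigma> (fstep x w) = fmult (\<sigma> x) (subst \<sigma> w)" for x w
    by (cases w) (auto simp: fstep_def assms freduced_subst fmult_cancel)
  then show ?thesis
    by (induction v) (simp_all add: fmult_Cons fmult_assoc freduced_subst)
qed

context
  fixes N :: nat and l r :: fword
  assumes lr: "freduced l" "freduced r"
begin

lemma shear_letter_flip: "shear_letter N l r (flip s) = finv (shear_letter N l r s)"
  using lr by (auto simp: shear_letter_def finv_fmult freduced_fmult fmult_assoc flip_def)

lemma freduced_shear_letter: "freduced (shear_letter N l r s)"
  using lr by (auto simp: shear_letter_def freduced_fmult)

lemma shear_fmult: "shear N l r (fmult v w) = fmult (shear N l r v) (shear N l r w)"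
  unfolding shear_def by (intro subst_fmult freduced_shear_letter shear_letter_flip)

end

lemma shear_fwords: "w \<in> fwords I \<Longrightarrow> N \<notin> I \<Longrightarrow> shear N l r w = w"
proof (induction w)
  case (Cons s w)
  then have "shear N l r w = w" "fst s \<noteq> N"
    by (auto simp: fwords_def freduced_Cons)
  then show ?case
    using Cons.prems fmult_append[of "[s]" w] by (simp add: shear_def shear_letter_def fwords_def)
qed (simp add: shear_def)

lemma shear_generator:
  "freduced l \<Longrightarrow> freduced r \<Longrightarrow> shear N l r [(N, True)] = fmult l (fmult [(N, True)] r)"
  by (simp add: shear_def shear_letter_def fmult_Nil_right freduced_fmult)

lemma shear_closed:
  assumes "l \<in> fwords I" "r \<in> fwords I" "w \<in> fwords I"
  shows "shear N l r w \<in> fwords I"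
  using assms(3)
proof (induction w)
  case (Cons s w)
  then have "shear N l r w \<in> fwords I" "fst s \<in> I"
    by (auto simp: fwords_def freduced_Cons)
  moreover have "shear_letter N l r s \<in> fwords I"
    using assms \<open>fst s \<in> I\<close> by (auto simp: shear_letter_def intro!: fwords_fmult)
  ultimately show ?case
    by (auto simp: shear_def intro: fwords_fmult)
qed (simp add: shear_def)

text \<open>The outer substitution fixes \<open>l'\<close> and \<open>r'\<close>, which avoid the
  generator \<open>N\<close>, so the factors accumulate around \<open>x\<close> as
  \<open>l' l x r r'\<close>. Inverting both words therefore inverts the shear.\<close>

lemma shear_comp:
  assumes lr: "l \<in> fwords I" "r \<in> fwords I" "l' \<in> fwords I" "r' \<in> fwords I" and N: "N \<notin> I"
  shows "shear N l r (shear N l' r' w) = shear N (fmult l' l) (fmult r r') w"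
proof -
  have red: "freduced l" "freduced r" "freduced l'" "freduced r'"
    using lr by (auto simp: fwords_def)
  have "shear N l r (shear_letter N l' r' s) = shear_letter N (fmult l' l) (fmult r r') s" for s
  proof (cases "fst s = N")
    case True
    have "shear N l r [s] = shear_letter N l r s"
      using red by (simp add: shear_def fmult_Nil_right freduced_shear_letter)
    moreover have "shear N l r u = u" if "u \<in> fwords I" for u
      using that N by (rule shear_fwords)
    ultimately show ?thesis
      using red lr True
      by (auto simp: shear_letter_def shear_fmult finv_fmult fmult_assoc freduced_fmult)
  qed (simp add: shear_letter_def shear_def)
  then show ?thesis
    using red by (induction w) (simp_all add: shear_def shear_fmult[unfolded shear_def])
qed

lemma shear_trivial: "freduced w \<Longrightarrow> shear N [] [] w = w"
proof (induction w)
  case (Cons s w)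
  then have "shear N [] [] w = w"
    by (simp add: freduced_Cons)
  then show ?case
    using Cons.prems fmult_append[of "[s]" w] by (cases s) (auto simp: shear_def shear_letter_def)
qed (simp add: shear_def)

lemma shear_iso:
  assumes "l \<in> fwords {..<N}" "r \<in> fwords {..<N}"
  shows "shear N l r \<in> iso (free_group (Suc N)) (free_group (Suc N))"
proof -
  let ?C = "carrier (free_group (Suc N))"
  have red: "freduced l" "freduced r"
    using assms by (auto simp: fwords_def)
  have sub: "fwords {..<N} \<subseteq> fwords {..<Suc N}"
    by (intro fwords_mono) auto
  have closed: "shear N l' r' w \<in> ?C" if "l' \<in> fwords {..<N}" "r' \<in> fwords {..<N}" "w \<in> ?C" for l' r' w
    using that sub by (auto simp: carrier_free_group intro!: shear_closed)
  have "bij_betw (shear N l r) ?C ?C"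
  proof (rule bij_betw_byWitness[where f' = "shear N (finv l) (finv r)"])
    show "\<forall>w \<in> ?C. shear N (finv l) (finv r) (shear N l r w) = w"
      using assms red by (auto simp: shear_comp[of _ "{..<N}"] fmult_finv_right fmult_finv shear_trivial
          carrier_free_group fwords_def[of "{..<Suc N}"])
    show "\<forall>w \<in> ?C. shear N l r (shear N (finv l) (finv r) w) = w"
      using assms red by (auto simp: shear_comp[of _ "{..<N}"] fmult_finv_right fmult_finv shear_trivial
          carrier_free_group fwords_def[of "{..<Suc N}"])
  qed (use closed assms in auto)
  moreover have "shear N l r \<in> hom (free_group (Suc N)) (free_group (Suc N))"
    using closed assms red by (auto simp: hom_def shear_fmult)
  ultimately show ?thesis
    by (simp add: iso_def)
qed

subsection \<open>Syllable decompositions\<close>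

text \<open>A list of syllables \<open>(e, b)\<close> stands for the product of the words \<open>x\<^sup>e b\<close>, where \<open>x\<close> is the
  generator number \<open>N\<close>. The extra argument of \<open>next_sign\<close> and \<open>reduced_syllables\<close> is the exponent of the
  occurrence of \<open>x\<close> that follows the list.\<close>

type_synonym syllables = "(bool \<times> fword) list"

definition syllable_word :: "nat \<Rightarrow> syllables \<Rightarrow> fword" where
  "syllable_word N ss = concat (map (\<lambda>(d, b). (N, d) # b) ss)"

definition next_sign :: "syllables \<Rightarrow> bool \<Rightarrow> bool" where
  "next_sign ss e = (if ss = [] then e else fst (hd ss))"

fun reduced_syllables :: "nat \<Rightarrow> syllables \<Rightarrow> bool \<Rightarrow> bool" where
  "reduced_syllables N [] e = True"
| "reduced_syllables N ((d, b) # ss) e \<longleftrightarrow>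
     b \<in> fwords {..<N} \<and> (b = [] \<longrightarrow> d = next_sign ss e) \<and> reduced_syllables N ss e"

lemma syllable_word_simps [simp]:
  "syllable_word N [] = []" "syllable_word N ((d, b) # ss) = (N, d) # b @ syllable_word N ss"
  "syllable_word N (ss @ ss') = syllable_word N ss @ syllable_word N ss'"
  by (simp_all add: syllable_word_def)

lemma next_sign_simps [simp]: "next_sign [] e = e" "next_sign ((d, b) # ss) e = d"
  by (simp_all add: next_sign_def)

lemma syllable_word_snoc:
  obtains w where "syllable_word N ss @ [(N, e)] = (N, next_sign ss e) # w"
  by (cases ss) auto

lemma reduced_syllables_iff:
  assumes "\<forall>(d, b) \<in> set ss. fst ` set b \<subseteq> {..<N}"
  shows "reduced_syllables N ss e \<longleftrightarrow> freduced (syllable_word N ss @ [(N, e)])"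
  using assms
proof (induction ss)
  case (Cons y ss)
  obtain d b where y: "y = (d, b)"
    by fastforce
  obtain w where w: "syllable_word N ss @ [(N, e)] = (N, next_sign ss e) # w"
    by (rule syllable_word_snoc)
  have "\<forall>s \<in> set b. fst s < N"
    using Cons.prems by (auto simp: y)
  then have b: "fst (last b) \<noteq> N" "fst (hd b) \<noteq> N" if "b \<noteq> []"
    using that last_in_set[of b] hd_in_set[of b] by force+
  have IH: "reduced_syllables N ss e \<longleftrightarrow> freduced ((N, next_sign ss e) # w)"
    using Cons by (simp add: w)
  have "freduced (syllable_word N (y # ss) @ [(N, e)]) \<longleftrightarrow> freduced ((N, d) # b @ (N, next_sign ss e) # w)"
    by (simp add: y w)
  also have "\<dots> \<longleftrightarrow> freduced b \<and> freduced ((N, next_sign ss e) # w) \<and> (b = [] \<longrightarrow> d = next_sign ss e)"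
    using b by (cases "b = []") (auto simp: freduced_Cons freduced_append flip_def prod_eq_iff)
  finally show ?case
    using Cons.prems by (auto simp: y IH fwords_def)
qed simp

lemma reduced_syllables_letters:
  "reduced_syllables N ss e \<Longrightarrow> \<forall>(d, b) \<in> set ss. fst ` set b \<subseteq> {..<N}"
  by (induction N ss e rule: reduced_syllables.induct) (simp_all add: fwords_def)

lemma freduced_syllable_word: "reduced_syllables N ss e \<Longrightarrow> freduced (syllable_word N ss @ [(N, e)])"
  using reduced_syllables_iff reduced_syllables_letters by blast

lemma syllable_word_carrier: "reduced_syllables N ss e \<Longrightarrow> syllable_word N ss \<in> carrier (free_group (Suc N))"
proof -
  assume *: "reduced_syllables N ss e"
  have "fst ` set (syllable_word N ss) \<subseteq> {..<Suc N}"
    using *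
  proof (induction N ss e rule: reduced_syllables.induct)
    case (2 N d b ss e)
    have "fst ` set b \<subseteq> {..<Suc N}"
      using 2(2) by (auto simp: fwords_def intro: order_trans[of _ "{..<N}"])
    then show ?case
      using 2 by (simp add: image_Un)
  qed simp
  then show ?thesis
    using freduced_syllable_word[OF *] by (simp add: carrier_free_group fwords_def freduced_append)
qed

text \<open>An occurrence of \<open>x\<close> emits \<open>l\<close> to its left and
  \<open>r\<close> to its right; an occurrence of its inverse emits \<open>finv r\<close> to its
  left and \<open>finv l\<close> to its right. Each piece between two occurrences absorbs what
  reaches it from both sides.\<close>

fun shear_syllables :: "fword \<Rightarrow> fword \<Rightarrow> syllables \<Rightarrow> bool \<Rightarrow> syllables" where
  "shear_syllables l r [] e = []"
| "shear_syllables l r ((d, b) # ss) e =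
     (d, fmult (if d then r else finv l) (fmult b (if next_sign ss e then l else finv r))) #
     shear_syllables l r ss e"

lemma next_sign_shear [simp]: "next_sign (shear_syllables l r ss e) e' = next_sign ss e'"
  by (cases ss) auto

lemma fmult_conj_eq_Nil:
  assumes "freduced g" "freduced b" "fmult g (fmult b (finv g)) = []"
  shows "b = []"
proof -
  have "fmult b (finv g) = fmult (finv g) (fmult g (fmult b (finv g)))"
    using fmult_cancel(1)[of g "fmult b (finv g)"] assms(1,2) by (simp add: freduced_fmult)
  then have "fmult b (finv g) = finv g"
    using assms by (simp add: fmult_Nil_right)
  then have "fmult (fmult b (finv g)) g = []"
    using assms fmult_finv by simp
  then show ?thesis
    using assms by (simp add: fmult_assoc fmult_finv fmult_Nil_right)
qed

text \<open>Between occurrences of opposite sign the piece is conjugated, by \<open>r\<close> or by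
  \<open>finv l\<close>, hence stays nontrivial; between equal signs an empty piece is allowed. So
  no occurrence of \<open>x\<close> ever cancels.\<close>

lemma reduced_shear_syllables:
  assumes lr: "l \<in> fwords {..<N}" "r \<in> fwords {..<N}"
  shows "reduced_syllables N ss e \<Longrightarrow> reduced_syllables N (shear_syllables l r ss e) e"
proof (induction ss)
  case (Cons y ss)
  obtain d b where y: "y = (d, b)"
    by fastforce
  have red: "freduced l" "freduced r" "freduced b"
    using Cons.prems lr by (auto simp: y fwords_def)
  have "b = []" if "d \<noteq> next_sign ss e"
    "fmult (if d then r else finv l) (fmult b (if next_sign ss e then l else finv r)) = []"
    using that red fmult_conj_eq_Nil[of r b] fmult_conj_eq_Nil[of "finv l" b] by (auto split: if_splits)
  moreover have "fmult (if d then r else finv l) (fmult b (if next_sign ss e then l else finv r)) \<in> fwords {..<N}"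
    using lr Cons.prems by (auto simp: y intro!: fwords_fmult)
  ultimately show ?case
    using Cons by (auto simp: y)
qed simp

text \<open>The factor in front comes from the first occurrence of \<open>x\<close>, the one behind
  from the occurrence that follows the list. When the list is read cyclically they are mutually
  inverse, and the image is a conjugate of the sheared list.\<close>

lemma shear_syllable_word:
  assumes lr: "l \<in> fwords {..<N}" "r \<in> fwords {..<N}" and ss: "reduced_syllables N ss e"
  shows "shear N l r (syllable_word N ss) = fmult (if next_sign ss e then l else finv r)
     (fmult (syllable_word N (shear_syllables l r ss e)) (finv (if e then l else finv r)))"
  using ss
proof (induction ss)
  case Nil
  then show ?case
    using lr by (simp add: shear_def fmult_finv_right fmult_finv fwords_def)
next
  case (Cons y ss)
  obtain d b where y: "y = (d, b)"
    by fastforce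
  have red: "freduced l" "freduced r" "freduced b"
    using Cons.prems lr by (auto simp: y fwords_def)
  define k where "k = (if e then l else finv r)"
  define h where "h = (if next_sign ss e then l else finv r)"
  define f where "f = syllable_word N (shear_syllables l r ss e)"
  define b' where "b' = fmult (if d then r else finv l) (fmult b h)"
  have hk: "freduced h" "freduced k"
    using red by (auto simp: h_def k_def)
  have "freduced (syllable_word N (shear_syllables l r (y # ss) e))"
    using freduced_syllable_word[OF reduced_shear_syllables[OF lr Cons.prems]] by (simp add: freduced_append)
  then have f': "freduced ((N, d) # b' @ f)"
    by (simp add: y f_def b'_def h_def)
  then have f: "freduced f" "(N, d) # b' @ f = fmult [(N, d)] (fmult b' f)"
    using fmult_append[of "[(N, d)]" "b' @ f"] fmult_append[of b' f]
    by (simp_all add: freduced_append freduced_Cons)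
  have "shear N l r (syllable_word N ss) = fmult h (fmult f (finv k))"
    using Cons by (simp add: y h_def f_def k_def)
  moreover have "subst (shear_letter N l r) b = b"
    using shear_fwords[of b "{..<N}" N] Cons.prems by (simp add: y shear_def)
  ultimately have "shear N l r (syllable_word N (y # ss)) =
      fmult (shear_letter N l r (N, d)) (fmult b (fmult h (fmult f (finv k))))"
    by (simp add: y shear_def subst_append)
  also have "\<dots> = fmult (if d then l else finv r) (fmult (fmult [(N, d)] (fmult b' f)) (finv k))"
    using red hk f by (simp add: shear_letter_def b'_def fmult_assoc freduced_fmult)
  finally show ?case
    by (simp add: y f_def[symmetric] h_def[symmetric] b'_def[symmetric] k_def[symmetric] flip: f(2))
qed

text \<open>The list \<open>ss\<close> may be empty: the word is then \<open>x b\<close> and the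
  second \<open>x\<close> is the first one met again cyclically. The default \<open>True\<close> of
  \<open>next_sign\<close> covers this case.\<close>

definition has_segment :: "nat \<Rightarrow> fword set \<Rightarrow> fword \<Rightarrow> bool" where
  "has_segment N E b \<longleftrightarrow> (\<exists>ss. next_sign ss True \<and> reduced_syllables N ((True, b) # ss) True \<and>
     unseparated (free_group (Suc N)) E (syllable_word N ((True, b) # ss)))"

lemma cyc_reduced_syllable_word:
  assumes "reduced_syllables N ((d, b) # ss) d"
  shows "cyc_reduced (syllable_word N ((d, b) # ss))"
  using freduced_syllable_word[OF assms] by (simp add: cyc_reduced_def)

text \<open>The image of the unseparated word is unseparated for the image of the half-space, and it
  is the conjugate by \<open>l\<close> of a syllable word starting with \<open>x r b l\<close>;
  conjugation does no harm to elements of infinite order.\<close>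

lemma has_segment_shear:
  assumes lr: "l \<in> fwords {..<N}" "r \<in> fwords {..<N}" and E: "halfspace (free_group (Suc N)) E"
    and b: "has_segment N E b"
  shows "has_segment N (shear N l r ` E) (fmult r (fmult b l))"
proof -
  let ?G = "free_group (Suc N)"
  interpret group ?G
    by (rule group_free_group)
  have "{..<N} \<subseteq> {..<Suc N}"
    by auto
  then have lc: "l \<in> carrier ?G"
    using lr fwords_mono[of "{..<N}" "{..<Suc N}"] by (auto simp: carrier_free_group)
  obtain ss where ss: "next_sign ss True" "reduced_syllables N ((True, b) # ss) True"
    "unseparated ?G E (syllable_word N ((True, b) # ss))"
    using b by (auto simp: has_segment_def)
  define ts where "ts = shear_syllables l r ss True"
  let ?w = "syllable_word N ((True, b) # ss)" and ?v = "syllable_word N ((True, fmult r (fmult b l)) # ts)"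
  have eq: "shear_syllables l r ((True, b) # ss) True = (True, fmult r (fmult b l)) # ts"
    using ss(1) by (simp add: ts_def)
  have ts: "next_sign ts True" "reduced_syllables N ((True, fmult r (fmult b l)) # ts) True"
    using ss(1) reduced_shear_syllables[OF lr ss(2)] unfolding eq by (simp_all add: ts_def)
  have v: "?v \<in> carrier ?G" "cyc_reduced ?v"
    using syllable_word_carrier[OF ts(2)] cyc_reduced_syllable_word[OF ts(2)] .
  have sw: "shear N l r ?w = l \<otimes>\<^bsub>?G\<^esub> ?v \<otimes>\<^bsub>?G\<^esub> inv\<^bsub>?G\<^esub> l"
  proof -
    have "shear N l r ?w = fmult l (fmult ?v (finv l))"
      using shear_syllable_word[OF lr ss(2)] unfolding eq by (simp del: syllable_word_simps)
    also have "\<dots> = fmult (fmult l ?v) (finv l)"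
      using lr by (subst fmult_assoc) (auto simp: fwords_def simp del: syllable_word_simps)
    finally show ?thesis
      using lc by (simp add: inv_free_group del: syllable_word_simps)
  qed
  have "?v = inv\<^bsub>?G\<^esub> l \<otimes>\<^bsub>?G\<^esub> shear N l r ?w \<otimes>\<^bsub>?G\<^esub> inv\<^bsub>?G\<^esub> (inv\<^bsub>?G\<^esub> l)"
    using lc v(1) unfolding sw by (simp add: m_assoc del: syllable_word_simps mult_free_group one_free_group)
  moreover have "unseparated ?G (shear N l r ` E) (shear N l r ?w)"
    using E unfolding halfspace_def
    by (intro unseparated_image[OF shear_iso[OF lr] _ syllable_word_carrier[OF ss(2)] ss(3)]) blast
  moreover have "shear N l r ?w \<in> carrier ?G" "infinite_order ?G (shear N l r ?w)"
    unfolding sw using infinite_order_conj infinite_order_cyc_reduced v lc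
    by (simp_all del: syllable_word_simps mult_free_group)
  ultimately have "unseparated ?G (shear N l r ` E) ?v"
    using unseparated_conj[OF halfspace_image[OF shear_iso[OF lr] E] _ _ _ inv_closed[OF lc],
        of "shear N l r ?w"] by (simp only:)
  then show ?thesis
    using ts by (auto simp: has_segment_def simp del: syllable_word_simps)
qed

text \<open>The Whitehead graph of a word with full subword is complete on the letters of the first \<open>N\<close> generators.\<close>

definition full :: "nat \<Rightarrow> fword \<Rightarrow> bool" where
  "full N w \<longleftrightarrow> (\<forall>s t. fst s < N \<longrightarrow> fst t < N \<longrightarrow> t \<noteq> flip s \<longrightarrow> sublist [s, t] w)"

text \<open>The cut vertex and the colouring depend on the half-space alone, so the two-letter
  subwords of all words \<open>x b x\<close> obey the same colouring.\<close>

lemma has_segment_cyc_adjacent: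
  assumes E: "halfspace (free_group (Suc N)) E"
  obtains c :: "letter option" and col :: "letter \<Rightarrow> bool" where
    "\<exists>s t. fst s \<le> N \<and> fst t \<le> N \<and> Some s \<noteq> c \<and> Some t \<noteq> c \<and> col s \<noteq> col t"
    "\<And>b s t. \<lbrakk>has_segment N E b; sublist [s, t] ((N, True) # b @ [(N, True)]);
       Some t \<noteq> c; Some (flip s) \<noteq> c\<rbrakk> \<Longrightarrow> col t = col (flip s)"
proof -
  obtain c and col :: "letter \<Rightarrow> bool" where c: "\<exists>s t. fst s < Suc N \<and> fst t < Suc N \<and> Some s \<noteq> c \<and> Some t \<noteq> c \<and> col s \<noteq> col t"
    "\<And>w s t. \<lbrakk>w \<in> carrier (free_group (Suc N)); cyc_reduced w; unseparated (free_group (Suc N)) E w;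
       cyc_adjacent w s t; Some t \<noteq> c; Some (flip s) \<noteq> c\<rbrakk> \<Longrightarrow> col t = col (flip s)"
  proof (rule cut_vertex[OF E], goal_cases)
    case (1 c col)
    show ?case
      by (rule 1(1)[OF 1(2)], rule 1(3))
  qed
  show thesis
  proof (rule that[of c col])
    fix b s t
    assume b: "has_segment N E b" and sub: "sublist [s, t] ((N, True) # b @ [(N, True)])"
      and ne: "Some t \<noteq> c" "Some (flip s) \<noteq> c"
    obtain ss where ss: "next_sign ss True" "reduced_syllables N ((True, b) # ss) True"
      "unseparated (free_group (Suc N)) E (syllable_word N ((True, b) # ss))"
      using b by (auto simp: has_segment_def)
    define w where "w = syllable_word N ((True, b) # ss)"
    obtain v where "syllable_word N ss @ [(N, True)] = (N, True) # v"
      using syllable_word_snoc[of N ss True] ss(1) by auto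
    then have "w @ [hd w] = ((N, True) # b @ [(N, True)]) @ v"
      by (simp add: w_def)
    moreover obtain us vs where "(N, True) # b @ [(N, True)] = us @ [s, t] @ vs"
      using sub by (auto simp: sublist_def)
    ultimately have "w @ [hd w] = us @ s # t # (vs @ v)"
      by simp
    then have "cyc_adjacent w s t"
      unfolding cyc_adjacent_def by (auto simp: w_def)
    then show "col t = col (flip s)"
      using c(2)[of w s t] ne ss syllable_word_carrier[OF ss(2)] cyc_reduced_syllable_word[OF ss(2)]
      unfolding w_def by blast
  qed (use c(1) in \<open>simp add: less_Suc_eq_le\<close>)
qed

lemma fullD: "full N w \<Longrightarrow> fst s < N \<Longrightarrow> fst t < N \<Longrightarrow> t \<noteq> flip s \<Longrightarrow> sublist [s, t] w"
  unfolding full_def by blast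

lemma full_imp_mem:
  assumes "full N w" "fst s < N"
  shows "s \<in> set w"
proof -
  have "sublist [s, s] w"
    using assms by (simp add: fullD)
  then show ?thesis
    using set_mono_sublist by fastforce
qed

lemma fmult_snoc_flip:
  assumes "freduced (m @ [flip y])"
  shows "fmult (m @ [flip y]) [y] = m"
  using assms fmult_append[of m "[flip y]"] fmult_assoc[of "[y]" m "[flip y]"]
  by (simp add: fmult_Cons fstep_def freduced_append fmult_Nil_right)

text \<open>
  If one of two segments is full, then the cut vertex is a letter \<open>y\<close> of the first \<open>N\<close> generators,
  and \<open>x\<close> is always followed by \<open>y\<close>, or always preceded by its inverse, or both up to empty segments.
\<close>

lemma shorten_segments:
  assumes "N \<ge> 2" and E: "halfspace (free_group (Suc N)) E"
    and B: "\<And>b. b \<in> S \<Longrightarrow> b \<in> fwords {..<N}" and seg: "\<And>b. b \<in> S \<Longrightarrow> has_segment N E b"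
    and f: "f \<in> S" "full N f"
  obtains l r where "l \<in> fwords {..<N}" "r \<in> fwords {..<N}"
    "\<And>b. b \<in> S \<Longrightarrow> length (fmult r (fmult b l)) < length b \<or> b = [] \<and> fmult r (fmult b l) = []"
proof -
  let ?x = "(N, True)" and ?X = "(N, False)"
  obtain c and col :: "letter \<Rightarrow> bool" where c: "\<exists>s t. fst s \<le> N \<and> fst t \<le> N \<and> Some s \<noteq> c \<and> Some t \<noteq> c \<and> col s \<noteq> col t"
    and adj: "\<And>b s t. \<lbrakk>has_segment N E b; sublist [s, t] (?x # b @ [?x]);
       Some t \<noteq> c; Some (flip s) \<noteq> c\<rbrakk> \<Longrightarrow> col t = col (flip s)"
  proof (rule has_segment_cyc_adjacent[OF E], goal_cases)
    case (1 c col)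
    show ?case
      by (rule 1(1)[OF 1(2)], rule 1(3))
  qed
  \<comment> \<open>Fullness of \<open>f\<close> joins any two distinct letters of the first
    \<open>N\<close> generators by an edge, so at most one vertex \<open>c\<close> is lost and the
    others share a colour.\<close>
  have const: "col s = col t" if "fst s < N" "fst t < N" "Some s \<noteq> c" "Some t \<noteq> c" for s t
  proof (cases "s = t")
    case False
    have "sublist [flip s, t] f"
      using fullD[OF f(2), of "flip s" t] that False by simp
    then obtain us vs where "f = us @ [flip s, t] @ vs"
      by (auto simp: sublist_def)
    then have "?x # f @ [?x] = (?x # us) @ [flip s, t] @ (vs @ [?x])"
      by simp
    then have "sublist [flip s, t] (?x # f @ [?x])"
      by (metis sublist_appendI)
    then show ?thesis
      using adj[OF seg[OF f(1)], of "flip s" t] that by simp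
  qed simp
  obtain \<kappa> where \<kappa>: "\<And>s. fst s < N \<Longrightarrow> Some s \<noteq> c \<Longrightarrow> col s = \<kappa>"
  proof (cases "\<exists>t. fst t < N \<and> Some t \<noteq> c")
    case True
    then obtain t where "fst t < N" "Some t \<noteq> c"
      by blast
    then show thesis
      using const[of _ t] that[of "col t"] by blast
  qed (use that in blast)
  have first: "Some (hd b) = c \<or> Some ?X = c \<or> col ?X = \<kappa>" if "b \<in> S" "b \<noteq> []" for b
  proof -
    have "?x # b @ [?x] = [] @ [?x, hd b] @ tl b @ [?x]"
      using that by simp
    then have "sublist [?x, hd b] (?x # b @ [?x])"
      by (metis sublist_appendI)
    moreover have "fst (hd b) < N"
      using B[OF that(1)] that(2) by (cases b) (auto simp: fwords_def)
    ultimately show ?thesis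
      using adj[OF seg[OF that(1)], of ?x "hd b"] \<kappa>[of "hd b"] by auto
  qed
  have final: "Some (flip (last b)) = c \<or> Some ?x = c \<or> col ?x = \<kappa>" if "b \<in> S" "b \<noteq> []" for b
  proof -
    have "?x # b @ [?x] = (?x # butlast b) @ [last b, ?x] @ []"
      using that by simp
    then have "sublist [last b, ?x] (?x # b @ [?x])"
      by (metis sublist_appendI)
    moreover have "fst (last b) < N"
      using B[OF that(1)] that(2) by (cases b rule: rev_cases) (auto simp: fwords_def)
    ultimately show ?thesis
      using adj[OF seg[OF that(1)], of "last b" ?x] \<kappa>[of "flip (last b)"] by auto
  qed
  have empty: "Some ?x = c \<or> Some ?X = c \<or> col ?x = col ?X" if "[] \<in> S"
    using adj[OF seg[OF that], of ?x ?x] by auto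
  have "f \<noteq> []"
    using full_imp_mem[OF f(2), of "(0, True)"] \<open>N \<ge> 2\<close> by auto
  have "fst s < N \<or> s = ?x \<or> s = ?X" if "fst s \<le> N" for s
    using that by (cases s) auto
  \<comment> \<open>The colouring is not constant, so the exceptional colour sits at
    \<open>x\<close> or at its inverse.\<close>
  then have ne: "Some ?X \<noteq> c \<and> col ?X \<noteq> \<kappa> \<or> Some ?x \<noteq> c \<and> col ?x \<noteq> \<kappa>"
    using c \<kappa> by metis
  have red: "freduced b" "fst (hd b) < N" "fst (last b) < N" if "b \<in> S" "b \<noteq> []" for b
  proof -
    have "\<forall>s \<in> set b. fst s < N"
      using B[OF that(1)] by (auto simp: fwords_def)
    then show "fst (hd b) < N" "fst (last b) < N"
      using that(2) hd_in_set[of b] last_in_set[of b] by blast+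
  qed (use B[OF that(1)] in \<open>simp add: fwords_def\<close>)
  show thesis
  proof (cases "Some ?X \<noteq> c \<and> col ?X \<noteq> \<kappa>")
    case True
    define y where "y = hd f"
    have y: "c = Some y" "fst y < N"
      using first[OF f(1) \<open>f \<noteq> []\<close>] True red[OF f(1) \<open>f \<noteq> []\<close>] by (auto simp: y_def)
    have hd: "hd b = y" if "b \<in> S" "b \<noteq> []" for b
      using first[OF that] True y by auto
    show thesis
    \<comment> \<open>If \<open>x\<close> has the common colour, an empty segment would join
      \<open>x\<close> to its inverse across colours; all segments are then nonempty and lose their
      first letter \<open>y\<close>. Otherwise each nonempty segment runs from \<open>y\<close> to
      \<open>flip y\<close>, conjugation removes both ends, and empty segments stay empty.\<close>
    proof (cases "col ?x = \<kappa>")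
      case col: True
      have "length (fmult [flip y] (fmult b [])) < length b" if b: "b \<in> S" for b
      proof -
        have "b \<noteq> []"
          using empty True col y b by auto
        then obtain b' where "b = y # b'"
          using hd[OF b] by (cases b) auto
        then show ?thesis
          using red(1)[OF b] by (auto simp: fmult_Nil_right fmult_Cons fstep_def freduced_Cons)
      qed
      then show thesis
        using that[of "[]" "[flip y]"] y by auto
    next
      case False
      have last: "last b = flip y" if "b \<in> S" "b \<noteq> []" for b
        using final[OF that] False y by (auto simp flip: flip_eq_iff[of "last b"])
      have "length (fmult [flip y] (fmult b [y])) < length b \<or> b = [] \<and> fmult [flip y] (fmult b [y]) = []"
        if b: "b \<in> S" for b
      proof (cases "b = []")
        case False
        then obtain b' where b': "b = y # b'"
          using hd[OF b] by (cases b) auto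
        then have "b' \<noteq> []"
          using last[OF b] by auto
        then obtain m where m: "b' = m @ [flip y]"
          using last[OF b] b' by (cases b' rule: rev_cases) auto
        have "freduced (y # m @ [flip y])"
          using red(1)[OF b False] by (simp add: b' m)
        then have "fmult b [y] = y # m"
          using fmult_snoc_flip[of "y # m" y] by (simp add: b' m)
        then show ?thesis
          by (simp add: fmult_Cons fstep_def b' m)
      qed (simp add: fmult_Cons fstep_def)
      then show thesis
        using that[of "[y]" "[flip y]"] y by auto
    qed
  next
    case False
    then have x: "Some ?x \<noteq> c" "col ?x \<noteq> \<kappa>"
      using ne by auto
    define y where "y = flip (last f)"
    have y: "c = Some y" "fst y < N"
      using final[OF f(1) \<open>f \<noteq> []\<close>] x red[OF f(1) \<open>f \<noteq> []\<close>] by (auto simp: y_def)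
    have "length (fmult [] (fmult b [y])) < length b" if b: "b \<in> S" for b
    proof -
      have "b \<noteq> []"
        using empty False x y b by auto
      then have "last b = flip y"
        using final[OF b] x y by (auto simp flip: flip_eq_iff[of "last b"])
      then obtain m where m: "b = m @ [flip y]"
        using \<open>b \<noteq> []\<close> by (cases b rule: rev_cases) auto
      have "freduced (m @ [flip y])"
        using red(1)[OF b \<open>b \<noteq> []\<close>] by (simp add: m)
      then have "fmult b [y] = m"
        unfolding m by (rule fmult_snoc_flip)
      then show ?thesis
        by (simp add: m)
    qed
    then show thesis
      using that[of "[y]" "[]"] y by auto
  qed
qed

text \<open>Each step multiplies both segments by the same words on the left and on the right, so
  undoing all steps restores them with the same \<open>p\<close> and \<open>q\<close>. While one of
  them is full, hence nonempty, the total length drops. The half-space is replaced by its image in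
  each step, so the induction generalises over \<open>E\<close>.\<close>

lemma segments_common_factors:
  assumes "N \<ge> 2" "halfspace (free_group (Suc N)) E"
    and "has_segment N E b" "has_segment N E b'"
  obtains p q c c' where "p \<in> fwords {..<N}" "q \<in> fwords {..<N}" "c \<in> fwords {..<N}" "c' \<in> fwords {..<N}"
    "b = fmult p (fmult c q)" "b' = fmult p (fmult c' q)" "\<not> full N c" "\<not> full N c'"
proof -
  have B: "b \<in> fwords {..<N}" if "has_segment N E b" for E b
    using that by (auto simp: has_segment_def)
  have "\<exists>p q c c'. p \<in> fwords {..<N} \<and> q \<in> fwords {..<N} \<and> c \<in> fwords {..<N} \<and> c' \<in> fwords {..<N} \<and>
      b = fmult p (fmult c q) \<and> b' = fmult p (fmult c' q) \<and> \<not> full N c \<and> \<not> full N c'"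
    using assms(2-4)
  proof (induction "length b + length b'" arbitrary: b b' E rule: less_induct)
    case less
    have b: "b \<in> fwords {..<N}" "b' \<in> fwords {..<N}"
      using less.prems B by auto
    show ?case
    proof (cases "full N b \<or> full N b'")
      case False
      then show ?thesis
        using b by (intro exI[of _ "[]"] exI[of _ b] exI[of _ b']) (simp add: fmult_Nil_right fwords_def)
    next
      case True
      then obtain f where f: "f \<in> {b, b'}" "full N f"
        by blast
      obtain l r where lr: "l \<in> fwords {..<N}" "r \<in> fwords {..<N}"
        and len: "\<And>a. a \<in> {b, b'} \<Longrightarrow> length (fmult r (fmult a l)) < length a \<or> a = [] \<and> fmult r (fmult a l) = []"
      proof (rule shorten_segments[OF assms(1) less.prems(1) _ _ f], goal_cases)
        case (3 l r)
        show ?case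
          by (rule 3(1)[OF 3(2,3)], rule 3(4))
      qed (use b less.prems(2,3) in auto)
      have "f \<noteq> []"
        using full_imp_mem[OF f(2), of "(0, True)"] assms(1) by auto
      then have "length (fmult r (fmult b l)) + length (fmult r (fmult b' l)) < length b + length b'"
        using len[of b] len[of b'] f(1) by auto
      from less.hyps[OF this group.halfspace_image[OF group_free_group shear_iso[OF lr] less.prems(1)]
          has_segment_shear[OF lr less.prems(1,2)] has_segment_shear[OF lr less.prems(1,3)]]
      obtain p q c c' where IH: "p \<in> fwords {..<N}" "q \<in> fwords {..<N}" "c \<in> fwords {..<N}" "c' \<in> fwords {..<N}"
        "fmult r (fmult b l) = fmult p (fmult c q)" "fmult r (fmult b' l) = fmult p (fmult c' q)"
        "\<not> full N c" "\<not> full N c'"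
        by (elim exE conjE)
      have red: "freduced w" if "w \<in> {l, r, b, b', p, q, c, c'}" for w
        using that lr b IH(1-4) by (auto simp: fwords_def)
      have eq: "a = fmult (fmult (finv r) p) (fmult d (fmult q (finv l)))"
        if "a \<in> {b, b'}" "d \<in> {c, c'}" "fmult r (fmult a l) = fmult p (fmult d q)" for a d
      proof -
        have ad: "freduced a" "freduced d" and rest: "freduced l" "freduced r" "freduced p" "freduced q"
          using red that(1,2) by auto
        have "a = fmult (finv r) (fmult (fmult r (fmult a l)) (finv l))"
          using ad rest by (simp add: fmult_assoc freduced_fmult fmult_finv_right fmult_Nil_right fmult_cancel)
        also have "\<dots> = fmult (finv r) (fmult (fmult p (fmult d q)) (finv l))"
          by (simp only: that(3))
        also have "\<dots> = fmult (fmult (finv r) p) (fmult d (fmult q (finv l)))"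
          using ad rest by (simp add: fmult_assoc freduced_fmult)
        finally show ?thesis .
      qed
      show ?thesis
      proof (intro exI conjI)
        show "b = fmult (fmult (finv r) p) (fmult c (fmult q (finv l)))"
          "b' = fmult (fmult (finv r) p) (fmult c' (fmult q (finv l)))"
          using IH(5,6) by (auto intro!: eq)
      qed (use IH lr in \<open>auto intro!: fwords_fmult\<close>)
    qed
  qed
  then show thesis
    using that by blast
qed

section \<open>Counting quasimorphisms\<close>

primrec occ :: "fword \<Rightarrow> fword \<Rightarrow> nat" where
  "occ u [] = 0"
| "occ u (x # w) = of_bool (prefix u (x # w)) + occ u w"

definition brooks :: "fword \<Rightarrow> fword \<Rightarrow> int" where
  "brooks u w = int (occ u w) - int (occ (finv u) w)"

lemma occ_append_ge: "occ u (v @ w) \<ge> occ u v + occ u w"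
proof (induction v)
  case (Cons x v)
  have "prefix u (x # v) \<Longrightarrow> prefix u (x # v @ w)"
    by (metis append_Cons prefix_prefix)
  then show ?case
    using Cons by (auto simp: of_bool_def simp del: prefix_Cons)
qed simp

text \<open>New occurrences straddle the junction, so they begin among the last
  \<open>length u\<close> letters of \<open>v\<close>. The minimum lets the induction on
  \<open>v\<close> start at 0.\<close>

lemma occ_append_le: "occ u (v @ w) \<le> occ u v + occ u w + min (length v) (length u)"
proof (induction v)
  case (Cons x v)
  show ?case
  proof (cases "length (x # v) \<ge> length u")
    case True
    then have "prefix u (x # v @ w) \<longleftrightarrow> prefix u (x # v)"
      by (metis append_Cons prefix_length_prefix prefix_prefix prefixI)
    then show ?thesis
      using Cons by (auto simp: min_def of_bool_def simp del: prefix_Cons split: if_splits)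
  qed (use Cons in \<open>auto simp: of_bool_def simp del: prefix_Cons\<close>)
qed simp

text \<open>Counts occurrences by where they end instead of where they begin, which is what
  inversion of words exchanges.\<close>

lemma occ_snoc: "u \<noteq> [] \<Longrightarrow> occ u (w @ [x]) = occ u w + of_bool (suffix u (w @ [x]))"
proof (induction w)
  case Nil
  then show ?case
    by (cases u) (auto simp: suffix_def Cons_eq_append_conv)
next
  case (Cons y w)
  have 1: "prefix u (y # w @ [x]) \<longleftrightarrow> prefix u (y # w) \<or> u = y # w @ [x]"
    using prefix_snoc[of u "y # w" x] by auto
  have 2: "suffix u (y # w @ [x]) \<longleftrightarrow> suffix u (w @ [x]) \<or> u = y # w @ [x]"
    by (auto simp: suffix_Cons)
  have 3: "\<not> prefix u (y # w)" "\<not> suffix u (w @ [x])" if "u = y # w @ [x]"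
    using that by (auto dest: prefix_length_le suffix_length_le)
  show ?case
    using Cons 3 by (cases "u = y # w @ [x]") (simp_all add: 1 2 del: prefix_Cons)
qed

lemma prefix_finv: "prefix (finv u) (finv w) \<longleftrightarrow> suffix u w"
  by (metis finv_finv finv_simps(3) prefix_def suffix_def)

lemma occ_finv: "u \<noteq> [] \<Longrightarrow> occ (finv u) (finv w) = occ u w"
proof (induction w rule: rev_induct)
  case (snoc x w)
  have "prefix (finv u) (flip x # finv w) \<longleftrightarrow> suffix u (w @ [x])"
    using prefix_finv[of u "w @ [x]"] by simp
  then show ?case
    using snoc by (simp add: occ_snoc del: prefix_Cons)
qed simp

lemma occ_eq_0: "\<not> sublist u w \<Longrightarrow> occ u w = 0"
  by (induction w) (auto simp: sublist_Cons_right simp del: prefix_Cons)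

lemma brooks_finv: "u \<noteq> [] \<Longrightarrow> brooks u (finv w) = - brooks u w"
  using occ_finv[of u w] occ_finv[of "finv u" w] by (simp add: brooks_def)

lemma brooks_Nil [simp]: "brooks u [] = 0"
  by (simp add: brooks_def)

lemma brooks_append: "\<bar>brooks u (v @ w) - brooks u v - brooks u w\<bar> \<le> int (length u)"
  using occ_append_ge[of u v w] occ_append_ge[of "finv u" v w] occ_append_le[of u v w]
    occ_append_le[of "finv u" v w] by (simp add: brooks_def)

lemma fmult_decompose:
  assumes "freduced v" "freduced w"
  obtains a d b where "v = a @ d" "w = finv d @ b" "fmult v w = a @ b"
proof -
  have "\<exists>a d b. v = a @ d \<and> w = finv d @ b \<and> fmult v w = a @ b"
    using assms(1)
  proof (induction v)
    case (Cons x v)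
    then obtain a d b where adb: "v = a @ d" "w = finv d @ b" "fmult v w = a @ b"
      by (auto simp: freduced_Cons)
    show ?case
    proof (cases "a = [] \<and> b \<noteq> [] \<and> hd b = flip x")
      case True
      then have "w = finv (x # v) @ tl b \<and> fmult (x # v) w = tl b"
        using adb by (cases b) (auto simp: fmult_Cons fstep_def)
      then show ?thesis
        by (metis append_Nil)
    next
      case False
      then have "fmult (x # v) w = (x # a) @ b"
        using adb Cons.prems by (cases a) (auto simp: fmult_Cons fstep_def freduced_Cons)
      then show ?thesis
        using adb by (intro exI[of _ "x # a"] exI[of _ d] exI[of _ b]) simp
    qed
  qed simp
  then show thesis
    using that by blast
qed

text \<open>Write the factors as \<open>a d\<close> and \<open>finv d b\<close>, where
  \<open>d\<close> cancels. The values of \<open>d\<close> and \<open>finv d\<close> are opposite,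
  and each of the three concatenations \<open>a d\<close>, \<open>finv d b\<close>,
  \<open>a b\<close> costs \<open>length u\<close>.\<close>

lemma brooks_fmult:
  assumes "u \<noteq> []" "freduced v" "freduced w"
  shows "\<bar>brooks u (fmult v w) - brooks u v - brooks u w\<bar> \<le> 3 * int (length u)"
proof -
  obtain a d b where "v = a @ d" "w = finv d @ b" "fmult v w = a @ b"
    using fmult_decompose[OF assms(2,3)] .
  then show ?thesis
    using brooks_append[of u a d] brooks_append[of u "finv d" b] brooks_append[of u a b]
      brooks_finv[OF assms(1), of d] by simp
qed

lemma full_sublist: "full N u \<Longrightarrow> sublist u w \<Longrightarrow> full N w"
  unfolding full_def using sublist_order.order_trans by blast

lemma full_finv:
  assumes "full N u"
  shows "full N (finv u)"
  unfolding full_def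
proof (intro allI impI)
  fix s t :: letter assume st: "fst s < N" "fst t < N" "t \<noteq> flip s"
  then have "sublist [flip t, flip s] u"
    by (intro fullD[OF assms]) auto
  then obtain us vs where "u = us @ [flip t, flip s] @ vs"
    by (auto simp: sublist_def)
  then have "finv u = finv vs @ [s, t] @ finv us"
    by simp
  then show "sublist [s, t] (finv u)"
    by (metis sublist_appendI)
qed

lemma brooks_not_full:
  assumes "full N u" "\<not> full N w"
  shows "brooks u w = 0"
proof -
  have "\<not> sublist u w" "\<not> sublist (finv u) w"
    using assms full_sublist full_finv by blast+
  then show ?thesis
    by (simp add: brooks_def occ_eq_0)
qed

text \<open>Both values are close to \<open>brooks u p + brooks u q\<close>: the middle words
  contain neither \<open>u\<close> nor its inverse, and two multiplications cost
  \<open>6 * length u\<close> for each segment.\<close>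

lemma brooks_segments:
  assumes "N \<ge> 2" "halfspace (free_group (Suc N)) E" "has_segment N E b" "has_segment N E b'"
    and u: "full N u"
  shows "\<bar>brooks u b - brooks u b'\<bar> \<le> 12 * int (length u)"
proof -
  have "u \<noteq> []"
    using full_imp_mem[OF u, of "(0, True)"] assms(1) by auto
  obtain p q c c' where pq: "p \<in> fwords {..<N}" "q \<in> fwords {..<N}" "c \<in> fwords {..<N}" "c' \<in> fwords {..<N}"
    and b: "b = fmult p (fmult c q)" "b' = fmult p (fmult c' q)" and nf: "\<not> full N c" "\<not> full N c'"
    using segments_common_factors[OF assms(1-4)] by blast
  have "\<bar>brooks u (fmult p (fmult d q)) - brooks u p - brooks u q\<bar> \<le> 6 * int (length u)"
    if "d \<in> fwords {..<N}" "\<not> full N d" for d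
  proof -
    have "brooks u d = 0" "freduced p" "freduced q" "freduced d"
      using that u brooks_not_full pq by (auto simp: fwords_def)
    then show ?thesis
      using brooks_fmult[OF \<open>u \<noteq> []\<close>, of p "fmult d q"] brooks_fmult[OF \<open>u \<noteq> []\<close>, of d q]
      by (simp add: freduced_fmult)
  qed
  from this[OF pq(3) nf(1)] this[OF pq(4) nf(2)] show ?thesis
    by (simp add: b)
qed

subsection \<open>Independent full words\<close>

text \<open>Append the required two-letter words one at a time, each after a connecting letter; rank
  2 offers four letters, enough to avoid a cancellation on both sides of it. The prescribed end
  letters \<open>z\<close> serve as markers when copies of \<open>V\<close> are located in periodic
  words.\<close>

lemma exists_full_word:
  assumes "N \<ge> 2" "fst z < N"
  obtains V where "V \<in> fwords {..<N}" "full N V" "V \<noteq> []" "hd V = z" "last V = z"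
proof -
  have ex: "\<exists>k. fst k < N \<and> k \<noteq> s \<and> k \<noteq> t" for s t :: letter
  proof -
    have "card ({..<2::nat} \<times> (UNIV :: bool set)) = 4"
      by simp
    moreover have "card {s, t} \<le> 2"
      by (cases "s = t") auto
    ultimately have "\<not> {..<2} \<times> (UNIV :: bool set) \<subseteq> {s, t}"
      using card_mono[of "{s, t}" "{..<2} \<times> (UNIV :: bool set)"] by auto
    then obtain k where "k \<in> {..<2} \<times> (UNIV :: bool set)" "k \<notin> {s, t}"
      by blast
    then show ?thesis
      using assms(1) by (intro exI[of _ k]) auto
  qed
  define P where "P = {(s :: letter, t :: letter). fst s < N \<and> fst t < N \<and> t \<noteq> flip s}"
  have "P \<subseteq> ({..<N} \<times> UNIV) \<times> ({..<N} \<times> UNIV)"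
    by (auto simp: P_def)
  then have "finite P"
    by (rule finite_subset) simp
  have "\<exists>V. V \<in> fwords {..<N} \<and> V \<noteq> [] \<and> hd V = z \<and> (\<forall>(s, t) \<in> Q. sublist [s, t] V)" if "Q \<subseteq> P" for Q
    using finite_subset[OF that \<open>finite P\<close>] that
  proof (induction Q rule: finite_induct)
    case empty
    then show ?case
      using assms(2) by (intro exI[of _ "[z]"]) simp
  next
    case (insert p Q)
    obtain s t where p: "p = (s, t)"
      by (rule prod.exhaust)
    then have st: "fst s < N" "fst t < N" "t \<noteq> flip s"
      using insert.prems by (auto simp: P_def)
    obtain V where V: "V \<in> fwords {..<N}" "V \<noteq> []" "hd V = z" "\<forall>(s, t) \<in> Q. sublist [s, t] V"
      using insert by auto
    obtain k where k: "fst k < N" "k \<noteq> flip (last V)" "k \<noteq> flip s"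
      using ex by blast
    have "s \<noteq> flip k"
      using k(3) by auto
    then have "V @ k # [s, t] \<in> fwords {..<N}"
      using V(1,2) k st by (simp add: fwords_def freduced_append freduced_Cons)
    moreover have "sublist [s', t'] (V @ k # [s, t])" if "sublist [s', t'] V \<or> (s', t') = (s, t)" for s' t'
      using that sublist_appendI[of "[s, t]" "V @ [k]" "[]"]
      by (auto intro: sublist_order.order_trans[OF _ sublist_append_rightI])
    ultimately show ?case
      using V by (intro exI[of _ "V @ k # [s, t]"]) (auto simp: p)
  qed
  then obtain V where V: "V \<in> fwords {..<N}" "V \<noteq> []" "hd V = z" "\<forall>(s, t) \<in> P. sublist [s, t] V"
    by blast
  obtain k where k: "fst k < N" "k \<noteq> flip (last V)" "k \<noteq> flip z"
    using ex by blast
  have "z \<noteq> flip k"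
    using k(3) by auto
  then have "V @ [k, z] \<in> fwords {..<N}"
    using V(1,2) k assms(2) by (simp add: fwords_def freduced_append freduced_Cons)
  moreover have "full N (V @ [k, z])"
  proof (rule full_sublist)
    show "full N V"
      unfolding full_def using V(4) unfolding P_def by blast
  qed simp
  ultimately show thesis
    using that[of "V @ [k, z]"] V by simp
qed

lemma nth_concat_replicate:
  "t < k * length w \<Longrightarrow> concat (replicate k w) ! t = w ! (t mod length w)"
proof (induction k arbitrary: t)
  case (Suc k)
  then show ?case
    by (cases "t < length w") (auto simp: nth_append le_mod_geq)
qed simp

lemma length_concat_replicate: "length (concat (replicate k w)) = k * length w"
  by (induction k) auto

lemma mod_add_less: "j0 mod p + e < p \<Longrightarrow> (j0 + e) mod p = j0 mod p + e" for j0 p e :: nat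
  by (metis mod_add_left_eq mod_less)

lemma sublist_nth:
  assumes "sublist u w"
  obtains j0 where "\<And>i. i < length u \<Longrightarrow> j0 + i < length w \<and> w ! (j0 + i) = u ! i"
proof -
  obtain us vs where "w = us @ u @ vs"
    using assms by (auto simp: sublist_def)
  then show thesis
    using that[of "length us"] by (auto simp: nth_append)
qed

context
  fixes V :: fword and y z :: letter
  assumes V: "V \<noteq> []" "hd V = z" "last V = z" and yz: "y \<noteq> z"
begin

lemma periodic_nth:
  assumes "t < length (concat (replicate k (V @ replicate M y)))"
  shows "concat (replicate k (V @ replicate M y)) ! t =
    (if t mod (length V + M) < length V then V ! (t mod (length V + M)) else y)"
proof -
  have "t mod (length V + M) < length V + M"
    using V by simp
  then show ?thesis
    using assms nth_concat_replicate[of t k "V @ replicate M y"]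
    by (simp add: length_concat_replicate nth_append)
qed

text \<open>A letter \<open>z\<close> followed by at least \<open>length V\<close> letters
  \<open>y\<close> must be the last letter of a copy of \<open>V\<close>, since otherwise the
  \<open>z\<close> that ends this copy would fall into the run. From there the next \<open>z\<close>
  comes right after \<open>M\<close> letters \<open>y\<close>, so the run lengths agree.\<close>

lemma not_sublist_periodic:
  assumes M: "length V \<le> M'" and sub: "sublist (V @ replicate M' y @ V) (concat (replicate k (V @ replicate M y)))"
  shows "M' = M"
proof -
  let ?u = "V @ replicate M' y @ V" and ?w = "concat (replicate k (V @ replicate M y))"
  let ?P = "length V + M"
  obtain j1 where j1: "\<And>i. i < length ?u \<Longrightarrow> j1 + i < length ?w \<and> ?w ! (j1 + i) = ?u ! i"
    using sublist_nth[OF sub] by blast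
  \<comment> \<open>Position of the last letter of the first \<open>V\<close> of the pattern, just
    before its run of \<open>y\<close>.\<close>
  define j0 where "j0 = j1 + (length V - 1)"
  have V0: "V ! 0 = z" "V ! (length V - 1) = z" "length V > 0"
    using V by (simp_all add: hd_conv_nth last_conv_nth)
  have Q: "?u ! (length V - 1 + i) = (if (j0 + i) mod ?P < length V then V ! ((j0 + i) mod ?P) else y)"
    if "i \<le> Suc M'" for i
  proof -
    have "length V - 1 + i < length ?u"
      using that V0(3) unfolding length_append length_replicate by linarith
    then have "j0 + i < length ?w" "?w ! (j0 + i) = ?u ! (length V - 1 + i)"
      using j1[of "length V - 1 + i"] unfolding j0_def add.assoc by auto
    then show ?thesis
      using periodic_nth[of "j0 + i" k M] by (simp only:)
  qed
  have u0: "?u ! (length V - 1 + 0) = z"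
    using V0 by (simp add: nth_append)
  have u1: "?u ! (length V - 1 + i) = y" if i: "1 \<le> i" "i \<le> M'" for i
  proof -
    obtain i' where "i = Suc i'"
      using i by (cases i) auto
    then have "length V - 1 + i = length V + i'" "i' < M'"
      using i V0(3) by auto
    then show ?thesis
      by (simp only: nth_append_length_plus) (simp add: nth_append)
  qed
  have "length V - 1 + Suc M' = length V + (length (replicate M' y) + 0)"
    using V0(3) by simp
  then have u2: "?u ! (length V - 1 + Suc M') = z"
    using V0(1) by (simp only: nth_append_length_plus)
  define s where "s = j0 mod ?P"
  have s: "s < length V"
    using Q[of 0] u0 yz by (auto simp: s_def split: if_splits)
  have "s = length V - 1"
  proof (rule ccontr)
    assume "s \<noteq> length V - 1"
    then have e: "1 \<le> length V - 1 - s" "length V - 1 - s \<le> M'"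
      using s M by auto
    have "(j0 + (length V - 1 - s)) mod ?P = length V - 1"
      using mod_add_less[of j0 ?P "length V - 1 - s"] s by (simp add: s_def)
    then show False
      using Q[of "length V - 1 - s"] u1[OF e] e V0 yz by simp
  qed
  then have s_eq: "j0 mod ?P = length V - 1"
    by (simp only: s_def)
  have mod: "(j0 + i) mod ?P = length V - 1 + i" if "i \<le> M" for i
  proof -
    have "j0 mod ?P + i < ?P"
      using that V0(3) unfolding s_eq by linarith
    then show ?thesis
      using mod_add_less[of j0 ?P i] unfolding s_eq by blast
  qed
  have "(j0 + Suc M) mod ?P = Suc (j0 + M) mod ?P"
    by simp
  also have "\<dots> = 0"
    using mod[of M] V0(3) by (simp add: mod_Suc)
  finally have mod2: "(j0 + Suc M) mod ?P = 0" .
  show ?thesis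
  proof (rule linorder_cases)
    assume "M' < M"
    then show ?thesis
      using Q[of "Suc M'"] u2 mod[of "Suc M'"] yz V0(3) by simp
  next
    assume "M < M'"
    then show ?thesis
      using Q[of "Suc M"] u1[of "Suc M"] mod2 yz V0 by simp
  qed
qed

text \<open>The inverse pattern has a run of more than \<open>length V\<close> letters
  \<open>flip y\<close>. Such a run does not fit inside a copy of \<open>V\<close>, and outside
  these copies there are only letters \<open>y\<close>.\<close>

lemma not_sublist_finv_periodic:
  assumes M: "length V < M'" "0 < M"
  shows "\<not> sublist (finv (V @ replicate M' y @ V)) (concat (replicate k (V @ replicate M y)))"
proof
  let ?r = "replicate M' (flip y)" and ?w = "concat (replicate k (V @ replicate M y))"
  let ?P = "length V + M"
  have "finv (replicate j y) = replicate j (flip y)" for j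
    by (induction j) (simp_all flip: replicate_append_same)
  moreover assume "sublist (finv (V @ replicate M' y @ V)) ?w"
  ultimately have "sublist (finv V @ ?r @ finv V) ?w"
    by simp
  then have "sublist ?r ?w"
    using sublist_appendI sublist_order.order_trans by blast
  then obtain j0 where j0: "\<And>i. i < length ?r \<Longrightarrow> j0 + i < length ?w \<and> ?w ! (j0 + i) = ?r ! i"
    using sublist_nth by blast
  then have Q: "flip y = (if (j0 + i) mod ?P < length V then V ! ((j0 + i) mod ?P) else y)" if "i < M'" for i
    using that periodic_nth[of "j0 + i" k M] by simp
  have s: "j0 mod ?P < length V"
    using Q[of 0] M(1) by (auto split: if_splits)
  then have "(j0 + (length V - j0 mod ?P)) mod ?P = length V"
    using mod_add_less[of j0 ?P "length V - j0 mod ?P"] M by simp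
  then show False
    using Q[of "length V - j0 mod ?P"] M(1) less_imp_diff_less[OF M(1)] by simp
qed

text \<open>The pattern takes one period and the \<open>V\<close> of the following one, so the last
  period is not counted; hence the loss of 1 in later estimates.\<close>

lemma occ_periodic: "occ (V @ replicate M y @ V) (concat (replicate (Suc k) (V @ replicate M y))) \<ge> k"
proof (induction k)
  case (Suc k)
  let ?w = "concat (replicate (Suc k) (V @ replicate M y))"
  obtain x v where xv: "V @ replicate M y = x # v"
    using V by (cases V) auto
  have "prefix (V @ replicate M y @ V) ((V @ replicate M y) @ ?w)"
    by simp
  then have "prefix (V @ replicate M y @ V) (x # v @ ?w)"
    unfolding xv by simp
  then have "occ (V @ replicate M y @ V) ((V @ replicate M y) @ ?w) \<ge> 1 + occ (V @ replicate M y @ V) ?w"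
    using occ_append_ge[of "V @ replicate M y @ V" v ?w] unfolding xv by (simp del: prefix_Cons replicate_Suc)
  then show ?case
    using Suc by simp
qed simp

end

section \<open>Segments of group elements and of splittings\<close>

definition exponent :: "nat \<Rightarrow> fword \<Rightarrow> int" where
  "exponent N w = (\<Sum>s \<leftarrow> w. if fst s = N then if snd s then 1 else - 1 else 0)"

definition segment_of :: "nat \<Rightarrow> fword \<Rightarrow> fword \<Rightarrow> bool" where
  "segment_of N a b \<longleftrightarrow> (\<exists>g ss. g \<in> carrier (free_group (Suc N)) \<and> next_sign ss True \<and>
     reduced_syllables N ((True, b) # ss) True \<and>
     a = g \<otimes>\<^bsub>free_group (Suc N)\<^esub> syllable_word N ((True, b) # ss) \<otimes>\<^bsub>free_group (Suc N)\<^esub>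
       inv\<^bsub>free_group (Suc N)\<^esub> g)"

lemma exponent_simps [simp]:
  "exponent N [] = 0" "exponent N (s # w) = (if fst s = N then if snd s then 1 else - 1 else 0) + exponent N w"
  "exponent N (v @ w) = exponent N v + exponent N w"
  by (simp_all add: exponent_def)

lemma exponent_fmult: "exponent N (fmult v w) = exponent N v + exponent N w"
proof -
  have "exponent N (fstep s w) = exponent N [s] + exponent N w" for s w
    by (cases w) (auto simp: fstep_def flip_def)
  then show ?thesis
    by (induction v) (auto simp: fmult_Cons)
qed

lemma exponent_finv [simp]: "exponent N (finv w) = - exponent N w"
  by (induction w) (auto simp: flip_def)

lemma exponent_eq_0: "fst ` set w \<subseteq> {..<N} \<Longrightarrow> exponent N w = 0"
  by (induction w) auto

context group
begin

lemma conj_conj: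
  assumes "g \<in> carrier G" "h \<in> carrier G" "a \<in> carrier G"
  shows "g \<otimes> (h \<otimes> a \<otimes> inv h) \<otimes> inv g = (g \<otimes> h) \<otimes> a \<otimes> inv (g \<otimes> h)"
  using assms by (simp add: m_assoc inv_mult_group)

end

lemma exists_cyc_reduced_conj:
  assumes "a \<in> carrier (free_group n)" "a \<noteq> []"
  obtains g w where "g \<in> carrier (free_group n)" "w \<in> carrier (free_group n)" "cyc_reduced w"
    "a = g \<otimes>\<^bsub>free_group n\<^esub> w \<otimes>\<^bsub>free_group n\<^esub> inv\<^bsub>free_group n\<^esub> g"
proof -
  let ?G = "free_group n"
  interpret group ?G
    by (rule group_free_group)
  have "\<exists>g w. g \<in> carrier ?G \<and> w \<in> carrier ?G \<and> cyc_reduced w \<and> a = g \<otimes>\<^bsub>?G\<^esub> w \<otimes>\<^bsub>?G\<^esub> inv\<^bsub>?G\<^esub> g"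
    using assms
  proof (induction "length a" arbitrary: a rule: less_induct)
    case less
    show ?case
    proof (cases "cyc_reduced a")
      case True
      then show ?thesis
        using less.prems by (intro exI[of _ "\<one>\<^bsub>?G\<^esub>"] exI[of _ a]) (simp del: mult_free_group one_free_group)
    next
      case False
      then have hl: "hd a = flip (last a)"
        using less.prems by (auto simp: cyc_reduced_def freduced_append carrier_free_group fwords_def)
      obtain m where m: "a = hd a # m" "m \<noteq> []"
        using less.prems hl by (cases a) (auto split: if_splits)
      then obtain m' where m': "m = m' @ [last a]"
        by (metis append_butlast_last_id last_ConsR)
      define x where "x = hd a"
      have a: "a = x # m' @ [flip x]"
        using m m' hl by (simp add: x_def)
      have "m' \<noteq> []"
        using less.prems a by (auto simp: carrier_free_group fwords_def freduced_Cons)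
      have x: "[x] \<in> carrier ?G" and mc: "m' \<in> carrier ?G"
        using less.prems(1) by (auto simp: a carrier_free_group fwords_def freduced_Cons freduced_append)
      obtain g w where IH: "g \<in> carrier ?G" "w \<in> carrier ?G" "cyc_reduced w"
        "m' = g \<otimes>\<^bsub>?G\<^esub> w \<otimes>\<^bsub>?G\<^esub> inv\<^bsub>?G\<^esub> g"
        using less.hyps[of m'] \<open>m' \<noteq> []\<close> mc by (auto simp: a)
      have f: "freduced ((x # m') @ [flip x])"
        using less.prems(1) by (simp add: a carrier_free_group fwords_def)
      then have f': "freduced ([x] @ m')"
        using freduced_append[of "x # m'" "[flip x]"] by simp
      have "a = [x] \<otimes>\<^bsub>?G\<^esub> m' \<otimes>\<^bsub>?G\<^esub> inv\<^bsub>?G\<^esub> [x]"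
        using x fmult_append[OF f] fmult_append[OF f'] by (simp add: inv_free_group a)
      also have "\<dots> = ([x] \<otimes>\<^bsub>?G\<^esub> g) \<otimes>\<^bsub>?G\<^esub> w \<otimes>\<^bsub>?G\<^esub> inv\<^bsub>?G\<^esub> ([x] \<otimes>\<^bsub>?G\<^esub> g)"
        unfolding IH(4) using x IH by (intro conj_conj)
      finally show ?thesis
        using IH(2,3) m_closed[OF x IH(1)] by blast
    qed
  qed
  then show thesis
    using that by blast
qed

lemma rotate_conj_class:
  assumes "cyc_reduced (v @ w)" "v @ w \<in> carrier (free_group n)"
  obtains g where "g \<in> carrier (free_group n)"
    "v @ w = g \<otimes>\<^bsub>free_group n\<^esub> (w @ v) \<otimes>\<^bsub>free_group n\<^esub> inv\<^bsub>free_group n\<^esub> g"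
    "cyc_reduced (w @ v)" "w @ v \<in> carrier (free_group n)"
proof -
  let ?G = "free_group n"
  interpret group ?G
    by (rule group_free_group)
  have cr: "cyc_reduced (w @ v)"
    using assms(1) by (rule cyc_reduced_append_commute)
  then have c: "w @ v \<in> carrier ?G" and vc: "v \<in> carrier ?G"
    using assms(2) cyc_reduced_imp_freduced[OF cr]
    by (auto simp: carrier_free_group fwords_def freduced_append)
  have "v \<otimes>\<^bsub>?G\<^esub> (inv\<^bsub>?G\<^esub> v \<otimes>\<^bsub>?G\<^esub> (v @ w) \<otimes>\<^bsub>?G\<^esub> v) \<otimes>\<^bsub>?G\<^esub> inv\<^bsub>?G\<^esub> v = v @ w"
    using assms(2) vc by (simp add: m_assoc del: mult_free_group one_free_group)
  then have "v @ w = v \<otimes>\<^bsub>?G\<^esub> (w @ v) \<otimes>\<^bsub>?G\<^esub> inv\<^bsub>?G\<^esub> v"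
    unfolding rotate_conj[OF assms(2) c] by (rule sym)
  then show thesis
    using that vc cr c by blast
qed

lemma exists_syllables:
  assumes "w \<noteq> []" "fst (hd w) = N" "fst ` set w \<subseteq> {..<Suc N}"
  obtains ss where "w = syllable_word N ss" "\<forall>(d, b) \<in> set ss. fst ` set b \<subseteq> {..<N}" "ss \<noteq> []"
proof -
  have "\<exists>ss. w = syllable_word N ss \<and> (\<forall>(d, b) \<in> set ss. fst ` set b \<subseteq> {..<N})"
    if "w = [] \<or> fst (hd w) = N" "fst ` set w \<subseteq> {..<Suc N}" for w
    using that
  proof (induction "length w" arbitrary: w rule: less_induct)
    case less
    show ?case
    proof (cases w)
      case Nil
      then show ?thesis
        by (intro exI[of _ "[]"]) simp
    next
      case (Cons s r)
      define b where "b = takeWhile (\<lambda>s. fst s \<noteq> N) r"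
      define w' where "w' = dropWhile (\<lambda>s. fst s \<noteq> N) r"
      have r: "r = b @ w'"
        by (simp add: b_def w'_def)
      have "w' = [] \<or> fst (hd w') = N"
        using hd_dropWhile[of "\<lambda>s. fst s \<noteq> N" r] by (auto simp: w'_def)
      moreover have "fst ` set w' \<subseteq> {..<Suc N}"
        using less.prems(2) by (auto simp: Cons r)
      ultimately obtain ss where ss: "w' = syllable_word N ss" "\<forall>(d, b) \<in> set ss. fst ` set b \<subseteq> {..<N}"
        using less.hyps[of w'] by (auto simp: Cons r)
      have "fst t < N" if "t \<in> set b" for t
      proof -
        have "t \<in> set w" "fst t \<noteq> N"
          using that set_takeWhileD[of t "\<lambda>s. fst s \<noteq> N" r] by (auto simp: b_def Cons)
        then show ?thesis
          using less.prems(2) by fastforce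
      qed
      moreover have "s = (N, snd s)"
        using less.prems(1) Cons by (simp add: prod_eq_iff)
      ultimately show ?thesis
        using ss by (intro exI[of _ "(snd s, b) # ss"]) (auto simp: Cons r)
    qed
  qed
  from this[of w] assms obtain ss where "w = syllable_word N ss" "\<forall>(d, b) \<in> set ss. fst ` set b \<subseteq> {..<N}"
    by blast
  then show thesis
    using assms(1) by (intro that[of ss]) auto
qed

text \<open>Every positive sign except possibly the last is followed by a negative one. A positive
  sum is thus possible only when both end signs are positive.\<close>

lemma signs_sum_le:
  assumes "successively (\<lambda>d e. \<not> (d \<and> e)) ds" "ds \<noteq> []"
  shows "(\<Sum>d \<leftarrow> ds. if d then 1 else - 1 :: int) \<le> of_bool (hd ds) + of_bool (last ds) - 1"
  using assms
proof (induction ds)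
  case (Cons d ds)
  show ?case
  proof (cases ds)
    case (Cons e es)
    then show ?thesis
      using Cons.IH Cons.prems by (cases d; cases e) auto
  qed auto
qed simp

text \<open>A cyclic sequence of signs with positive sum has two neighbouring positive signs, and
  the word between these two occurrences of \<open>x\<close> is a segment. The exponent sum is
  unaffected by passing to a cyclically reduced conjugate.\<close>

lemma exists_segment:
  assumes "a \<in> carrier (free_group (Suc N))" "exponent N a > 0"
  shows "\<exists>b. segment_of N a b"
proof -
  let ?G = "free_group (Suc N)"
  interpret group ?G
    by (rule group_free_group)
  obtain g w where g: "g \<in> carrier ?G" "w \<in> carrier ?G" "cyc_reduced w"
    "a = g \<otimes>\<^bsub>?G\<^esub> w \<otimes>\<^bsub>?G\<^esub> inv\<^bsub>?G\<^esub> g"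
  proof -
    have "a \<noteq> []"
      using assms(2) by auto
    from exists_cyc_reduced_conj[OF assms(1) this] that show thesis
      by blast
  qed
  have ew: "exponent N w > 0"
    using assms(2) g by (simp add: exponent_fmult inv_free_group)
  have "\<exists>s \<in> set w. fst s = N"
    using ew by (induction w) (auto split: if_splits)
  then obtain u s v where w: "w = u @ s # v" "fst s = N"
    by (auto simp: in_set_conv_decomp)
  obtain g1 where g1: "g1 \<in> carrier ?G" "w = g1 \<otimes>\<^bsub>?G\<^esub> ((s # v) @ u) \<otimes>\<^bsub>?G\<^esub> inv\<^bsub>?G\<^esub> g1"
    "cyc_reduced ((s # v) @ u)" "(s # v) @ u \<in> carrier ?G"
    using rotate_conj_class[of u "s # v" "Suc N"] g(2,3) unfolding w(1) by blast
  obtain ss where ss: "(s # v) @ u = syllable_word N ss" "\<forall>(d, b) \<in> set ss. fst ` set b \<subseteq> {..<N}" "ss \<noteq> []"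
    using exists_syllables[of "(s # v) @ u" N] g1(4) w(2) by (auto simp: carrier_free_group fwords_def)
  have "exponent N (syllable_word N ss) = (\<Sum>d \<leftarrow> map fst ss. if d then 1 else - 1)"
    using ss(2) by (induction ss) (auto simp: exponent_eq_0)
  moreover have "exponent N (syllable_word N ss) > 0"
    using ew unfolding ss(1)[symmetric] by (simp add: w(1))
  ultimately have pos: "(\<Sum>d \<leftarrow> map fst ss. if d then 1 else - 1 :: int) > 0"
    by simp
  \<comment> \<open>The neighbouring pair lies inside the list or wraps around from its end to its
    beginning; a single positive syllable is its own neighbour.\<close>
  obtain i b ts where ts: "drop i ss @ take i ss = (True, b) # ts" "next_sign ts True"
  proof (cases "successively (\<lambda>d e. \<not> (d \<and> e)) (map fst ss)")
    case True
    then have "of_bool (fst (hd ss)) + of_bool (fst (last ss)) > (1 :: int)"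
      using signs_sum_le[OF True] ss(3) pos by (simp add: hd_map last_map)
    then have hl: "fst (hd ss)" "fst (last ss)"
      by (auto simp: of_bool_def split: if_splits)
    obtain ss' s' where ss': "ss = ss' @ [s']"
      using ss(3) by (cases ss rule: rev_cases) auto
    have "drop (length ss') ss @ take (length ss') ss = (True, snd s') # ss'"
      using hl(2) by (simp add: ss' prod_eq_iff)
    moreover have "next_sign ss' True"
      using hl(1) by (auto simp: next_sign_def ss')
    ultimately show thesis
      by (rule that)
  next
    case False
    then obtain i where i: "Suc i < length ss" "fst (ss ! i)" "fst (ss ! Suc i)"
      by (auto simp: successively_conv_nth)
    then have "drop i ss = ss ! i # ss ! Suc i # drop (Suc (Suc i)) ss"
      by (simp add: Cons_nth_drop_Suc)
    then have "drop i ss @ take i ss = (True, snd (ss ! i)) # (ss ! Suc i # drop (Suc (Suc i)) ss @ take i ss)"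
      using i(2) by (simp add: prod_eq_iff)
    moreover have "next_sign (ss ! Suc i # drop (Suc (Suc i)) ss @ take i ss) True"
      using i(3) by (simp add: next_sign_def)
    ultimately show thesis
      by (rule that)
  qed
  have split: "(s # v) @ u = syllable_word N (take i ss) @ syllable_word N (drop i ss)"
    unfolding ss(1) syllable_word_simps(3)[symmetric] by simp
  have eq: "syllable_word N (drop i ss) @ syllable_word N (take i ss) = syllable_word N ((True, b) # ts)"
    unfolding ts(1)[symmetric] by simp
  obtain g2 where g2: "g2 \<in> carrier ?G"
    "(s # v) @ u = g2 \<otimes>\<^bsub>?G\<^esub> syllable_word N ((True, b) # ts) \<otimes>\<^bsub>?G\<^esub> inv\<^bsub>?G\<^esub> g2"
    "cyc_reduced (syllable_word N ((True, b) # ts))" "syllable_word N ((True, b) # ts) \<in> carrier ?G"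
    using rotate_conj_class[of "syllable_word N (take i ss)" "syllable_word N (drop i ss)" "Suc N"] g1(3,4)
    unfolding split eq by blast
  have "set ((True, b) # ts) \<subseteq> set ss"
    unfolding ts(1)[symmetric] using set_take_subset set_drop_subset by (simp add: set_take_subset set_drop_subset)
  then have letters: "\<forall>(d, b) \<in> set ((True, b) # ts). fst ` set b \<subseteq> {..<N}"
    using ss(2) by blast
  have "freduced (syllable_word N ((True, b) # ts) @ [(N, True)])"
    using g2(3) by (simp add: cyc_reduced_def)
  then have red: "reduced_syllables N ((True, b) # ts) True"
    using reduced_syllables_iff[OF letters] by blast
  have "a = (g \<otimes>\<^bsub>?G\<^esub> g1) \<otimes>\<^bsub>?G\<^esub> ((s # v) @ u) \<otimes>\<^bsub>?G\<^esub> inv\<^bsub>?G\<^esub> (g \<otimes>\<^bsub>?G\<^esub> g1)"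
    unfolding g(4) g1(2) by (rule conj_conj[OF g(1) g1(1,4)])
  also have "\<dots> = (g \<otimes>\<^bsub>?G\<^esub> g1 \<otimes>\<^bsub>?G\<^esub> g2) \<otimes>\<^bsub>?G\<^esub> syllable_word N ((True, b) # ts) \<otimes>\<^bsub>?G\<^esub>
      inv\<^bsub>?G\<^esub> (g \<otimes>\<^bsub>?G\<^esub> g1 \<otimes>\<^bsub>?G\<^esub> g2)"
    unfolding g2(2) by (rule conj_conj[OF m_closed[OF g(1) g1(1)] g2(1,4)])
  finally show ?thesis
    unfolding segment_of_def using m_closed[OF m_closed[OF g(1) g1(1)] g2(1)] ts(2) red by blast
qed

section \<open>Segments of vertices and their variation along walks\<close>

definition vertex_segment :: "nat \<Rightarrow> fword set set set \<Rightarrow> fword \<Rightarrow> bool" where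
  "vertex_segment N V b \<longleftrightarrow> (\<exists>P \<in> V. \<exists>D \<in> P. \<exists>a \<in> D. segment_of N a b)"

definition separating_halfspace :: "nat \<Rightarrow> fword set set set \<Rightarrow> fword set \<Rightarrow> bool" where
  "separating_halfspace N V E \<longleftrightarrow> halfspace (free_group (Suc N)) E \<and>
     (\<forall>b. vertex_segment N V b \<longrightarrow> has_segment N E b)"

lemma conj_class_self:
  assumes "\<And>D. D \<in> P \<Longrightarrow> D \<subseteq> carrier (free_group n)"
  shows "P \<in> conj_class n P"
proof -
  interpret group "free_group n"
    by (rule group_free_group)
  have "conj_sub n \<one>\<^bsub>free_group n\<^esub> D = D" if "D \<in> P" for D
    using assms[OF that] by (force simp: conj_sub_def simp del: mult_free_group one_free_group)
  then have "conj_sub n \<one>\<^bsub>free_group n\<^esub> ` P = P"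
    by force
  then show ?thesis
    unfolding conj_class_def using one_closed by (metis (mono_tags, lifting) mem_Collect_eq)
qed

text \<open>One half-space serves all conjugates of the pair, by \<open>unseparated_conj\<close>.
  Segments come from conjugates of cyclically reduced words, which have infinite order, so testing
  such elements suffices.\<close>

lemma separating_halfspace_conj_class:
  assumes E: "halfspace (free_group (Suc N)) E"
    and P: "\<And>D a. D \<in> P \<Longrightarrow> a \<in> D \<Longrightarrow> a \<in> carrier (free_group (Suc N))"
      "\<And>D a. D \<in> P \<Longrightarrow> a \<in> D \<Longrightarrow> infinite_order (free_group (Suc N)) a \<Longrightarrow>
        unseparated (free_group (Suc N)) E a"
  shows "separating_halfspace N (conj_class (Suc N) P) E"
  unfolding separating_halfspace_def
proof (intro conjI allI impI E)
  let ?G = "free_group (Suc N)"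
  interpret group ?G
    by (rule group_free_group)
  fix b assume "vertex_segment N (conj_class (Suc N) P) b"
  then obtain k D a where k: "k \<in> carrier ?G" and D: "D \<in> P" "a \<in> D"
    and seg: "segment_of N (k \<otimes>\<^bsub>?G\<^esub> a \<otimes>\<^bsub>?G\<^esub> inv\<^bsub>?G\<^esub> k) b"
    unfolding vertex_segment_def conj_class_def conj_sub_def by blast
  have a: "a \<in> carrier ?G"
    using P D by blast
  obtain g ss where g: "g \<in> carrier ?G" and ss: "next_sign ss True" "reduced_syllables N ((True, b) # ss) True"
    and eq: "k \<otimes>\<^bsub>?G\<^esub> a \<otimes>\<^bsub>?G\<^esub> inv\<^bsub>?G\<^esub> k =
       g \<otimes>\<^bsub>?G\<^esub> syllable_word N ((True, b) # ss) \<otimes>\<^bsub>?G\<^esub> inv\<^bsub>?G\<^esub> g"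
    using seg unfolding segment_of_def by blast
  define w where "w = syllable_word N ((True, b) # ss)"
  have w: "w \<in> carrier ?G" "infinite_order ?G w"
    using syllable_word_carrier[OF ss(2)] infinite_order_cyc_reduced cyc_reduced_syllable_word[OF ss(2)]
    by (auto simp: w_def)
  define h where "h = inv\<^bsub>?G\<^esub> g \<otimes>\<^bsub>?G\<^esub> k"
  have h: "h \<in> carrier ?G"
    using g k by (simp add: h_def del: mult_free_group)
  have inverse: "inv\<^bsub>?G\<^esub> c \<otimes>\<^bsub>?G\<^esub> (c \<otimes>\<^bsub>?G\<^esub> v \<otimes>\<^bsub>?G\<^esub> inv\<^bsub>?G\<^esub> c) \<otimes>\<^bsub>?G\<^esub> inv\<^bsub>?G\<^esub> (inv\<^bsub>?G\<^esub> c) = v"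
    if "c \<in> carrier ?G" "v \<in> carrier ?G" for c v
    using that by (simp add: m_assoc del: mult_free_group one_free_group)
  have wa: "w = h \<otimes>\<^bsub>?G\<^esub> a \<otimes>\<^bsub>?G\<^esub> inv\<^bsub>?G\<^esub> h"
    unfolding h_def using inverse[OF g w(1)] k g a
    by (simp only: w_def flip: eq) (simp only: conj_conj inv_closed)
  have "infinite_order ?G a"
    using infinite_order_conj[OF w(1) inv_closed[OF h] w(2)] unfolding wa inverse[OF h a] .
  then have "unseparated ?G E w"
    unfolding wa using unseparated_conj[OF E a _ _ h] P(2) D by blast
  then show "has_segment N E b"
    using ss unfolding has_segment_def w_def by blast
qed

text \<open>The exponent sum of \<open>x\<close> is a nonzero homomorphism, so it cannot vanish on
  all three factors. An element of one factor with positive exponent sum, obtained by inversion if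
  need be, lies in a part of both coarser splittings and supplies the common segment. The
  half-spaces belong to the factor left alone: \<open>H3\<close> on one side, \<open>H1\<close> on
  the other.\<close>

lemma ES_edge_segments:
  assumes "ES_edge (Suc N) V1 V2"
  obtains E1 E2 b where "separating_halfspace N V1 E1" "separating_halfspace N V2 E2"
    "vertex_segment N V1 b" "vertex_segment N V2 b"
proof -
  let ?G = "free_group (Suc N)"
  interpret group ?G
    by (rule group_free_group)
  have main: "\<exists>E1 E2 b. separating_halfspace N V1 E1 \<and> separating_halfspace N V2 E2 \<and>
      vertex_segment N V1 b \<and> vertex_segment N V2 b"
    if H: "nontrivial_sub ?G H1" "nontrivial_sub ?G H2" "nontrivial_sub ?G H3"
      and fp: "is_free_product ?G [H1, H2, H3]"
      and V1: "V1 = conj_class (Suc N) {generate ?G (H1 \<union> H2), H3}"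
      and V2: "V2 = conj_class (Suc N) {H1, generate ?G (H2 \<union> H3)}" for H1 H2 H3 V1 V2
  proof -
    interpret free_product ?G "[H1, H2, H3]"
      using fp by unfold_locales
    have sub: "subgroup H1 ?G" "subgroup H2 ?G" "subgroup H3 ?G"
      using subgroup_factor[of 0] subgroup_factor[of 1] subgroup_factor[of 2] by auto
    have ex: "\<exists>h \<in> K. h \<noteq> \<one>\<^bsub>?G\<^esub>" if "subgroup K ?G" "nontrivial_sub ?G K" for K
      using that subgroup.one_closed[OF that(1)] unfolding nontrivial_sub_def by blast
    obtain h1 h3 where h: "h1 \<in> H1" "h1 \<noteq> \<one>\<^bsub>?G\<^esub>" "h3 \<in> H3" "h3 \<noteq> \<one>\<^bsub>?G\<^esub>"
      using ex sub H by meson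
    have subs: "H1 \<subseteq> carrier ?G" "H2 \<subseteq> carrier ?G" "H3 \<subseteq> carrier ?G"
      using sub subgroup.subset by blast+
    have gen: "generate ?G (H1 \<union> H2) \<subseteq> carrier ?G" "generate ?G (H2 \<union> H3) \<subseteq> carrier ?G"
      using subs by (auto intro!: generate_incl)
    have 12: "(\<Union>j \<in> {..<length [H1, H2, H3]} - {2}. [H1, H2, H3] ! j) = H1 \<union> H2"
      "(\<Union>j \<in> {..<length [H1, H2, H3]} - {0}. [H1, H2, H3] ! j) = H2 \<union> H3"
      by (auto simp: less_Suc_eq numeral_3_eq_3 numeral_2_eq_2)
    have "separating_halfspace N V1 (starting_with ?G [H1, H2, H3] 2)"
      unfolding V1
    proof (rule separating_halfspace_conj_class)
      show "halfspace ?G (starting_with ?G [H1, H2, H3] 2)"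
        using h by (intro halfspace_starting_with[of 2 h3 0 h1]) auto
      show "unseparated ?G (starting_with ?G [H1, H2, H3] 2) a"
        if "D \<in> {generate ?G (H1 \<union> H2), H3}" "a \<in> D" "infinite_order ?G a" for D a
        using that unseparated_factor[of 2 a] unseparated_other_factors[of a 2] unfolding 12 by auto
    qed (use gen subs in auto)
    moreover have "separating_halfspace N V2 (starting_with ?G [H1, H2, H3] 0)"
      unfolding V2
    proof (rule separating_halfspace_conj_class)
      show "halfspace ?G (starting_with ?G [H1, H2, H3] 0)"
        using h by (intro halfspace_starting_with[of 0 h1 2 h3]) auto
      show "unseparated ?G (starting_with ?G [H1, H2, H3] 0) a"
        if "D \<in> {H1, generate ?G (H2 \<union> H3)}" "a \<in> D" "infinite_order ?G a" for D a
        using that unseparated_factor[of 0 a] unseparated_other_factors[of a 0] unfolding 12 by auto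
    qed (use gen subs in auto)
    moreover have "\<exists>b. vertex_segment N V1 b \<and> vertex_segment N V2 b"
    proof -
      have "\<exists>a \<in> H1 \<union> H2 \<union> H3. exponent N a \<noteq> 0"
      proof (rule ccontr)
        assume *: "\<not> (\<exists>a \<in> H1 \<union> H2 \<union> H3. exponent N a \<noteq> 0)"
        have "exponent N a = 0" if "a \<in> generate ?G (\<Union> (set [H1, H2, H3]))" for a
          using that
        proof (induction a rule: generate.induct)
          case (inv h)
          then have "h \<in> carrier ?G"
            using subs by auto
          then show ?case
            using * inv by (auto simp: inv_free_group)
        qed (use * in \<open>auto simp: exponent_fmult\<close>)
        moreover have "[(N, True)] \<in> generate ?G (\<Union> (set [H1, H2, H3]))"
          unfolding generate_factors by (simp add: carrier_free_group)
        ultimately have "exponent N [(N, True)] = 0"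
          by blast
        then show False
          by simp
      qed
      then obtain a0 where a0: "a0 \<in> H1 \<union> H2 \<union> H3" "exponent N a0 \<noteq> 0"
        by blast
      have "\<exists>a \<in> H1 \<union> H2 \<union> H3. exponent N a > 0"
      proof (cases "exponent N a0 > 0")
        case False
        have "inv\<^bsub>?G\<^esub> a0 \<in> H1 \<union> H2 \<union> H3"
          using a0(1) subgroup.m_inv_closed[OF sub(1), of a0] subgroup.m_inv_closed[OF sub(2), of a0]
            subgroup.m_inv_closed[OF sub(3), of a0] by blast
        moreover have "exponent N (inv\<^bsub>?G\<^esub> a0) > 0"
          using a0 False subs by (subst inv_free_group) auto
        ultimately show ?thesis
          by blast
      qed (use a0 in blast)
      then obtain a where a: "a \<in> H1 \<union> H2 \<union> H3" "exponent N a > 0"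
        by blast
      moreover have "a \<in> carrier ?G"
        using a(1) subs by blast
      ultimately obtain b where b: "segment_of N a b"
        using exists_segment by blast
      have "{generate ?G (H1 \<union> H2), H3} \<in> V1" "{H1, generate ?G (H2 \<union> H3)} \<in> V2"
        unfolding V1 V2 using gen subs by (auto intro!: conj_class_self)
      moreover have "\<exists>D \<in> {generate ?G (H1 \<union> H2), H3}. a \<in> D" "\<exists>D \<in> {H1, generate ?G (H2 \<union> H3)}. a \<in> D"
        using a(1) generate.incl[of a _ ?G] by auto
      ultimately show ?thesis
        unfolding vertex_segment_def using b by blast
    qed
    ultimately show ?thesis
      by blast
  qed
  have "\<exists>E1 E2 b. separating_halfspace N V1 E1 \<and> separating_halfspace N V2 E2 \<and>
      vertex_segment N V1 b \<and> vertex_segment N V2 b"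
    using assms main[of _ _ _ V1 V2] main[of _ _ _ V2 V1] unfolding ES_edge_def by metis
  then show thesis
    using that by blast
qed

lemma brooks_separating_halfspace:
  assumes "N \<ge> 2" "separating_halfspace N V E" "vertex_segment N V b" "vertex_segment N V b'" "full N u"
  shows "\<bar>brooks u b - brooks u b'\<bar> \<le> 12 * int (length u)"
  using assms brooks_segments[of N E b b' u] by (simp add: separating_halfspace_def)

text \<open>A cost arises inside each of the \<open>k + 1\<close> vertices; crossing an edge is free
  because its ends share a segment. The half-space of the first vertex is given separately because a
  walk of length 0 has no edge to provide it.\<close>

lemma brooks_walk:
  assumes "N \<ge> 2" "full N u" "ES_walk (Suc N) V V' k" "separating_halfspace N V E"
    and b: "vertex_segment N V b" "vertex_segment N V' b'"
  shows "\<bar>brooks u b - brooks u b'\<bar> \<le> 12 * int (length u) * (int k + 1)"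
proof -
  obtain ps where ps: "ps ! 0 = V" "ps ! k = V'" "\<And>i. i < k \<Longrightarrow> ES_edge (Suc N) (ps ! i) (ps ! Suc i)"
    using assms(3) by (auto simp: ES_walk_def)
  have "\<bar>brooks u b - brooks u c\<bar> \<le> 12 * int (length u) * (int i + 1)"
    if "i \<le> k" "vertex_segment N (ps ! i) c" for i c
    using that
  proof (induction i arbitrary: c)
    case 0
    then show ?case
      using brooks_separating_halfspace[OF assms(1,4) b(1) _ assms(2)] ps(1) by simp
  next
    case (Suc i)
    then have "ES_edge (Suc N) (ps ! i) (ps ! Suc i)"
      using ps(3) by simp
    then obtain E2 d where d: "separating_halfspace N (ps ! Suc i) E2" "vertex_segment N (ps ! i) d"
      "vertex_segment N (ps ! Suc i) d"
      by (rule ES_edge_segments)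
    have "\<bar>brooks u b - brooks u d\<bar> \<le> 12 * int (length u) * (int i + 1)"
      using Suc d by simp
    moreover have "\<bar>brooks u d - brooks u c\<bar> \<le> 12 * int (length u)"
      using brooks_separating_halfspace[OF assms(1) d(1,3) Suc.prems(2) assms(2)] .
    ultimately show ?case
      by (simp add: algebra_simps)
  qed
  then show ?thesis
    using b(2) ps(2) by blast
qed

section \<open>Paths in the edge splitting graph\<close>

text \<open>Words over disjoint sets of generators cannot cancel against each other, so an
  alternating product is plain concatenation.\<close>

lemma freduced_concat_gprod:
  assumes "alternating (free_group n) (map fwords Is) es"
    and disj: "\<And>i j. i < length Is \<Longrightarrow> j < length Is \<Longrightarrow> i \<noteq> j \<Longrightarrow> Is ! i \<inter> Is ! j = {}"
  shows "freduced (concat (map snd es)) \<and> gprod (free_group n) es = concat (map snd es) \<and>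
    (es \<noteq> [] \<longrightarrow> concat (map snd es) \<noteq> [] \<and> fst (hd (concat (map snd es))) \<in> Is ! fst (hd es))"
  using assms(1)
proof (induction es)
  case (Cons e es)
  have e: "fst e < length Is" "freduced (snd e)" "fst ` set (snd e) \<subseteq> Is ! fst e" "snd e \<noteq> []"
    and es: "alternating (free_group n) (map fwords Is) es" and ne: "es = [] \<or> fst (hd es) \<noteq> fst e"
    using Cons.prems by (cases es; auto simp: alternating_def fwords_def)+
  note IH = Cons.IH[OF es]
  have "fst (hd es) < length Is" if "es \<noteq> []"
    using es that by (cases es) (auto simp: alternating_def)
  then have "Is ! fst e \<inter> Is ! fst (hd es) = {}" if "es \<noteq> []"
    using disj[of "fst e" "fst (hd es)"] e(1) ne that by auto
  moreover have "fst (last (snd e)) \<in> Is ! fst e" "fst (hd (snd e)) \<in> Is ! fst e"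
    using e(3,4) by auto
  ultimately have "hd (concat (map snd es)) \<noteq> flip (last (snd e))" if "es \<noteq> []"
    using IH that by (metis disjoint_iff fst_flip)
  then have f: "freduced (snd e @ concat (map snd es))"
    using e IH by (cases "es = []") (auto simp: freduced_append)
  show ?case
    using f fmult_append[OF f] IH \<open>fst (hd (snd e)) \<in> Is ! fst e\<close> e(4)
    by (simp add: gprod_def hd_append)
qed (simp add: gprod_def)

lemma generate_fwords:
  assumes I: "\<Union>\<I> \<subseteq> {..<n}"
  shows "generate (free_group n) (\<Union>I \<in> \<I>. fwords I) = fwords (\<Union>\<I>)"
proof -
  let ?G = "free_group n"
  interpret group ?G
    by (rule group_free_group)
  show ?thesis
  proof
    have "(\<Union>I \<in> \<I>. fwords I) \<subseteq> fwords (\<Union>\<I>)"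
      by (auto simp: fwords_def)
    then show "generate ?G (\<Union>I \<in> \<I>. fwords I) \<subseteq> fwords (\<Union>\<I>)"
      by (rule generate_subgroup_incl) (rule subgroup_fwords[OF I])
    show "fwords (\<Union>\<I>) \<subseteq> generate ?G (\<Union>I \<in> \<I>. fwords I)"
    proof
      fix w assume "w \<in> fwords (\<Union>\<I>)"
      then show "w \<in> generate ?G (\<Union>I \<in> \<I>. fwords I)"
      proof (induction w)
        case Nil
        then show ?case
          using generate.one[of ?G] by simp
      next
        case (Cons s w)
        then have w: "w \<in> fwords (\<Union>\<I>)" and f: "freduced ([s] @ w)"
          by (auto simp: fwords_def freduced_Cons)
        obtain I where "I \<in> \<I>" "fst s \<in> I"
          using Cons.prems by (auto simp: fwords_def)
        then have "[s] \<in> generate ?G (\<Union>I \<in> \<I>. fwords I)"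
          by (intro generate.incl) auto
        then have "[s] \<otimes>\<^bsub>?G\<^esub> w \<in> generate ?G (\<Union>I \<in> \<I>. fwords I)"
          using Cons.IH[OF w] by (rule generate.eng)
        then show ?case
          using fmult_append[OF f] by simp
      qed
    qed
  qed
qed

lemma free_product_fwords:
  assumes "\<Union>(set Is) = {..<n}"
    and "\<And>i j. i < length Is \<Longrightarrow> j < length Is \<Longrightarrow> i \<noteq> j \<Longrightarrow> Is ! i \<inter> Is ! j = {}"
  shows "is_free_product (free_group n) (map fwords Is)"
  unfolding is_free_product_alternating
proof (intro conjI allI impI)
  show "\<forall>H \<in> set (map fwords Is). subgroup H (free_group n)"
    using assms(1) by (auto intro!: subgroup_fwords)
  show "generate (free_group n) (\<Union>(set (map fwords Is))) = carrier (free_group n)"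
    using generate_fwords[of "set Is" n] assms(1) by (simp add: carrier_free_group)
  show "gprod (free_group n) es \<noteq> \<one>\<^bsub>free_group n\<^esub>"
    if "alternating (free_group n) (map fwords Is) es" "es \<noteq> []" for es
    using freduced_concat_gprod[OF that(1) assms(2)] that(2) by simp
qed

text \<open>An alternating word in the images is pulled back syllable by syllable, and injectivity
  carries nontriviality of the product forward.\<close>

lemma (in group) free_product_image:
  assumes \<alpha>: "\<alpha> \<in> iso G G" and Hs: "is_free_product G Hs"
  shows "is_free_product G (map ((`) \<alpha>) Hs)"
  unfolding is_free_product_alternating
proof (intro conjI allI impI ballI)
  interpret free_product G Hs
    using Hs by unfold_locales
  have hom: "\<alpha> \<in> hom G G" and inj: "inj_on \<alpha> (carrier G)" and surj: "\<alpha> ` carrier G = carrier G"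
    using \<alpha> by (auto simp: iso_def bij_betw_def)
  then interpret h: group_hom G G \<alpha>
    by unfold_locales
  have sub: "\<Union>(set Hs) \<subseteq> carrier G"
    using factor_closed by (auto simp: in_set_conv_nth)
  show "subgroup H G" if "H \<in> set (map ((`) \<alpha>) Hs)" for H
    using that h.subgroup_img_is_subgroup subgroup_factor by (auto simp: in_set_conv_nth)
  have "\<Union>(set (map ((`) \<alpha>) Hs)) = \<alpha> ` \<Union>(set Hs)"
    by auto
  then show "generate G (\<Union>(set (map ((`) \<alpha>) Hs))) = carrier G"
    using h.generate_img[OF sub] generate_factors surj by simp
  fix es assume es: "alternating G (map ((`) \<alpha>) Hs) es" "es \<noteq> []"
  have "\<exists>fs. alternating G Hs fs \<and> map fst fs = map fst es \<and> \<alpha> (gprod G fs) = gprod G es"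
    using es(1)
  proof (induction es)
    case (Cons e es)
    have "alternating G (map ((`) \<alpha>) Hs) es"
      using Cons.prems by (cases es) (auto simp: alternating_def)
    then obtain fs where fs: "alternating G Hs fs" "map fst fs = map fst es" "\<alpha> (gprod G fs) = gprod G es"
      using Cons.IH by blast
    have "fst e < length Hs" "snd e \<in> \<alpha> ` (Hs ! fst e)" "snd e \<noteq> \<one>"
      using Cons.prems by (auto simp: alternating_def)
    then obtain a where a: "a \<in> Hs ! fst e" "snd e = \<alpha> a" "a \<in> carrier G" "\<alpha> a \<noteq> \<one>"
      using factor_closed[of "fst e"] by (metis imageE)
    then have "a \<noteq> \<one>"
      using h.hom_one by auto
    have "distinct_adj (map fst (e # fs))"
      using Cons.prems fs(2) by (auto simp: alternating_def)
    then have "alternating G Hs ((fst e, a) # fs)"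
      using fs(1) a \<open>a \<noteq> \<one>\<close> \<open>fst e < length Hs\<close> by (auto simp: alternating_def)
    then show ?case
      using fs a by (intro exI[of _ "(fst e, a) # fs"]) (auto simp: gprod_def[of G "e # es"] gprod_def[symmetric])
  qed (auto intro: exI[of _ "[]"] simp: gprod_def)
  then obtain fs where fs: "alternating G Hs fs" "map fst fs = map fst es" "\<alpha> (gprod G fs) = gprod G es"
    by blast
  have "fs \<noteq> []"
    using fs(2) es(2) by auto
  then have "gprod G fs \<noteq> \<one>" "gprod G fs \<in> carrier G"
    using gprod_alternating fs(1) by auto
  then have "\<alpha> (gprod G fs) \<noteq> \<alpha> \<one>"
    using inj_onD[OF inj] one_closed by blast
  then show "gprod G es \<noteq> \<one>"
    using fs(3) h.hom_one by simp
qed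

lemma conj_class_conj:
  assumes g: "g \<in> carrier (free_group n)" and P: "\<And>D. D \<in> P \<Longrightarrow> D \<subseteq> carrier (free_group n)"
  shows "conj_class n (conj_sub n g ` P) = conj_class n P"
proof -
  let ?G = "free_group n"
  interpret group ?G
    by (rule group_free_group)
  have cc: "conj_sub n h (conj_sub n k D) = conj_sub n (h \<otimes>\<^bsub>?G\<^esub> k) D"
    if "h \<in> carrier ?G" "k \<in> carrier ?G" "D \<subseteq> carrier ?G" for h k D
    unfolding conj_sub_def image_image using that by (intro image_cong refl conj_conj) auto
  then have ccP: "conj_sub n h ` conj_sub n k ` P = conj_sub n (h \<otimes>\<^bsub>?G\<^esub> k) ` P"
    if "h \<in> carrier ?G" "k \<in> carrier ?G" for h k
    unfolding image_image using that P by (intro image_cong refl) auto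
  have "conj_sub n h ` P = conj_sub n (h \<otimes>\<^bsub>?G\<^esub> inv\<^bsub>?G\<^esub> g) ` conj_sub n g ` P" if "h \<in> carrier ?G" for h
    using that g by (subst ccP) (simp_all add: m_assoc del: mult_free_group one_free_group)
  then have "Q \<in> conj_class n (conj_sub n g ` P)" if "Q \<in> conj_class n P" for Q
    using that g m_closed[OF _ inv_closed[OF g]] unfolding conj_class_def by blast
  moreover have "Q \<in> conj_class n P" if Q: "Q \<in> conj_class n (conj_sub n g ` P)" for Q
  proof -
    obtain h where "h \<in> carrier ?G" "Q = conj_sub n h ` conj_sub n g ` P"
      using Q unfolding conj_class_def by blast
    then show ?thesis
      using ccP[of h g] g m_closed[of h g] unfolding conj_class_def by blast
  qed
  ultimately show ?thesis
    by blast
qed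

lemma conj_sub_fwords:
  assumes I: "I \<subseteq> {..<n}" and g: "g \<in> fwords I"
  shows "conj_sub n g (fwords I) = fwords I"
proof
  have gc: "g \<in> carrier (free_group n)"
    using fwords_mono[OF I] g by (auto simp: carrier_free_group)
  then show "conj_sub n g (fwords I) \<subseteq> fwords I"
    using g by (auto simp: conj_sub_def inv_free_group intro!: fwords_fmult)
  show "fwords I \<subseteq> conj_sub n g (fwords I)"
  proof
    fix w assume w: "w \<in> fwords I"
    then have "w = fmult (fmult g (fmult (finv g) (fmult w g))) (finv g)"
      using g by (simp add: fwords_def fmult_cancel freduced_fmult)
        (simp add: fmult_assoc fmult_finv_right fmult_Nil_right)
    moreover have "fmult (finv g) (fmult w g) \<in> fwords I"
      using w g by (auto intro!: fwords_fmult)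
    ultimately show "w \<in> conj_sub n g (fwords I)"
      using gc by (auto simp: conj_sub_def inv_free_group)
  qed
qed

text \<open>With \<open>x\<close> the generator number \<open>N\<close> and \<open>B\<close> the free factor of the other generators, these are the
  splittings \<open>{<l x r>, B}\<close> and \<open>{<l x r, y>, B'}\<close>, where \<open>y\<close> is the generator number \<open>i\<close> and
  \<open>B = <y> * B'\<close>.\<close>

definition handle_vertex :: "nat \<Rightarrow> fword \<Rightarrow> fword \<Rightarrow> fword set set set" where
  "handle_vertex N l r = conj_class (Suc N) {shear N l r ` fwords {N}, fwords {..<N}}"

definition handle_neighbour :: "nat \<Rightarrow> nat \<Rightarrow> fword \<Rightarrow> fword \<Rightarrow> fword set set set" where
  "handle_neighbour N i l r = conj_class (Suc N) {shear N l r ` fwords {N, i}, fwords ({..<N} - {i})}"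

lemma shear_image_fwords: "N \<notin> I \<Longrightarrow> shear N l r ` fwords I = fwords I"
  by (simp add: shear_fwords cong: image_cong)

lemma nontrivial_fwords: "i \<in> I \<Longrightarrow> nontrivial_sub G' (fwords I)" if "\<one>\<^bsub>G'\<^esub> = []"
proof -
  assume "i \<in> I"
  then have "[(i, True)] \<in> fwords I"
    by simp
  then show ?thesis
    using that unfolding nontrivial_sub_def by fastforce
qed

lemma nontrivial_shear:
  assumes "l \<in> fwords {..<N}" "r \<in> fwords {..<N}" "i \<in> I" "I \<subseteq> {..<Suc N}"
  shows "nontrivial_sub (free_group (Suc N)) (shear N l r ` fwords I)"
  unfolding nontrivial_sub_def
proof
  assume triv: "shear N l r ` fwords I = {\<one>\<^bsub>free_group (Suc N)\<^esub>}"
  have mem: "[(i, True)] \<in> fwords I" "[] \<in> fwords I"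
    using assms(3) by simp_all
  have "shear N l r w = \<one>\<^bsub>free_group (Suc N)\<^esub>" if "w \<in> fwords I" for w
    using imageI[OF that, of "shear N l r"] unfolding triv by (rule singletonD)
  from this[OF mem(1)] this[OF mem(2)] have eq: "shear N l r [(i, True)] = shear N l r []"
    by (rule trans[OF _ sym])
  have inj: "inj_on (shear N l r) (carrier (free_group (Suc N)))"
    using shear_iso[OF assms(1,2)] unfolding iso_def bij_betw_def by (rule CollectE) (elim conjE)
  have "[(i, True)] \<in> carrier (free_group (Suc N))" "[] \<in> carrier (free_group (Suc N))"
    unfolding carrier_free_group
    by (rule subsetD[OF fwords_mono[OF assms(4)] mem(1)], rule fwords_Nil)
  from inj_onD[OF inj eq this] show False
    by simp
qed

text \<open>The factors are \<open><l x r>\<close>, \<open><y>\<close> and \<open>B'\<close>;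
  grouping \<open><y>\<close> with the first gives the neighbour, grouping it with \<open>B'\<close>
  gives the vertex. \<open>N \<ge> 2\<close> makes \<open>B'\<close> nontrivial.\<close>

lemma handle_edge:
  assumes "N \<ge> 2" "i < N" and lr: "l \<in> fwords {..<N}" "r \<in> fwords {..<N}"
  shows "ES_edge (Suc N) (handle_neighbour N i l r) (handle_vertex N l r)"
proof -
  let ?G = "free_group (Suc N)" and ?\<alpha> = "shear N l r"
  interpret group ?G
    by (rule group_free_group)
  have iso: "?\<alpha> \<in> iso ?G ?G"
    by (rule shear_iso[OF lr])
  then interpret h: group_hom ?G ?G ?\<alpha>
    by unfold_locales (simp add: iso_def)
  obtain j where j: "j \<in> {..<N} - {i}"
    using assms(1) by (cases "i = 0") force+
  have fix_i: "?\<alpha> ` fwords {i} = fwords {i}" and fix_Y: "?\<alpha> ` fwords ({..<N} - {i}) = fwords ({..<N} - {i})"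
    using assms(2) by (simp_all add: shear_image_fwords)
  have "is_free_product ?G (map fwords [{N}, {i}, {..<N} - {i}])"
    using assms(2) by (intro free_product_fwords) (auto simp: less_Suc_eq nth_Cons split: nat.splits)
  from free_product_image[OF iso this]
  have fp: "is_free_product ?G [?\<alpha> ` fwords {N}, fwords {i}, fwords ({..<N} - {i})]"
    by (simp add: fix_i fix_Y)
  have "generate ?G (\<Union>I \<in> {{i}, {..<N} - {i}}. fwords I) = fwords (\<Union>{{i}, {..<N} - {i}})"
    using assms(2) by (intro generate_fwords) auto
  moreover have "\<Union>{{i}, {..<N} - {i}} = {..<N}"
    using assms(2) by auto
  ultimately have g23: "generate ?G (fwords {i} \<union> fwords ({..<N} - {i})) = fwords {..<N}"
    by simp
  have "generate ?G (\<Union>I \<in> {{N}, {i}}. fwords I) = fwords (\<Union>{{N}, {i}})"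
    using assms(2) by (intro generate_fwords) auto
  then have "generate ?G (fwords {N} \<union> fwords {i}) = fwords {N, i}"
    by (simp add: insert_commute)
  moreover have "fwords {N} \<union> fwords {i} \<subseteq> carrier ?G"
    using assms(2) fwords_mono[of "{N}" "{..<Suc N}"] fwords_mono[of "{i}" "{..<Suc N}"]
    by (auto simp: carrier_free_group)
  ultimately have g12: "generate ?G (?\<alpha> ` fwords {N} \<union> fwords {i}) = ?\<alpha> ` fwords {N, i}"
    using h.generate_img[of "fwords {N} \<union> fwords {i}"] by (simp add: image_Un fix_i)
  have "nontrivial_sub ?G (?\<alpha> ` fwords {N})" "nontrivial_sub ?G (fwords {i})"
    "nontrivial_sub ?G (fwords ({..<N} - {i}))"
    using nontrivial_shear[OF lr, of N "{N}"] nontrivial_fwords[of ?G i] nontrivial_fwords[of ?G j] j by auto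
  then show ?thesis
    unfolding ES_edge_def handle_neighbour_def handle_vertex_def
    by (intro exI[of _ "?\<alpha> ` fwords {N}"] exI[of _ "fwords {i}"] exI[of _ "fwords ({..<N} - {i})"])
      (simp only: fp g12 g23 simp_thms)
qed

lemma handle_vertex_ES_vertices:
  assumes "N \<ge> 1" and lr: "l \<in> fwords {..<N}" "r \<in> fwords {..<N}"
  shows "handle_vertex N l r \<in> ES_vertices (Suc N)"
proof -
  let ?G = "free_group (Suc N)"
  interpret group ?G
    by (rule group_free_group)
  have "is_free_product ?G (map fwords [{N}, {..<N}])"
    by (intro free_product_fwords) (auto simp: less_Suc_eq nth_Cons split: nat.splits)
  from free_product_image[OF shear_iso[OF lr] this]
  have "is_free_product ?G [shear N l r ` fwords {N}, fwords {..<N}]"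
    by (simp add: shear_image_fwords)
  moreover have "nontrivial_sub ?G (shear N l r ` fwords {N})" "nontrivial_sub ?G (fwords {..<N})"
    using nontrivial_shear[OF lr, of N "{N}"] nontrivial_fwords[of ?G 0 "{..<N}"] assms(1) by auto
  ultimately show ?thesis
    unfolding ES_vertices_def handle_vertex_def free_splittings_def by blast
qed

lemma shear_eq_conj:
  assumes "freduced l" "freduced r" "w \<in> fwords {N}"
  shows "shear N l r w = fmult l (fmult (shear N [] (fmult r l) w) (finv l))"
  using assms(3)
proof (induction w)
  case Nil
  then show ?case
    using assms by (simp add: shear_def fmult_finv_right)
next
  case (Cons s w)
  then have w: "w \<in> fwords {N}" and s: "fst s = N"
    by (auto simp: fwords_def freduced_Cons)
  have red: "freduced (shear N l' r' w)" for l' r'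
    by (simp add: shear_def freduced_subst)
  have "shear_letter N l r s = fmult l (fmult (shear_letter N [] (fmult r l) s) (finv l))"
    using assms(1,2) s by (auto simp: shear_letter_def fmult_assoc freduced_fmult finv_fmult fmult_cancel
        fmult_finv_right fmult_Nil_right)
  moreover have "freduced (shear_letter N [] (fmult r l) s)"
    using assms by (intro freduced_shear_letter) (auto simp: freduced_fmult)
  ultimately show ?case
    using Cons.IH[OF w] assms(1,2) red
    by (simp add: shear_def fmult_assoc freduced_fmult fmult_cancel freduced_subst)
qed

text \<open>Conjugation by \<open>l\<close> takes \<open>x r l\<close> to \<open>l x r\<close> and
  preserves \<open>B\<close>, which contains \<open>l\<close>. The freedom to choose
  \<open>l\<close> is what later produces conjugates.\<close>

lemma handle_vertex_eq:
  assumes lr: "l \<in> fwords {..<N}" "r \<in> fwords {..<N}"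
  shows "handle_vertex N l r = handle_vertex N [] (fmult r l)"
proof -
  let ?P = "{shear N [] (fmult r l) ` fwords {N}, fwords {..<N}}"
  have "{..<N} \<subseteq> {..<Suc N}"
    by auto
  then have l: "l \<in> carrier (free_group (Suc N))"
    using lr fwords_mono[of "{..<N}" "{..<Suc N}"] by (auto simp: carrier_free_group)
  have red: "freduced l" "freduced r"
    using lr by (auto simp: fwords_def)
  have "conj_sub (Suc N) l (shear N [] (fmult r l) ` fwords {N}) = shear N l r ` fwords {N}"
    unfolding conj_sub_def image_image
  proof (intro image_cong refl)
    fix w assume "w \<in> fwords {N}"
    then show "l \<otimes>\<^bsub>free_group (Suc N)\<^esub> shear N [] (fmult r l) w \<otimes>\<^bsub>free_group (Suc N)\<^esub>
        inv\<^bsub>free_group (Suc N)\<^esub> l = shear N l r w"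
      using shear_eq_conj[OF red, of w N] l red by (simp add: inv_free_group fmult_assoc)
  qed
  moreover have "conj_sub (Suc N) l (fwords {..<N}) = fwords {..<N}"
    using lr by (intro conj_sub_fwords) auto
  ultimately have "conj_sub (Suc N) l ` ?P = {shear N l r ` fwords {N}, fwords {..<N}}"
    by simp
  moreover have "D \<subseteq> carrier (free_group (Suc N))" if "D \<in> ?P" for D
  proof -
    have sub: "fwords {..<N} \<subseteq> fwords {..<Suc N}" "fwords {N} \<subseteq> fwords {..<Suc N}"
      by (auto intro!: fwords_mono)
    have "fmult r l \<in> fwords {..<Suc N}"
      using lr sub(1) fwords_fmult by blast
    then have "shear N [] (fmult r l) ` fwords {N} \<subseteq> fwords {..<Suc N}"
      using sub(2) shear_closed[OF fwords_Nil] by blast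
    then show ?thesis
      using that sub unfolding carrier_free_group by blast
  qed
  ultimately show ?thesis
    unfolding handle_vertex_def using conj_class_conj[OF l, of ?P] by simp
qed

text \<open>Multiplying \<open>l x r\<close> on the right by a power of the generator
  \<open>i\<close> does not change the subgroup that these two elements generate.\<close>

lemma handle_neighbour_eq:
  assumes i: "i < N" and lr: "l \<in> fwords {..<N}" "r \<in> fwords {..<N}" and y: "y \<in> fwords {i}"
  shows "handle_neighbour N i l (fmult r y) = handle_neighbour N i l r"
proof -
  have sub: "shear N [] v ` fwords {N, i} \<subseteq> fwords {N, i}" if "v \<in> fwords {i}" for v
    using that fwords_mono[of "{i}" "{N, i}"] shear_closed[OF fwords_Nil] by blast
  have yB: "y \<in> fwords {..<N}" and red: "freduced y"
    using y i fwords_mono[of "{i}" "{..<N}"] by (auto simp: fwords_def)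
  have "w \<in> shear N [] y ` fwords {N, i}" if w: "w \<in> fwords {N, i}" for w
  proof
    show "w = shear N [] y (shear N [] (finv y) w)"
      using yB red w by (simp add: shear_comp[of _ "{..<N}"] fmult_finv_right shear_trivial fwords_def)
    show "shear N [] (finv y) w \<in> fwords {N, i}"
      using sub[of "finv y"] y w by auto
  qed
  then have img: "shear N [] y ` fwords {N, i} = fwords {N, i}"
    using sub[OF y] by blast
  have "shear N l (fmult r y) w = shear N l r (shear N [] y w)" for w
    using lr yB by (simp add: shear_comp[of _ "{..<N}"])
  then have "shear N l (fmult r y) ` fwords {N, i} = shear N l r ` shear N [] y ` fwords {N, i}"
    by (simp add: image_image)
  then show ?thesis
    by (simp add: handle_neighbour_def img)
qed

section \<open>Walks of bounded length and conjugation invariance\<close>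

definition walk_within :: "nat \<Rightarrow> fword set set set \<Rightarrow> fword set set set \<Rightarrow> nat \<Rightarrow> bool" where
  "walk_within n V W d \<longleftrightarrow> (\<exists>k \<le> d. ES_walk n V W k)"

lemma walk_within_refl: "walk_within n V V d"
  unfolding walk_within_def ES_walk_def by (intro exI[of _ 0] conjI exI[of _ "[V]"]) auto

lemma walk_within_mono: "walk_within n V W d \<Longrightarrow> d \<le> d' \<Longrightarrow> walk_within n V W d'"
  unfolding walk_within_def using order_trans by blast

lemma walk_within_edge: "ES_edge n V W \<Longrightarrow> walk_within n V W 1"
  unfolding walk_within_def ES_walk_def by (intro exI[of _ 1] conjI exI[of _ "[V, W]"]) auto

lemma walk_within_trans:
  assumes "walk_within n U V d" "walk_within n V W e"
  shows "walk_within n U W (d + e)"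
proof -
  obtain k ps where ps: "k \<le> d" "length ps = Suc k" "ps ! 0 = U" "ps ! k = V"
    "\<forall>i < k. ES_edge n (ps ! i) (ps ! Suc i)"
    using assms(1) by (auto simp: walk_within_def ES_walk_def)
  obtain m qs where qs: "m \<le> e" "length qs = Suc m" "qs ! 0 = V" "qs ! m = W"
    "\<forall>i < m. ES_edge n (qs ! i) (qs ! Suc i)"
    using assms(2) by (auto simp: walk_within_def ES_walk_def)
  obtain qs' where qs': "qs = V # qs'"
    using qs by (cases qs) auto
  define rs where "rs = ps @ qs'"
  have r: "rs ! i = ps ! i" if "i \<le> k" for i
    using that ps(2) by (simp add: rs_def nth_append)
  have r': "rs ! (k + i) = qs ! i" for i
    using ps(2,4) by (cases i) (simp_all add: rs_def nth_append qs')
  have "ES_edge n (rs ! i) (rs ! Suc i)" if "i < k + m" for i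
  proof (cases "i < k")
    case True
    then show ?thesis
      using ps(5) r by simp
  next
    case False
    define j where "j = i - k"
    have "i = k + j" "j < m"
      using False that by (auto simp: j_def)
    then show ?thesis
      using qs(5) r'[of j] r'[of "Suc j"] by simp
  qed
  then have "ES_walk n U W (k + m)"
    unfolding ES_walk_def using ps qs r[of 0] r'[of m]
    by (intro exI[of _ rs]) (simp add: rs_def qs')
  then show ?thesis
    unfolding walk_within_def using ps(1) qs(1) by (meson add_mono)
qed

lemma ES_edge_sym: "ES_edge n V W \<Longrightarrow> ES_edge n W V"
  unfolding ES_edge_def by blast

text \<open>Present the vertex of \<open>w\<close> with \<open>l = finv k\<close> and
  \<open>r = w k\<close>. Multiplying \<open>r\<close> by \<open>y\<close> keeps the neighbour, so
  the two vertices have a common one, and moving \<open>l\<close> back to the right turns the new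
  word into \<open>w k y\<close> times \<open>finv k\<close>.\<close>

lemma walk_conj_letter:
  assumes N: "N \<ge> 2" and w: "w \<in> fwords {..<N}" and k: "k \<in> fwords {..<N}" and y: "fst y < N"
  shows "walk_within (Suc N) (handle_vertex N [] w) (handle_vertex N [] (fmult w (fmult k (fmult [y] (finv k))))) 2"
proof -
  have red: "freduced w" "freduced k"
    using w k by (auto simp: fwords_def)
  have yB: "[y] \<in> fwords {..<N}" "[y] \<in> fwords {fst y}"
    using y by auto
  have 1: "handle_vertex N [] w = handle_vertex N (finv k) (fmult w k)"
    using handle_vertex_eq[of "finv k" N "fmult w k"] w k red
    by (simp add: fwords_fmult fmult_assoc fmult_finv_right fmult_Nil_right)
  have 2: "handle_vertex N [] (fmult w (fmult k (fmult [y] (finv k)))) =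
      handle_vertex N (finv k) (fmult (fmult w k) [y])"
    using handle_vertex_eq[of "finv k" N "fmult (fmult w k) [y]"] w k yB red
    by (simp add: fwords_fmult fmult_assoc freduced_fmult)
  have "walk_within (Suc N) (handle_vertex N (finv k) (fmult w k)) (handle_neighbour N (fst y) (finv k) (fmult w k)) 1"
    using w k by (intro walk_within_edge ES_edge_sym[OF handle_edge[OF N y]]) (simp_all add: fwords_fmult)
  moreover have "walk_within (Suc N) (handle_neighbour N (fst y) (finv k) (fmult (fmult w k) [y]))
      (handle_vertex N (finv k) (fmult (fmult w k) [y])) 1"
    using w k yB(1) by (intro walk_within_edge handle_edge[OF N y]) (simp_all add: fwords_fmult del: fwords_single)
  moreover have "handle_neighbour N (fst y) (finv k) (fmult (fmult w k) [y]) =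
      handle_neighbour N (fst y) (finv k) (fmult w k)"
    using w k yB by (intro handle_neighbour_eq[OF y]) (simp_all add: fwords_fmult del: fwords_single)
  ultimately show ?thesis
    unfolding 1 2 using walk_within_trans[of "Suc N" _ _ 1 _ 1] unfolding one_add_one by simp
qed

text \<open>The letters of \<open>g\<close> are inserted one at a time, all conjugated by the same
  \<open>k\<close>, so the cost does not depend on \<open>k\<close>.\<close>

lemma walk_conj:
  assumes N: "N \<ge> 2" and k: "k \<in> fwords {..<N}"
  shows "w \<in> fwords {..<N} \<Longrightarrow> g \<in> fwords {..<N} \<Longrightarrow>
    walk_within (Suc N) (handle_vertex N [] w) (handle_vertex N [] (fmult w (fmult k (fmult g (finv k))))) (2 * length g)"
proof (induction g arbitrary: w)
  case Nil
  then show ?case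
    using k by (simp add: fwords_def fmult_finv_right fmult_Nil_right walk_within_refl)
next
  case (Cons y g)
  have g: "g \<in> fwords {..<N}" and y: "fst y < N" and f: "freduced ([y] @ g)"
    using Cons.prems by (auto simp: fwords_def freduced_Cons)
  have red: "freduced w" "freduced k" "freduced g"
    using Cons.prems k g by (auto simp: fwords_def)
  let ?w = "fmult w (fmult k (fmult [y] (finv k)))"
  have w': "?w \<in> fwords {..<N}"
    using Cons.prems k y by (intro fwords_fmult) auto
  have "fmult ?w (fmult k (fmult g (finv k))) = fmult w (fmult k (fmult (y # g) (finv k)))"
    using red fmult_append[OF f] fmult_assoc[of "finv k" "[y]" g]
    by (simp add: fmult_assoc freduced_fmult fmult_cancel)
  then show ?case
    using walk_within_trans[OF walk_conj_letter[OF N Cons.prems(1) k y] Cons.IH[OF w' g]] by simp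
qed

section \<open>Quasi-isometric embeddings\<close>

lemma length_fmult: "length (fmult v w) \<le> length v + length w"
proof (induction v)
  case (Cons x v)
  then show ?case
    by (auto simp: fmult_Cons fstep_def)
qed simp

lemma handle_vertex_segment:
  assumes "w \<in> fwords {..<N}"
  shows "vertex_segment N (handle_vertex N [] w) w"
proof -
  let ?G = "free_group (Suc N)"
  interpret group ?G
    by (rule group_free_group)
  let ?P = "{shear N [] w ` fwords {N}, fwords {..<N}}"
  have sub: "fwords {..<N} \<subseteq> fwords {..<Suc N}" "fwords {N} \<subseteq> fwords {..<Suc N}"
    by (auto intro!: fwords_mono)
  have "w \<in> fwords {..<Suc N}"
    using assms sub(1) by blast
  then have "shear N [] w ` fwords {N} \<subseteq> fwords {..<Suc N}"
    using sub(2) shear_closed[OF fwords_Nil] by blast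
  then have "D \<subseteq> carrier ?G" if "D \<in> ?P" for D
    using that sub(1) unfolding carrier_free_group by blast
  then have P: "?P \<in> handle_vertex N [] w"
    unfolding handle_vertex_def by (rule conj_class_self)
  have red: "reduced_syllables N [(True, w)] True"
    using assms by simp
  have f: "freduced ([(N, True)] @ w)"
    using freduced_syllable_word[OF red] freduced_append[of "(N, True) # w" "[(N, True)]"] by simp
  have "shear N [] w [(N, True)] = syllable_word N [(True, w)]"
    using fmult_append[OF f] assms by (simp add: shear_generator fwords_def)
  moreover have "shear N [] w [(N, True)] \<in> shear N [] w ` fwords {N}"
    by simp
  moreover have "segment_of N (syllable_word N [(True, w)]) w"
    unfolding segment_of_def
  proof (intro exI conjI)
    show "\<one>\<^bsub>?G\<^esub> \<in> carrier ?G"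
      by (rule one_closed)
    show "syllable_word N [(True, w)] = \<one>\<^bsub>?G\<^esub> \<otimes>\<^bsub>?G\<^esub> syllable_word N ((True, w) # []) \<otimes>\<^bsub>?G\<^esub> inv\<^bsub>?G\<^esub> \<one>\<^bsub>?G\<^esub>"
      using syllable_word_carrier[OF red] by (simp del: mult_free_group one_free_group syllable_word_simps)
  qed (use red in simp_all)
  ultimately show ?thesis
    unfolding vertex_segment_def using P by (metis insertI1)
qed

lemma brooks_handle_walk:
  assumes N: "N \<ge> 2" and u: "full N u" and w: "w \<in> fwords {..<N}" "w' \<in> fwords {..<N}"
    and walk: "ES_walk (Suc N) (handle_vertex N [] w) (handle_vertex N [] w') k"
  shows "\<bar>brooks u w - brooks u w'\<bar> \<le> 12 * int (length u) * (int k + 1)"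
proof -
  \<comment> \<open>Any edge at the starting vertex yields a half-space for it, which is needed even
    for a walk of length 0.\<close>
  have "ES_edge (Suc N) (handle_neighbour N 0 [] w) (handle_vertex N [] w)"
    using N w by (intro handle_edge) auto
  then obtain E where "separating_halfspace N (handle_vertex N [] w) E"
    using ES_edge_segments by metis
  then show ?thesis
    using brooks_walk[OF N u walk] handle_vertex_segment w by blast
qed

section \<open>Products of powers and independent words\<close>

fun power_product :: "nat \<Rightarrow> (nat \<Rightarrow> fword) \<Rightarrow> nat \<Rightarrow> int list \<Rightarrow> fword" where
  "power_product n u i [] = []"
| "power_product n u i (a # as) = fmult (u i [^]\<^bsub>free_group n\<^esub> a) (power_product n u (Suc i) as)"

context
  fixes N :: nat and u :: "nat \<Rightarrow> fword"
  assumes N: "N \<ge> 2" and u: "\<And>i. u i \<in> fwords {..<N}"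
begin

interpretation G: group "free_group N"
  by (rule group_free_group)

lemma power_closed: "u i [^]\<^bsub>free_group N\<^esub> (a :: int) \<in> fwords {..<N}"
  using u[of i] G.int_pow_closed[of "u i" a] by (simp add: carrier_free_group)

lemma power_product_closed: "power_product N u i as \<in> fwords {..<N}"
  by (induction as arbitrary: i) (auto intro: fwords_fmult power_closed)

lemma length_power: "int (length (u i [^]\<^bsub>free_group N\<^esub> (a :: int))) \<le> \<bar>a\<bar> * int (length (u i))"
proof -
  have nat: "length (u i [^]\<^bsub>free_group N\<^esub> k) \<le> k * length (u i)" for k :: nat
  proof (induction k)
    case (Suc k)
    then show ?case
      using length_fmult[of "u i [^]\<^bsub>free_group N\<^esub> k" "u i"] by simp
  qed simp
  have c: "u i [^]\<^bsub>free_group N\<^esub> k \<in> carrier (free_group N)" for k :: nat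
    using u[of i] by (intro G.nat_pow_closed) (simp add: carrier_free_group)
  have "length (u i [^]\<^bsub>free_group N\<^esub> a) = length (u i [^]\<^bsub>free_group N\<^esub> nat \<bar>a\<bar>)"
    unfolding int_pow_def2 inv_free_group[OF c] by (cases "a < 0") (simp_all only: abs_if if_True if_False finv_simps)
  then have "length (u i [^]\<^bsub>free_group N\<^esub> a) \<le> nat \<bar>a\<bar> * length (u i)"
    using nat[of "nat \<bar>a\<bar>"] by (simp only:)
  then have "int (length (u i [^]\<^bsub>free_group N\<^esub> a)) \<le> int (nat \<bar>a\<bar> * length (u i))"
    by (simp only: of_nat_le_iff)
  then show ?thesis
    by simp
qed

text \<open>Replacing the exponent \<open>a\<close> of \<open>u i\<close> by \<open>b\<close> in
  front of a tail \<open>v\<close> is right multiplication by a power of \<open>u i\<close>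
  conjugated by \<open>finv v\<close>, at a cost independent of \<open>v\<close>. The arbitrary
  prefix \<open>p\<close> then takes up the new leading power while the tail is treated.\<close>

lemma walk_power_product:
  assumes L: "\<And>j. j < i + length as \<Longrightarrow> length (u j) \<le> L"
  shows "length as = length bs \<Longrightarrow> p \<in> fwords {..<N} \<Longrightarrow>
    walk_within (Suc N) (handle_vertex N [] (fmult p (power_product N u i as)))
      (handle_vertex N [] (fmult p (power_product N u i bs)))
      (2 * L * nat (\<Sum>j < length as. \<bar>as ! j - bs ! j\<bar>))"
  using L
proof (induction as bs arbitrary: i p rule: list_induct2')
  case (4 a as b bs)
  let ?v = "power_product N u (Suc i) as" and ?u = "\<lambda>a. u i [^]\<^bsub>free_group N\<^esub> (a :: int)"
  have v: "?v \<in> fwords {..<N}" and p: "p \<in> fwords {..<N}"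
    using power_product_closed 4 by auto
  have red: "freduced p" "freduced ?v" "freduced (?u a)" "freduced (?u b)" for a b
    using v p power_closed by (auto simp: fwords_def)
  have pc: "fmult p (?u b) \<in> fwords {..<N}"
    using p power_closed by (rule fwords_fmult)
  have ui: "u i \<in> carrier (free_group N)"
    using u by (simp add: carrier_free_group)
  have "fmult (?u a) (?u (b - a)) = ?u b"
    using G.int_pow_mult[OF ui, of a "b - a"] by simp
  then have "fmult (fmult p (fmult (?u a) ?v)) (fmult (finv ?v) (fmult (?u (b - a)) (finv (finv ?v)))) =
      fmult p (fmult (?u b) ?v)"
    using red by (simp add: fmult_assoc freduced_fmult fmult_cancel flip: fmult_assoc[of "?v" "?u a"])
  then have 1: "walk_within (Suc N) (handle_vertex N [] (fmult p (fmult (?u a) ?v)))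
      (handle_vertex N [] (fmult p (fmult (?u b) ?v))) (2 * length (?u (b - a)))"
    using walk_conj[OF N, of "finv ?v" "fmult p (fmult (?u a) ?v)" "?u (b - a)"] v p power_closed
    by (simp add: fwords_fmult)
  have 2: "walk_within (Suc N) (handle_vertex N [] (fmult (fmult p (?u b)) ?v))
      (handle_vertex N [] (fmult (fmult p (?u b)) (power_product N u (Suc i) bs)))
      (2 * L * nat (\<Sum>j < length as. \<bar>as ! j - bs ! j\<bar>))"
    using 4 pc by simp
  have "int (length (?u (b - a))) \<le> int L * \<bar>a - b\<bar>"
  proof -
    have "int (length (?u (b - a))) \<le> \<bar>b - a\<bar> * int (length (u i))"
      by (rule length_power)
    also have "\<dots> \<le> \<bar>b - a\<bar> * int L"
      using 4(4)[of i] by (intro mult_left_mono) auto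
    finally show ?thesis
      by (simp add: abs_minus_commute mult.commute)
  qed
  then have "length (?u (b - a)) \<le> L * nat \<bar>a - b\<bar>"
    by (metis abs_ge_zero int_nat_eq nat_int nat_mono nat_mult_distrib of_nat_0_le_iff)
  moreover have "nat (\<Sum>j < length (a # as). \<bar>(a # as) ! j - (b # bs) ! j\<bar>) =
      nat \<bar>a - b\<bar> + nat (\<Sum>j < length as. \<bar>as ! j - bs ! j\<bar>)"
    by (simp add: sum.lessThan_Suc_shift nat_add_distrib sum_nonneg del: sum.lessThan_Suc)
  ultimately have "2 * length (?u (b - a)) + 2 * L * nat (\<Sum>j < length as. \<bar>as ! j - bs ! j\<bar>) \<le>
      2 * L * nat (\<Sum>j < length (a # as). \<bar>(a # as) ! j - (b # bs) ! j\<bar>)"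
    by (simp only: distrib_left)
  moreover have "fmult (fmult p (?u b)) c = fmult p (fmult (?u b) c)" if "freduced c" for c
    using that by (rule fmult_assoc)
  ultimately show ?case
    using walk_within_mono[OF walk_within_trans[OF 1]] 2 red power_product_closed[of "Suc i" bs]
    by (simp add: fwords_def)
qed (simp_all add: walk_within_refl)

text \<open>Each multiplication costs \<open>3 * length \<pi>\<close>, and only the power with index
  \<open>j\<close> contributes. The case distinction keeps the statement valid once the induction
  has passed \<open>j\<close>.\<close>

lemma brooks_power_product:
  assumes \<pi>: "\<pi> \<noteq> []" and other: "\<And>i a. i \<noteq> j \<Longrightarrow> brooks \<pi> (u i [^]\<^bsub>free_group N\<^esub> (a :: int)) = 0"
  shows "\<bar>brooks \<pi> (power_product N u i as) -
      (if i \<le> j \<and> j < i + length as then brooks \<pi> (u j [^]\<^bsub>free_group N\<^esub> (as ! (j - i))) else 0)\<bar>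
    \<le> 3 * int (length \<pi>) * int (length as)"
proof (induction as arbitrary: i)
  case (Cons a as)
  have "freduced (u i [^]\<^bsub>free_group N\<^esub> a)" "freduced (power_product N u (Suc i) as)"
    using power_closed power_product_closed by (auto simp: fwords_def)
  then have "\<bar>brooks \<pi> (power_product N u i (a # as)) - brooks \<pi> (u i [^]\<^bsub>free_group N\<^esub> a) -
      brooks \<pi> (power_product N u (Suc i) as)\<bar> \<le> 3 * int (length \<pi>)"
    using brooks_fmult[OF \<pi>] by simp
  moreover note Cons.IH[of "Suc i"]
  moreover have "i \<noteq> j \<Longrightarrow> i \<le> j \<Longrightarrow> (a # as) ! (j - i) = as ! (j - Suc i)"
    by (simp flip: Suc_diff_Suc)
  ultimately show ?case
    using other[of i a] by (cases "i = j") (auto simp: algebra_simps split: if_splits)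
qed simp

end

lemma brooks_nonneg_pow:
  assumes "\<And>k :: nat. occ \<pi> (concat (replicate (Suc k) w)) \<ge> k"
    and "\<And>k. occ (finv \<pi>) (concat (replicate k w)) = 0"
  shows "brooks \<pi> (concat (replicate (k + d) w)) \<ge> brooks \<pi> (concat (replicate k w)) + int d - 1"
proof -
  have "occ \<pi> (concat (replicate d w)) \<ge> d - 1"
    using assms(1)[of "d - 1"] by (cases d) auto
  moreover have "occ \<pi> (concat (replicate (k + d) w)) \<ge>
      occ \<pi> (concat (replicate k w)) + occ \<pi> (concat (replicate d w))"
    unfolding replicate_add concat_append by (rule occ_append_ge)
  ultimately show ?thesis
    using assms(2) by (simp add: brooks_def)
qed

text \<open>For exponents of equal sign the growth estimate loses 1. When the exponents lie on
  different sides of 0, both halves are estimated separately and the losses add up to 2.\<close>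

lemma brooks_int_pow:
  assumes w: "cyc_reduced w" "w \<in> carrier (free_group n)" and \<pi>: "\<pi> \<noteq> []"
    and occ: "\<And>k :: nat. occ \<pi> (concat (replicate (Suc k) w)) \<ge> k"
    "\<And>k. occ (finv \<pi>) (concat (replicate k w)) = 0"
    and "b \<le> a"
  shows "brooks \<pi> (w [^]\<^bsub>free_group n\<^esub> (a :: int)) \<ge> brooks \<pi> (w [^]\<^bsub>free_group n\<^esub> b) + (a - b) - 2"
proof -
  interpret group "free_group n"
    by (rule group_free_group)
  have c: "concat (replicate k w) \<in> carrier (free_group n)" for k
    using nat_pow_closed[OF w(2), of k] by (simp only: pow_cyc_reduced[OF w])
  have p: "w [^]\<^bsub>free_group n\<^esub> c = (if c < 0 then finv (concat (replicate (nat (- c)) w)) else concat (replicate (nat c) w))"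
    for c :: int
    by (simp only: int_pow_def2 pow_cyc_reduced[OF w] inv_free_group[OF c])
  let ?h = "\<lambda>k. brooks \<pi> (concat (replicate k w))"
  have h: "?h (k + d) \<ge> ?h k + int d - 1" for k d
    using brooks_nonneg_pow[OF occ] .
  have pos: "?h k \<ge> int k - 1" for k
    using h[of 0 k] by simp
  consider "b \<ge> 0" | "a < 0" | "b < 0" "a \<ge> 0"
    by linarith
  then show ?thesis
  proof cases
    case 1
    then show ?thesis
      using h[of "nat b" "nat (a - b)"] \<open>b \<le> a\<close> by (simp add: p flip: nat_add_distrib)
  next
    case 2
    then have "nat (- a) + nat (a - b) = nat (- b)"
      using \<open>b \<le> a\<close> by auto
    then show ?thesis
      using h[of "nat (- a)" "nat (a - b)"] 2 \<open>b \<le> a\<close> by (simp add: p brooks_finv[OF \<pi>])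
  next
    case 3
    then show ?thesis
      using pos[of "nat a"] pos[of "nat (- b)"] by (simp add: p brooks_finv[OF \<pi>])
  qed
qed

lemma brooks_int_pow_eq_0:
  assumes w: "cyc_reduced w" "w \<in> carrier (free_group n)" and \<pi>: "\<pi> \<noteq> []"
    and occ: "\<And>k. occ \<pi> (concat (replicate k w)) = 0" "\<And>k. occ (finv \<pi>) (concat (replicate k w)) = 0"
  shows "brooks \<pi> (w [^]\<^bsub>free_group n\<^esub> (a :: int)) = 0"
proof -
  interpret group "free_group n"
    by (rule group_free_group)
  have h: "brooks \<pi> (concat (replicate k w)) = 0" for k
    using occ by (simp add: brooks_def)
  have c: "concat (replicate k w) \<in> carrier (free_group n)" for k
    using nat_pow_closed[OF w(2), of k] by (simp only: pow_cyc_reduced[OF w])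
  show ?thesis
    by (simp only: int_pow_def2 pow_cyc_reduced[OF w] inv_free_group[OF c] brooks_finv[OF \<pi>] h minus_zero if_cancel split: if_split) simp
qed

lemma independent_full_words:
  assumes "N \<ge> 2"
  obtains u \<pi> :: "nat \<Rightarrow> fword" where "\<forall>i. u i \<in> fwords {..<N} \<and> full N (\<pi> i) \<and> \<pi> i \<noteq> []"
    "\<forall>i j. \<forall>a :: int. i \<noteq> j \<longrightarrow> brooks (\<pi> j) (u i [^]\<^bsub>free_group N\<^esub> a) = 0"
    "\<forall>i. \<forall>a b :: int. b \<le> a \<longrightarrow> brooks (\<pi> i) (u i [^]\<^bsub>free_group N\<^esub> a) \<ge>
       brooks (\<pi> i) (u i [^]\<^bsub>free_group N\<^esub> b) + (a - b) - 2"
proof -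
  define y z :: letter where "y = (1, True)" and "z = (0, True)"
  have yz: "fst y < N" "fst z < N" "y \<noteq> z" "flip y \<noteq> z" "y \<noteq> flip z"
    using assms by (auto simp: y_def z_def)
  obtain V where V: "V \<in> fwords {..<N}" "full N V" "V \<noteq> []" "hd V = z" "last V = z"
    using exists_full_word[OF assms yz(2)] .
  \<comment> \<open>Runs longer than \<open>V\<close> can be located in the periodic words, and
    different lengths for different \<open>i\<close> make the patterns independent.\<close>
  define M where "M i = Suc (length V + i)" for i
  define u where "u i = V @ replicate (M i) y" for i
  define \<pi> where "\<pi> i = V @ replicate (M i) y @ V" for i
  have rep: "freduced (replicate k y)" for k
  proof (induction k)
    case (Suc k)
    then show ?case
      by (cases k) (auto simp: freduced_Cons)
  qed simp
  have M: "length V < M i" "0 < M i" for i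
    by (auto simp: M_def)
  have last_rep: "last (replicate (M i) y) = y" "hd (replicate (M i) y) = y" "replicate (M i) y \<noteq> []" for i
    by (auto simp: M_def)
  have uB: "u i \<in> fwords {..<N}" for i
    using V yz rep last_rep by (auto simp: u_def fwords_def freduced_append)
  then have uc: "u i \<in> carrier (free_group N)" for i
    by (simp add: carrier_free_group)
  have "u i @ [hd (u i)] = u i @ [z]" for i
    using V by (simp add: u_def)
  then have cyc: "cyc_reduced (u i)" for i
    using uB[of i] V yz last_rep by (auto simp: cyc_reduced_def freduced_append fwords_def u_def)
  have \<pi>: "\<pi> i \<noteq> []" "full N (\<pi> i)" for i
    using V full_sublist[OF V(2), of "\<pi> i"] by (auto simp: \<pi>_def)
  have 1: "occ (finv (\<pi> j)) (concat (replicate k (u i))) = 0" for i j k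
    unfolding \<pi>_def u_def by (rule occ_eq_0[OF not_sublist_finv_periodic[OF V(3-5) yz(3) M]])
  have 2: "occ (\<pi> j) (concat (replicate k (u i))) = 0" if "i \<noteq> j" for i j k
  proof (rule occ_eq_0, rule notI)
    assume "sublist (\<pi> j) (concat (replicate k (u i)))"
    then have "M j = M i"
      unfolding \<pi>_def u_def using M[of j] by (intro not_sublist_periodic[OF V(3-5) yz(3)]) auto
    then show False
      using that by (simp add: M_def)
  qed
  have 3: "occ (\<pi> i) (concat (replicate (Suc k) (u i))) \<ge> k" for i k
    unfolding \<pi>_def u_def by (rule occ_periodic[OF V(3-5) yz(3)])
  show thesis
  proof (rule that)
    show "\<forall>i. u i \<in> fwords {..<N} \<and> full N (\<pi> i) \<and> \<pi> i \<noteq> []"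
      using uB \<pi> by simp
    show "\<forall>i j. \<forall>a :: int. i \<noteq> j \<longrightarrow> brooks (\<pi> j) (u i [^]\<^bsub>free_group N\<^esub> a) = 0"
      by (intro allI impI brooks_int_pow_eq_0[OF cyc uc \<pi>(1) 2 1])
    show "\<forall>i. \<forall>a b :: int. b \<le> a \<longrightarrow> brooks (\<pi> i) (u i [^]\<^bsub>free_group N\<^esub> a) \<ge>
       brooks (\<pi> i) (u i [^]\<^bsub>free_group N\<^esub> b) + (a - b) - 2"
      by (intro allI impI brooks_int_pow[OF cyc uc \<pi>(1) 3 1])
  qed
qed

text \<open>The infimum of a nonempty set of \<open>enat\<close> values is attained, so the distance
  is the length of an actual walk, to which the lower estimate applies.\<close>

lemma ES_dist_le:
  assumes "walk_within n V W d"
  shows "ES_dist n V W \<noteq> \<infinity>" "the_enat (ES_dist n V W) \<le> d" "ES_walk n V W (the_enat (ES_dist n V W))"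
proof -
  obtain k where k: "k \<le> d" "ES_walk n V W k"
    using assms by (auto simp: walk_within_def)
  then have mem: "enat k \<in> {enat k | k. ES_walk n V W k}"
    by blast
  then have le: "ES_dist n V W \<le> enat k"
    unfolding ES_dist_def by (rule Inf_lower)
  then obtain m where m: "ES_dist n V W = enat m"
    by (cases "ES_dist n V W") auto
  then show "ES_dist n V W \<noteq> \<infinity>"
    by simp
  show "the_enat (ES_dist n V W) \<le> d"
    using le k(1) m by simp
  have "ES_dist n V W \<in> {enat k | k. ES_walk n V W k}"
    unfolding ES_dist_def Inf_enat_def using mem by (auto intro: LeastI)
  then show "ES_walk n V W (the_enat (ES_dist n V W))"
    using m by auto
qed

theorem mainTheorem10:
  fixes n :: nat
  assumes "n \<ge> 3"
  shows "\<forall>m :: nat. qi_embeds_Zm_ES m n"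
proof
  fix m :: nat
  define N where "N = n - 1"
  have N: "N \<ge> 2" "n = Suc N"
    using assms by (auto simp: N_def)
  obtain u \<pi> :: "nat \<Rightarrow> fword" where fam: "\<forall>i. u i \<in> fwords {..<N} \<and> full N (\<pi> i) \<and> \<pi> i \<noteq> []"
    and other: "\<forall>i j. \<forall>a :: int. i \<noteq> j \<longrightarrow> brooks (\<pi> j) (u i [^]\<^bsub>free_group N\<^esub> a) = 0"
    and same: "\<forall>i. \<forall>a b :: int. b \<le> a \<longrightarrow> brooks (\<pi> i) (u i [^]\<^bsub>free_group N\<^esub> a) \<ge>
       brooks (\<pi> i) (u i [^]\<^bsub>free_group N\<^esub> b) + (a - b) - 2"
    by (rule independent_full_words[OF N(1)])
  have u: "u i \<in> fwords {..<N}" and \<pi>: "full N (\<pi> i)" "\<pi> i \<noteq> []" for i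
    using fam by simp_all
  define W where "W = power_product N u 0"
  define f where "f x = handle_vertex N [] (W x)" for x
  have W: "W x \<in> fwords {..<N}" for x
    unfolding W_def by (rule power_product_closed[OF N(1) u])
  \<comment> \<open>The inserted 0, and the inserted 1 in \<open>P\<close>, keep the maxima defined
    for \<open>m = 0\<close>; the 1 also makes \<open>P\<close> positive.\<close>
  define L where "L = Max (insert 0 ((length \<circ> u) ` {..<m}))"
  have L: "length (u j) \<le> L" if "j < m" for j
    unfolding L_def using that by (intro Max_ge) auto
  define P where "P = Max (insert 1 ((length \<circ> \<pi>) ` {..<m}))"
  have P: "length (\<pi> j) \<le> P" if "j < m" for j
    unfolding P_def using that by (intro Max_ge) auto
  have "P \<ge> 1"
    unfolding P_def by (intro Max_ge) auto
  define dist where "dist x y = the_enat (ES_dist n (f x) (f y))" for x y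
  have upper: "ES_dist n (f x) (f y) \<noteq> \<infinity> \<and> real (dist x y) \<le> 2 * real L * l1_dist x y \<and>
      ES_walk n (f x) (f y) (dist x y)"
    if xy: "length x = m" "length y = m" for x y
  proof -
    let ?S = "\<Sum>j < length x. \<bar>x ! j - y ! j\<bar>"
    have "walk_within (Suc N) (handle_vertex N [] (fmult [] (power_product N u 0 x)))
        (handle_vertex N [] (fmult [] (power_product N u 0 y))) (2 * L * nat ?S)"
      using xy L by (intro walk_power_product[OF N(1) u]) auto
    then have "walk_within n (f x) (f y) (2 * L * nat ?S)"
      by (simp add: f_def W_def N(2))
    note d = ES_dist_le[OF this]
    have "real (dist x y) \<le> real (2 * L * nat ?S)"
      using d(2) unfolding dist_def by (rule of_nat_mono)
    also have "\<dots> = 2 * real L * l1_dist x y"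
      by (simp add: l1_dist_def sum_nonneg)
    finally show ?thesis
      using d by (simp add: dist_def)
  qed
  define A where "A = 12 * real P"
  \<comment> \<open>The additive loss of one coordinate, taken \<open>m\<close> times: 2 from the
    powers, \<open>6 P m\<close> from the two power products, \<open>A\<close> from the extra vertex
    of a walk.\<close>
  define C where "C = real m * (2 + 6 * real P * real m + A)"
  have "A \<ge> 12"
    using \<open>P \<ge> 1\<close> by (simp add: A_def)
  have coord: "real_of_int \<bar>x ! j - y ! j\<bar> \<le> A * real (dist x y) + (2 + 6 * real P * real m + A)"
    if xy: "length x = m" "length y = m" and j: "j < m" for x y j
  proof -
    let ?h = "brooks (\<pi> j)" and ?p = "\<lambda>a. brooks (\<pi> j) (u j [^]\<^bsub>free_group N\<^esub> (a :: int))"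
    have "\<bar>?h (W x) - ?h (W y)\<bar> \<le> 12 * int (length (\<pi> j)) * (int (dist x y) + 1)"
      using upper[OF xy] W unfolding f_def N(2) by (intro brooks_handle_walk[OF N(1) \<pi>(1)]) auto
    also have "\<dots> \<le> 12 * int P * (int (dist x y) + 1)"
      using P[OF j] by (intro mult_right_mono) auto
    finally have 1: "\<bar>?h (W x) - ?h (W y)\<bar> \<le> 12 * int P * (int (dist x y) + 1)"
      by simp
    have 2: "\<bar>?h (W v) - ?p (v ! j)\<bar> \<le> 3 * int P * int m" if "length v = m" for v
    proof -
      have "\<bar>?h (W v) - ?p (v ! j)\<bar> \<le> 3 * int (length (\<pi> j)) * int m"
        using brooks_power_product[where u = u and \<pi> = "\<pi> j" and j = j and i = 0 and as = v,
            OF N(1) u \<pi>(2) other[rule_format]] that j by (simp add: W_def)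
      also have "\<dots> \<le> 3 * int P * int m"
        using P[OF j] by (intro mult_right_mono) auto
      finally show ?thesis
        by simp
    qed
    have "\<bar>x ! j - y ! j\<bar> \<le> \<bar>?p (x ! j) - ?p (y ! j)\<bar> + 2"
      using same[rule_format, of "x ! j" "y ! j" j] same[rule_format, of "y ! j" "x ! j" j] by linarith
    then have "\<bar>x ! j - y ! j\<bar> \<le> 12 * int P * (int (dist x y) + 1) + 2 * (3 * int P * int m) + 2"
      using 1 2[OF xy(1)] 2[OF xy(2)] by linarith
    then have "real_of_int \<bar>x ! j - y ! j\<bar> \<le>
        real_of_int (12 * int P * (int (dist x y) + 1) + 2 * (3 * int P * int m) + 2)"
      by (simp only: of_int_le_iff)
    then show ?thesis
      by (simp add: A_def algebra_simps)
  qed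
  \<comment> \<open>The summand \<open>2 L\<close> serves the upper bound and \<open>m A\<close> the
    lower one; the 1 gives \<open>K \<ge> 1\<close>, so that \<open>C\<close> may be enlarged to
    \<open>K * C\<close> before dividing.\<close>
  define K where "K = 2 * real L + real m * A + 1"
  have K: "K \<ge> 1" "K \<ge> 2 * real L" "K \<ge> real m * A" "C \<ge> 0"
    using \<open>A \<ge> 12\<close> by (auto simp: K_def C_def)
  have lower: "l1_dist x y / K - C \<le> real (dist x y)" if xy: "length x = m" "length y = m" for x y
  proof -
    have "l1_dist x y \<le> (\<Sum>j < m. A * real (dist x y) + (2 + 6 * real P * real m + A))"
      unfolding l1_dist_def xy(1) using coord[OF xy] by (intro sum_mono) auto
    also have "\<dots> = real m * A * real (dist x y) + C"
      by (simp add: C_def algebra_simps)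
    also have "\<dots> \<le> K * real (dist x y) + K * C"
      using K by (intro add_mono mult_right_mono) (auto simp: mult_le_cancel_right1)
    finally have "l1_dist x y \<le> K * (real (dist x y) + C)"
      by (simp add: algebra_simps)
    then have "l1_dist x y / K \<le> real (dist x y) + C"
      using K(1) by (simp add: divide_le_eq mult.commute)
    then show ?thesis
      by simp
  qed
  have vertices: "\<forall>x. length x = m \<longrightarrow> f x \<in> ES_vertices n"
    unfolding f_def N(2) using N(1) W by (auto intro!: handle_vertex_ES_vertices)
  have bounds: "\<forall>x y. length x = m \<longrightarrow> length y = m \<longrightarrow> ES_dist n (f x) (f y) \<noteq> \<infinity> \<and>
      l1_dist x y / K - C \<le> real (the_enat (ES_dist n (f x) (f y))) \<and>
      real (the_enat (ES_dist n (f x) (f y))) \<le> K * l1_dist x y + C"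
  proof (intro allI impI)
    fix x y :: "int list" assume xy: "length x = m" "length y = m"
    have "l1_dist x y \<ge> 0"
      by (simp add: l1_dist_def sum_nonneg)
    then have "2 * real L * l1_dist x y \<le> K * l1_dist x y + C"
      using K by (intro order_trans[OF mult_right_mono[OF K(2)]]) auto
    then show "ES_dist n (f x) (f y) \<noteq> \<infinity> \<and>
        l1_dist x y / K - C \<le> real (the_enat (ES_dist n (f x) (f y))) \<and>
        real (the_enat (ES_dist n (f x) (f y))) \<le> K * l1_dist x y + C"
      using upper[OF xy] lower[OF xy] by (auto simp: dist_def)
  qed
  show "qi_embeds_Zm_ES m n"
    unfolding qi_embeds_Zm_ES_def
    by (intro exI[of _ f] exI[of _ K] exI[of _ C] conjI K(1,4) vertices bounds)
qed

end
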